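(* Let $u\in L_6(\mathbb R^3)$. Then the function $$U(x,y)=\int_{\mathbb R^3}\mathcal K_{\frac32}(x-\tilde x,y)\,u(\tilde x)\,d\tilde x,\qquad \mathcal K_{\frac32}(x,y)=\frac4{\pi^2}\frac{y^3}{(y^2+|x|^2)^3},$$ solves the extension problem $$\Delta^2U=0\ \text{ in }\mathbb R^4_+,\qquad U(\cdot,0)=u,\quad \partial_yU(\cdot,0)=0\ \text{ on }\partial\mathbb R^4_+\simeq\mathbb R^3,$$ in the sense that for every $\varphi\in C^\infty_c(\overline{\mathbb R^4_+})$ with $\varphi=\partial_y\varphi=0$ on $\mathbb R^3$ we have $$\int_{\mathbb R^4_+}U(X)\Delta^2\varphi(X)\,dX=-\int_{\mathbb R^3}u(x)\,\partial_y\Delta\varphi(x,0)\,dx.\qquad(\ast)$$ Moreover, $U$ is the unique weak solution to this extension problem (i.e. the unique function satisfying $(\ast)$ for all such $\varphi$) among the functions $U\in L^1_{\mathrm{loc}}(\overline{\mathbb R^4_+})$ satisfying the bound $$|U(X)|+y|\partial_yU(X)|+y^2|\Delta U(X)|\le C(1+|X|^N),\qquad \lim_{y\to\infty}\frac{U(x,y)}{y^2}=0\quad\forall x\in\mathbb R^3,$$ for some $N\ge1$.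
   Context: Points of $\mathbb R^4$ are $X=(x,y)$, $x\in\mathbb R^3$, $y\in\mathbb R$; $\mathbb R^4_+=\{y>0\}$ and $\mathbb R^3$ is identified with $\{y=0\}=\partial\mathbb R^4_+$; $\Delta$ is the Laplacian in $\mathbb R^4$. $L_6(\mathbb R^3):=\{u\in L^1_{\mathrm{loc}}(\mathbb R^3):\int_{\mathbb R^3}\frac{|u(x)|}{1+|x|^6}\,dx<\infty\}$. $C$ denotes a constant.
   Formalization: Uniqueness is proved a.e. among weak solutions satisfying the bound and limit; U is claimed to be that solution only if U itself satisfies them, since for u=|x|² one has U=|x|²+3y² outside the class while |x|² is a weak solution in it. *)

theory Defs
  imports "HOL-Analysis.Analysis"
begin

section \<open>Smooth functions and test functions\<close>

definition pderiv_dir :: "'a::euclidean_space \<Rightarrow> ('a \<Rightarrow> real) \<Rightarrow> 'a \<Rightarrow> real" where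
  "pderiv_dir b f X = frechet_derivative f (at X) b"

primrec Ck :: "nat \<Rightarrow> ('a::euclidean_space \<Rightarrow> real) \<Rightarrow> bool" where
  "Ck 0 f \<longleftrightarrow> continuous_on UNIV f"
| "Ck (Suc k) f \<longleftrightarrow> f differentiable_on UNIV \<and> (\<forall>b\<in>Basis. Ck k (pderiv_dir b f))"

definition smooth :: "('a::euclidean_space \<Rightarrow> real) \<Rightarrow> bool" where
  "smooth f \<longleftrightarrow> (\<forall>k. Ck k f)"

definition laplacian :: "('a::euclidean_space \<Rightarrow> real) \<Rightarrow> 'a \<Rightarrow> real" where
  "laplacian f X = (\<Sum>b\<in>Basis. pderiv_dir b (pderiv_dir b f) X)"

definition Cc_infinity :: "'a::euclidean_space set \<Rightarrow> ('a \<Rightarrow> real) set" where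
  "Cc_infinity \<Omega> =
     {\<phi>. smooth \<phi> \<and> compact (closure {X. \<phi> X \<noteq> 0}) \<and> closure {X. \<phi> X \<noteq> 0} \<subseteq> \<Omega>}"


section \<open>Locally integrable functions and weak derivatives\<close>

definition L1_loc :: "'a::euclidean_space set \<Rightarrow> ('a \<Rightarrow> real) set" where
  "L1_loc \<Omega> = {f. \<forall>K. compact K \<and> K \<subseteq> \<Omega> \<longrightarrow> f absolutely_integrable_on K}"

definition weak_pderiv_dir ::
    "'a::euclidean_space set \<Rightarrow> 'a \<Rightarrow> ('a \<Rightarrow> real) \<Rightarrow> ('a \<Rightarrow> real) \<Rightarrow> bool" where
  "weak_pderiv_dir \<Omega> b f g \<longleftrightarrow>
     f \<in> L1_loc \<Omega> \<and> g \<in> L1_loc \<Omega> \<and>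
     (\<forall>\<psi>\<in>Cc_infinity \<Omega>.
        (LINT X:\<Omega>|lebesgue. f X * pderiv_dir b \<psi> X) = - (LINT X:\<Omega>|lebesgue. g X * \<psi> X))"

definition weak_laplacian ::
    "'a::euclidean_space set \<Rightarrow> ('a \<Rightarrow> real) \<Rightarrow> ('a \<Rightarrow> real) \<Rightarrow> bool" where
  "weak_laplacian \<Omega> f h \<longleftrightarrow>
     f \<in> L1_loc \<Omega> \<and> h \<in> L1_loc \<Omega> \<and>
     (\<forall>\<psi>\<in>Cc_infinity \<Omega>.
        (LINT X:\<Omega>|lebesgue. f X * laplacian \<psi> X) = (LINT X:\<Omega>|lebesgue. h X * \<psi> X))"


section \<open>The extension problem in the half-space\<close>

text \<open>The product type carries the Euclidean norm and its \<open>Basis\<close> has four elements, so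
  \<^term>\<open>laplacian\<close> on it is the Laplacian of four-dimensional space.\<close>

type_synonym R4 = "(real^3) \<times> real"

definition half_space :: "R4 set" where
  "half_space = {X. snd X > 0}"

definition closed_half_space :: "R4 set" where
  "closed_half_space = {X. snd X \<ge> 0}"

abbreviation e\<^sub>y :: R4 where
  "e\<^sub>y \<equiv> (0, 1)"

definition L\<^sub>6 :: "(real^3 \<Rightarrow> real) set" where
  "L\<^sub>6 = {u. u \<in> L1_loc UNIV \<and> integrable lebesgue (\<lambda>x. \<bar>u x\<bar> / (1 + norm x ^ 6))}"

definition poisson_kernel :: "R4 \<Rightarrow> real" where
  "poisson_kernel = (\<lambda>(x, y). 4 / pi\<^sup>2 * (y ^ 3 / (y\<^sup>2 + (norm x)\<^sup>2) ^ 3))"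

text \<open>Only the values at points with positive last coordinate are meaningful.\<close>

definition poisson_extension :: "(real^3 \<Rightarrow> real) \<Rightarrow> R4 \<Rightarrow> real" where
  "poisson_extension u = (\<lambda>(x, y). LINT x'|lebesgue. poisson_kernel (x - x', y) * u x')"

text \<open>Smooth compactly supported functions on the closed half-space are represented by the
  functions in \<^term>\<open>Cc_infinity UNIV\<close> of which they are the restrictions; the support may meet
  the boundary.\<close>

definition boundary_test_functions :: "(R4 \<Rightarrow> real) set" where
  "boundary_test_functions =
     {\<phi> \<in> Cc_infinity UNIV. \<forall>x. \<phi> (x, 0) = 0 \<and> pderiv_dir e\<^sub>y \<phi> (x, 0) = 0}"

definition weak_solution :: "(real^3 \<Rightarrow> real) \<Rightarrow> (R4 \<Rightarrow> real) \<Rightarrow> bool" where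
  "weak_solution u U \<longleftrightarrow>
     (\<forall>\<phi>\<in>boundary_test_functions.
        (LINT X:half_space|lebesgue. U X * laplacian (laplacian \<phi>) X) =
        - (LINT x|lebesgue. u x * pderiv_dir e\<^sub>y (laplacian \<phi>) (x, 0)))"

text \<open>The derivatives in the growth bound are weak derivatives in the open half-space and the
  bound holds almost everywhere, so that no regularity beyond local integrability is
  presupposed.\<close>

definition growth_class :: "(R4 \<Rightarrow> real) set" where
  "growth_class =
     {U. U \<in> L1_loc closed_half_space \<and>
         (\<exists>(N::real)\<ge>1. \<exists>C Uy LU.
            weak_pderiv_dir half_space e\<^sub>y U Uy \<and> weak_laplacian half_space U LU \<and>
            (AE X in lebesgue. X \<in> half_space \<longrightarrow>
               \<bar>U X\<bar> + snd X * \<bar>Uy X\<bar> + (snd X)\<^sup>2 * \<bar>LU X\<bar> \<le> C * (1 + norm X powr N))) \<and>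
         (\<forall>x. ((\<lambda>y. U (x, y) / y\<^sup>2) \<longlongrightarrow> 0) at_top)}"

end

theory Submission
  imports Defs "HOL-Probability.Probability"
begin

text \<open>The kernel is biharmonic up to its pole, so Green's identity on the half-space, applied to the
  kernel shifted by \<open>s > 0\<close> in the direction \<open>y\<close>, leaves two boundary terms. As \<open>s\<close> tends to \<open>0\<close>,
  the kernel is an approximate identity and its \<open>y\<close>-derivative converges weakly to \<open>0\<close>; Fubini
  transfers the result to the extension of \<open>u\<close>.

  For uniqueness let \<open>D\<close> be the difference of two solutions. Testing with high \<open>y\<close>-derivatives of a
  regularised fundamental solution \<open>log |X|\<close>, corrected by Duffin's reflection so as to have zero
  Dirichlet data, is allowed because enough derivatives decay faster than \<open>D\<close> grows. It shows that the
  mollifications of \<open>D\<close> have vanishing \<open>y\<close>-derivative of some order, that is, \<open>D\<close> is almost everywhere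
  a polynomial in \<open>y\<close> along lattices of points, and the limit condition makes it affine in \<open>y\<close>. An
  affine \<open>D\<close> annihilates every product \<open>\<zeta>(x) f''(y)\<close> for which \<open>f\<close> has zero Cauchy data at \<open>0\<close>. The
  weak equation for \<open>\<zeta>(x) g(y)\<close>, with \<open>g\<close> starting like \<open>y\<^sup>2\<close> or \<open>y\<^sup>3\<close>, then reduces to
  its fourth \<open>y\<close>-derivative and removes the condition on the Cauchy data, so that \<open>D\<close> annihilates
  the indicator of every box.\<close>

section \<open>Directional derivatives and smooth functions\<close>

lemma pderiv_dir_eq: "(f has_derivative f') (at X) \<Longrightarrow> pderiv_dir b f X = f' b"
  unfolding pderiv_dir_def by (drule frechet_derivative_at) simp

lemma differentiable_imp_has_derivative_pderiv:
  assumes "f differentiable (at X)"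
  shows "(f has_derivative (\<lambda>v. pderiv_dir v f X)) (at X)"
  using assms unfolding pderiv_dir_def by (simp add: frechet_derivative_works)

lemma differentiable_on_UNIV_D: "f differentiable_on UNIV \<Longrightarrow> f differentiable (at X)"
  by (simp add: differentiable_on_def)

lemma pderiv_dir_cong_open:
  assumes "open S" "X \<in> S" "\<And>Y. Y \<in> S \<Longrightarrow> f Y = g Y"
  shows "pderiv_dir b f X = pderiv_dir b g X"
proof -
  have "(f has_derivative f') (at X) \<longleftrightarrow> (g has_derivative f') (at X)" for f'
    using assms by (metis has_derivative_transform_within_open)
  then show ?thesis
    unfolding pderiv_dir_def frechet_derivative_def by simp
qed

lemma pderiv_dir_add:
  assumes "f differentiable_on UNIV" "g differentiable_on UNIV"
  shows "pderiv_dir b (\<lambda>X. f X + g X) = (\<lambda>X. pderiv_dir b f X + pderiv_dir b g X)"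
  by (rule ext, rule pderiv_dir_eq)
     (intro has_derivative_add differentiable_imp_has_derivative_pderiv differentiable_on_UNIV_D assms)

lemma pderiv_dir_mult:
  assumes "f differentiable_on UNIV" "g differentiable_on UNIV"
  shows "pderiv_dir b (\<lambda>X. f X * g X) = (\<lambda>X. pderiv_dir b f X * g X + f X * pderiv_dir b g X)"
  apply (rule ext)
  subgoal for X
    using has_derivative_mult[OF differentiable_imp_has_derivative_pderiv[OF differentiable_on_UNIV_D[OF assms(1), of X]]
        differentiable_imp_has_derivative_pderiv[OF differentiable_on_UNIV_D[OF assms(2), of X]]]
    by (subst pderiv_dir_eq) (auto simp: algebra_simps)
  done

lemma pderiv_dir_const [simp]: "pderiv_dir b (\<lambda>X. c) = (\<lambda>X. 0)"
  by (rule ext, rule pderiv_dir_eq) simp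

lemma pderiv_dir_inner [simp]: "pderiv_dir b (\<lambda>X. X \<bullet> v) = (\<lambda>X. b \<bullet> v)"
  by (rule ext, rule pderiv_dir_eq) (auto intro!: derivative_eq_intros)

lemma pderiv_dir_sum_Basis:
  assumes "f differentiable (at X)"
  shows "pderiv_dir v f X = (\<Sum>c\<in>Basis. (v \<bullet> c) * pderiv_dir c f X)"
proof -
  have lin: "linear (\<lambda>v. pderiv_dir v f X)"
    using differentiable_imp_has_derivative_pderiv[OF assms] has_derivative_bounded_linear
      bounded_linear.linear by blast
  have "pderiv_dir v f X = pderiv_dir (\<Sum>c\<in>Basis. (v \<bullet> c) *\<^sub>R c) f X"
    by (simp add: euclidean_representation)
  also have "\<dots> = (\<Sum>c\<in>Basis. (v \<bullet> c) * pderiv_dir c f X)"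
    by (simp only: linear_sum[OF lin] linear_scale[OF lin] real_scaleR_def)
  finally show ?thesis .
qed

lemma has_derivative_affine_comp:
  assumes "bounded_linear L" "f differentiable_on UNIV"
  shows "((\<lambda>X. f (a + L X)) has_derivative (\<lambda>v. pderiv_dir (L v) f (a + L X))) (at X)"
proof -
  have "((\<lambda>X. a + L X) has_derivative L) (at X)"
    using bounded_linear_imp_has_derivative[OF assms(1)] by (auto intro!: derivative_eq_intros)
  from diff_chain_at[OF this differentiable_imp_has_derivative_pderiv[OF differentiable_on_UNIV_D[OF assms(2)]]]
  show ?thesis by (simp add: o_def)
qed

lemma pderiv_dir_affine:
  assumes "bounded_linear L" "f differentiable_on UNIV"
  shows "pderiv_dir b (\<lambda>X. f (a + L X)) = (\<lambda>X. pderiv_dir (L b) f (a + L X))"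
  by (rule ext, rule pderiv_dir_eq) (rule has_derivative_affine_comp[OF assms])

lemma Ck_SucD: "Ck (Suc k) f \<Longrightarrow> Ck k f"
  by (induction k arbitrary: f) (auto intro: differentiable_imp_continuous_on)

lemma Ck_add: "Ck k f \<Longrightarrow> Ck k g \<Longrightarrow> Ck k (\<lambda>X. f X + g X)"
proof (induction k arbitrary: f g)
  case 0 then show ?case by (simp add: continuous_on_add)
next
  case (Suc k)
  then show ?case by (auto simp: pderiv_dir_add intro!: differentiable_on_add)
qed

lemma Ck_mult: "Ck k f \<Longrightarrow> Ck k g \<Longrightarrow> Ck k (\<lambda>X. f X * g X)"
proof (induction k arbitrary: f g)
  case 0 then show ?case by (simp add: continuous_on_mult)
next
  case (Suc k)
  have "Ck k f" "Ck k g" using Suc.prems by (auto dest: Ck_SucD simp del: Ck.simps)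
  with Suc show ?case by (auto simp: pderiv_dir_mult intro!: differentiable_on_mult Ck_add)
qed

lemma Ck_const: "Ck k (\<lambda>X. c)"
  by (induction k arbitrary: c) auto

lemma Ck_inner: "Ck k (\<lambda>X. X \<bullet> v)"
  by (cases k) (auto intro!: continuous_intros derivative_intros Ck_const
      bounded_linear_imp_differentiable_on bounded_linear_inner_left)

lemma Ck_sum: "(\<And>i. i \<in> I \<Longrightarrow> Ck k (f i)) \<Longrightarrow> Ck k (\<lambda>X. \<Sum>i\<in>I. f i X)"
  by (induction I rule: infinite_finite_induct) (auto intro: Ck_const Ck_add)

lemma Ck_affine:
  assumes L: "bounded_linear L"
  shows "Ck k f \<Longrightarrow> Ck k (\<lambda>X. f (a + L X))"
proof (induction k arbitrary: f)
  case 0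
  have "continuous_on UNIV (\<lambda>X. a + L X)"
    using L by (intro continuous_intros linear_continuous_on)
  from continuous_on_compose2[OF _ this] 0 show ?case by auto
next
  case (Suc k)
  then have d: "f differentiable_on UNIV" by simp
  have "pderiv_dir b (\<lambda>X. f (a + L X)) = (\<lambda>X. \<Sum>c\<in>Basis. (L b \<bullet> c) * pderiv_dir c f (a + L X))" for b
    unfolding pderiv_dir_affine[OF L d]
    by (rule ext, rule pderiv_dir_sum_Basis, rule differentiable_on_UNIV_D[OF d])
  moreover have "(\<lambda>X. f (a + L X)) differentiable_on UNIV"
    using has_derivative_affine_comp[OF L d] by (auto simp: differentiable_on_def differentiable_def)
  ultimately show ?case using Suc by (auto intro!: Ck_sum Ck_mult Ck_const)
qed

lemma Ck_comp_real:
  fixes g :: "'a::euclidean_space \<Rightarrow> real"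
  assumes h: "\<And>j X. (h j has_real_derivative h (Suc j) (g X)) (at (g X))"
  shows "Ck k g \<Longrightarrow> Ck k (\<lambda>X. h j (g X))"
proof (induction k arbitrary: j)
  case 0
  show ?case
    using 0 h by (auto simp: continuous_on_eq_continuous_at intro!: isCont_o2[where g = "h j"] DERIV_isCont)
next
  case (Suc k)
  have der: "((\<lambda>X. h j (g X)) has_derivative (\<lambda>v. pderiv_dir v g X * h (Suc j) (g X))) (at X)" for X
  proof -
    have "g differentiable (at X)" using Suc.prems by (auto simp: differentiable_on_def)
    from diff_chain_at[OF differentiable_imp_has_derivative_pderiv[OF this]
        h[where X = X and j = j, unfolded has_field_derivative_def]]
    show ?thesis by (simp add: o_def mult.commute)
  qed
  have "pderiv_dir b (\<lambda>X. h j (g X)) = (\<lambda>X. pderiv_dir b g X * h (Suc j) (g X))" for b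
    by (rule ext, rule pderiv_dir_eq, rule der)
  moreover have "(\<lambda>X. h j (g X)) differentiable_on UNIV"
    using der by (auto simp: differentiable_on_def differentiable_def)
  ultimately show ?case using Suc Ck_SucD[OF Suc.prems] by (auto intro!: Ck_mult)
qed

lemma has_derivative_inverse_real:
  assumes "f differentiable (at X)" "f X \<noteq> (0::real)"
  shows "((\<lambda>X. inverse (f X)) has_derivative (\<lambda>v. - pderiv_dir v f X * (inverse (f X) * inverse (f X)))) (at X)"
  using Deriv.has_derivative_inverse[OF assms(2) differentiable_imp_has_derivative_pderiv[OF assms(1)]]
  by (simp add: mult_ac)

lemma Ck_inverse:
  assumes pos: "\<And>X. f X \<noteq> 0"
  shows "Ck k f \<Longrightarrow> Ck k (\<lambda>X. inverse (f X))"
proof (induction k)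
  case 0 then show ?case using pos by (simp add: continuous_on_inverse)
next
  case (Suc k)
  have der: "((\<lambda>X. inverse (f X)) has_derivative (\<lambda>v. (- 1) * (pderiv_dir v f X * (inverse (f X) * inverse (f X))))) (at X)" for X
    using has_derivative_inverse_real[of f X] pos[of X] Suc.prems by (simp add: differentiable_on_def)
  have "pderiv_dir b (\<lambda>X. inverse (f X)) = (\<lambda>X. (- 1) * (pderiv_dir b f X * (inverse (f X) * inverse (f X))))" for b
    by (rule ext, rule pderiv_dir_eq, rule der)
  moreover have "(\<lambda>X. inverse (f X)) differentiable_on UNIV"
    using der unfolding differentiable_on_def differentiable_def by blast
  moreover have "Ck k (\<lambda>X. inverse (f X))"
    using Suc.IH Ck_SucD[OF Suc.prems] by blast
  moreover from this have "Ck k (\<lambda>X. (- 1) * (pderiv_dir b f X * (inverse (f X) * inverse (f X))))" if "b \<in> Basis" for b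
    using Suc.prems that by (intro Ck_mult Ck_const) auto
  ultimately show ?case by auto
qed

lemma Ck_ln:
  assumes pos: "\<And>X. f X > 0" and k: "Ck k f"
  shows "Ck k (\<lambda>X. ln (f X))"
proof (cases k)
  case 0 
  then show ?thesis using pos k by (auto intro!: continuous_on_ln simp: less_imp_neq[symmetric])
next
  case (Suc j)
  have der: "((\<lambda>X. ln (f X)) has_derivative (\<lambda>v. pderiv_dir v f X * inverse (f X))) (at X)" for X
    using has_derivative_ln[of f X, OF pos differentiable_imp_has_derivative_pderiv[of f X]] k Suc
    by (simp add: differentiable_on_def)
  have "pderiv_dir b (\<lambda>X. ln (f X)) = (\<lambda>X. pderiv_dir b f X * inverse (f X))" for b
    by (rule ext, rule pderiv_dir_eq, rule der)
  moreover have "(\<lambda>X. ln (f X)) differentiable_on UNIV"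
    using der unfolding differentiable_on_def differentiable_def by blast
  moreover have "Ck j (\<lambda>X. inverse (f X))"
    by (rule Ck_inverse) (use pos k Suc Ck_SucD in \<open>auto simp: less_imp_neq[symmetric] simp del: Ck.simps\<close>)
  ultimately show ?thesis using k Suc by (auto intro!: Ck_mult)
qed

named_theorems smooth_intros

lemma smooth_const [smooth_intros]: "smooth (\<lambda>X. c)"
  by (simp add: smooth_def Ck_const)
lemma smooth_inner [smooth_intros]: "smooth (\<lambda>X. X \<bullet> v)"
  by (simp add: smooth_def Ck_inner)
lemma smooth_add [smooth_intros]: "smooth f \<Longrightarrow> smooth g \<Longrightarrow> smooth (\<lambda>X. f X + g X)"
  by (simp add: smooth_def Ck_add)
lemma smooth_mult [smooth_intros]: "smooth f \<Longrightarrow> smooth g \<Longrightarrow> smooth (\<lambda>X. f X * g X)"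
  by (simp add: smooth_def Ck_mult)
lemma smooth_uminus [smooth_intros]: "smooth f \<Longrightarrow> smooth (\<lambda>X. - f X)"
  using smooth_mult[OF smooth_const[of "-1"], of f] by simp
lemma smooth_diff [smooth_intros]: "smooth f \<Longrightarrow> smooth g \<Longrightarrow> smooth (\<lambda>X. f X - g X)"
  using smooth_add[OF _ smooth_uminus, of f g] by simp
lemma smooth_sum [smooth_intros]: "(\<And>i. i \<in> I \<Longrightarrow> smooth (f i)) \<Longrightarrow> smooth (\<lambda>X. \<Sum>i\<in>I. f i X)"
  by (simp add: smooth_def Ck_sum)
lemma smooth_prod [smooth_intros]: "(\<And>i. i \<in> I \<Longrightarrow> smooth (f i)) \<Longrightarrow> smooth (\<lambda>X. \<Prod>i\<in>I. f i X)"
  by (induction I rule: infinite_finite_induct) (auto intro: smooth_intros)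
lemma smooth_power [smooth_intros]: "smooth f \<Longrightarrow> smooth (\<lambda>X. f X ^ n)"
  by (induction n) (auto intro: smooth_intros)
lemma smooth_inverse [smooth_intros]: "smooth f \<Longrightarrow> (\<And>X. f X \<noteq> 0) \<Longrightarrow> smooth (\<lambda>X. inverse (f X))"
  by (simp add: smooth_def Ck_inverse)
lemma smooth_divide [smooth_intros]:
  "smooth f \<Longrightarrow> smooth g \<Longrightarrow> (\<And>X. g X \<noteq> 0) \<Longrightarrow> smooth (\<lambda>X. f X / g X)"
  unfolding divide_inverse by (intro smooth_intros)
lemma smooth_ln [smooth_intros]: "smooth f \<Longrightarrow> (\<And>X. f X > 0) \<Longrightarrow> smooth (\<lambda>X. ln (f X))"
  by (simp add: smooth_def Ck_ln)
lemma smooth_affine: "smooth f \<Longrightarrow> bounded_linear L \<Longrightarrow> smooth (\<lambda>X. f (a + L X))"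
  by (simp add: smooth_def Ck_affine)
lemma smooth_linear: "smooth f \<Longrightarrow> bounded_linear L \<Longrightarrow> smooth (\<lambda>X. f (L X))"
  using smooth_affine[of f L 0] by simp
lemma smooth_id [smooth_intros]: "smooth (\<lambda>x::real. x)"
  using smooth_inner[of "1::real"] by simp

lemma smooth_imp_differentiable: "smooth f \<Longrightarrow> f differentiable_on UNIV"
  unfolding smooth_def by (drule spec[of _ "Suc 0"]) simp

lemma smooth_imp_continuous: "smooth f \<Longrightarrow> continuous_on UNIV f"
  by (simp add: smooth_imp_differentiable differentiable_imp_continuous_on)

lemma smooth_imp_measurable: "smooth f \<Longrightarrow> f \<in> borel_measurable borel"
  by (simp add: smooth_imp_continuous borel_measurable_continuous_onI)

lemma smooth_pderiv_Basis: "smooth f \<Longrightarrow> b \<in> Basis \<Longrightarrow> smooth (pderiv_dir b f)"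
  unfolding smooth_def by (metis Ck.simps(2))

lemma smooth_pderiv [smooth_intros]: "smooth f \<Longrightarrow> smooth (pderiv_dir v f)"
proof -
  assume f: "smooth f"
  have "pderiv_dir v f = (\<lambda>X. \<Sum>c\<in>Basis. (v \<bullet> c) * pderiv_dir c f X)"
    by (rule ext, rule pderiv_dir_sum_Basis)
       (rule differentiable_on_UNIV_D[OF smooth_imp_differentiable[OF f]])
  then show ?thesis using f by (auto intro!: smooth_intros smooth_pderiv_Basis)
qed

lemma smoothI_coinduct:
  assumes "P f" and "\<And>f. P f \<Longrightarrow> f differentiable_on UNIV"
    and "\<And>f b. P f \<Longrightarrow> b \<in> Basis \<Longrightarrow> P (pderiv_dir b f)"
  shows "smooth f"
proof -
  have "Ck k f" if "P f" for k f
    using that assms(2,3) by (induction k arbitrary: f) (auto intro: differentiable_imp_continuous_on)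
  then show ?thesis using assms(1) by (simp add: smooth_def)
qed

lemma smooth_has_derivative:
  "smooth f \<Longrightarrow> (f has_derivative (\<lambda>v. pderiv_dir v f X)) (at X)"
  by (intro differentiable_imp_has_derivative_pderiv differentiable_on_UNIV_D smooth_imp_differentiable)

lemma smooth_has_real_derivative_line:
  assumes "smooth f"
  shows "((\<lambda>t. f (X + t *\<^sub>R v)) has_real_derivative pderiv_dir v f (X + t *\<^sub>R v)) (at t within S)"
proof -
  have L: "linear (\<lambda>v. pderiv_dir v f Y)" for Y
    using smooth_has_derivative[OF assms] has_derivative_bounded_linear bounded_linear.linear by blast
  have "((\<lambda>t. X + t *\<^sub>R v) has_derivative (\<lambda>t. t *\<^sub>R v)) (at t)"
    by (auto intro!: derivative_eq_intros)
  from diff_chain_at[OF this smooth_has_derivative[OF assms]]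
  have "((\<lambda>t. f (X + t *\<^sub>R v)) has_real_derivative pderiv_dir v f (X + t *\<^sub>R v)) (at t)"
    by (simp add: o_def has_field_derivative_def linear_scale[OF L] mult.commute[of _ "pderiv_dir v f (X + t *\<^sub>R v)"] cong del: if_weak_cong)
  then show ?thesis by (rule has_field_derivative_at_within)
qed

lemma smooth_has_real_derivative:
  "smooth f \<Longrightarrow> (f has_real_derivative pderiv_dir 1 f t) (at t within S)"
  using smooth_has_real_derivative_line[of f 0 1 t S] by simp

lemma pderiv_dir_real_eq:
  "(f has_real_derivative d) (at t) \<Longrightarrow> pderiv_dir 1 f t = d"
  using pderiv_dir_eq[of f "(*) d" t 1] by (simp add: has_field_derivative_def)

lemma smooth_comp_real:
  assumes "smooth \<theta>" "smooth g"
  shows "smooth (\<lambda>X. \<theta> (g X))"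
proof -
  define h where "h j = (pderiv_dir 1 ^^ j) \<theta>" for j
  have s: "smooth (h j)" for j unfolding h_def by (induction j) (auto intro: smooth_intros assms)
  have "(h j has_real_derivative h (Suc j) (g X)) (at (g X))" for j X
    using smooth_has_real_derivative[OF s, of j] by (simp add: h_def)
  from Ck_comp_real[of h g, OF this, of _ 0] show ?thesis
    using assms by (simp add: smooth_def h_def)
qed

lemma pderiv_dir_chain:
  assumes "(\<theta> has_real_derivative d) (at (g X))" "smooth g"
  shows "pderiv_dir b (\<lambda>X. \<theta> (g X)) X = d * pderiv_dir b g X"
  by (rule pderiv_dir_eq)
    (use diff_chain_at[OF smooth_has_derivative[OF assms(2)] assms(1)[unfolded has_field_derivative_def]]
     in \<open>simp add: o_def\<close>)

lemma smooth_norm_square [smooth_intros]: "smooth (\<lambda>X. (norm X)\<^sup>2)"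
  unfolding power2_norm_eq_inner by (subst euclidean_inner) (intro smooth_intros)

lemma pderiv_dir_norm_square: "pderiv_dir b (\<lambda>X. (norm X)\<^sup>2) = (\<lambda>X. 2 * (X \<bullet> b))"
  by (rule ext, rule pderiv_dir_eq)
     (auto simp: power2_norm_eq_inner inner_commute intro!: derivative_eq_intros)

lemma pderiv_dir_cmult: "smooth f \<Longrightarrow> pderiv_dir b (\<lambda>X. c * f X) = (\<lambda>X. c * pderiv_dir b f X)"
  by (subst pderiv_dir_mult) (auto intro: smooth_imp_differentiable)

lemma pderiv_dir_diff:
  "smooth f \<Longrightarrow> smooth g \<Longrightarrow> pderiv_dir b (\<lambda>X. f X - g X) = (\<lambda>X. pderiv_dir b f X - pderiv_dir b g X)"
  by (rule ext, rule pderiv_dir_eq) (intro has_derivative_diff smooth_has_derivative)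

lemma pderiv_dir_sum:
  assumes "\<And>i. i \<in> I \<Longrightarrow> smooth (f i)"
  shows "pderiv_dir b (\<lambda>X. \<Sum>i\<in>I. f i X) = (\<lambda>X. \<Sum>i\<in>I. pderiv_dir b (f i) X)"
  by (rule ext, rule pderiv_dir_eq) (intro has_derivative_sum smooth_has_derivative assms)

lemma smooth_second_difference:
  assumes f: "smooth f" and t: "t > (0::real)"
  obtains s r where "0 < s" "s < t" "0 < r" "r < t"
    "f (X + t *\<^sub>R b + t *\<^sub>R c) - f (X + t *\<^sub>R b) - f (X + t *\<^sub>R c) + f X
       = t\<^sup>2 * pderiv_dir c (pderiv_dir b f) (X + s *\<^sub>R b + r *\<^sub>R c)"
proof -
  define g where "g s = f ((X + t *\<^sub>R c) + s *\<^sub>R b) - f (X + s *\<^sub>R b)" for s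
  have "(g has_real_derivative pderiv_dir b f ((X + t *\<^sub>R c) + s *\<^sub>R b) - pderiv_dir b f (X + s *\<^sub>R b)) (at s)" for s
    unfolding g_def by (intro derivative_intros smooth_has_real_derivative_line f)
  from MVT2[OF t, of g, OF this] obtain s where s: "0 < s" "s < t"
    "g t - g 0 = t * (pderiv_dir b f ((X + t *\<^sub>R c) + s *\<^sub>R b) - pderiv_dir b f (X + s *\<^sub>R b))"
    by auto
  have "((\<lambda>r. pderiv_dir b f ((X + s *\<^sub>R b) + r *\<^sub>R c)) has_real_derivative
      pderiv_dir c (pderiv_dir b f) ((X + s *\<^sub>R b) + r *\<^sub>R c)) (at r)" for r
    by (intro smooth_has_real_derivative_line smooth_intros f)
  from MVT2[OF t, of "\<lambda>r. pderiv_dir b f ((X + s *\<^sub>R b) + r *\<^sub>R c)", OF this] obtain r where r: "0 < r" "r < t"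
    "pderiv_dir b f ((X + s *\<^sub>R b) + t *\<^sub>R c) - pderiv_dir b f (X + s *\<^sub>R b)
     = t * pderiv_dir c (pderiv_dir b f) (X + s *\<^sub>R b + r *\<^sub>R c)"
    by auto
  show ?thesis
    by (rule that[OF s(1,2) r(1,2)])
       (use s(3) r(3) in \<open>simp add: g_def power2_eq_square algebra_simps\<close>)
qed

lemma pderiv_dir_commute:
  assumes f: "smooth f"
  shows "pderiv_dir b (pderiv_dir c f) = pderiv_dir c (pderiv_dir b f)"
proof
  fix X
  define P where "P n = X + (fst n) *\<^sub>R b + (snd n) *\<^sub>R c" for n :: "real \<times> real"
  have "\<exists>n. \<forall>i::nat. (\<bar>fst (n i)\<bar> \<le> inverse (Suc i) \<and> \<bar>snd (n i)\<bar> \<le> inverse (Suc i)) \<and>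
       (\<exists>m. \<bar>fst m\<bar> \<le> inverse (Suc i) \<and> \<bar>snd m\<bar> \<le> inverse (Suc i) \<and>
         pderiv_dir c (pderiv_dir b f) (P (n i)) = pderiv_dir b (pderiv_dir c f) (P m))"
  proof (rule choice, rule allI)
    fix i :: nat
    define t where "t = inverse (real (Suc i))"
    have t: "t > 0" by (simp add: t_def)
    obtain s r where 1: "0 < s" "s < t" "0 < r" "r < t"
      "f (X + t *\<^sub>R b + t *\<^sub>R c) - f (X + t *\<^sub>R b) - f (X + t *\<^sub>R c) + f X
       = t\<^sup>2 * pderiv_dir c (pderiv_dir b f) (X + s *\<^sub>R b + r *\<^sub>R c)"
      using smooth_second_difference[OF f t] by metis
    obtain s' r' where 2: "0 < s'" "s' < t" "0 < r'" "r' < t"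
      "f (X + t *\<^sub>R c + t *\<^sub>R b) - f (X + t *\<^sub>R c) - f (X + t *\<^sub>R b) + f X
       = t\<^sup>2 * pderiv_dir b (pderiv_dir c f) (X + s' *\<^sub>R c + r' *\<^sub>R b)"
      using smooth_second_difference[OF f t] by metis
    have "X + t *\<^sub>R b + t *\<^sub>R c = X + t *\<^sub>R c + t *\<^sub>R b" by simp
    with 1(5) 2(5) t have "pderiv_dir c (pderiv_dir b f) (X + s *\<^sub>R b + r *\<^sub>R c)
        = pderiv_dir b (pderiv_dir c f) (X + s' *\<^sub>R c + r' *\<^sub>R b)"
      by (auto simp: algebra_simps)
    with 1 2 show "\<exists>n. (\<bar>fst n\<bar> \<le> inverse (Suc i) \<and> \<bar>snd n\<bar> \<le> inverse (Suc i)) \<and>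
       (\<exists>m. \<bar>fst m\<bar> \<le> inverse (Suc i) \<and> \<bar>snd m\<bar> \<le> inverse (Suc i) \<and>
         pderiv_dir c (pderiv_dir b f) (P n) = pderiv_dir b (pderiv_dir c f) (P m))"
      unfolding P_def t_def
      by (intro exI[of _ "(s, r)"] conjI exI[of _ "(r', s')"]) (auto simp: algebra_simps)
  qed
  then obtain n m where nm: "\<And>i::nat. \<bar>fst (n i)\<bar> \<le> inverse (Suc i) \<and> \<bar>snd (n i)\<bar> \<le> inverse (Suc i)"
      "\<And>i::nat. \<bar>fst (m i)\<bar> \<le> inverse (Suc i) \<and> \<bar>snd (m i)\<bar> \<le> inverse (Suc i)"
      "\<And>i. pderiv_dir c (pderiv_dir b f) (P (n i)) = pderiv_dir b (pderiv_dir c f) (P (m i))"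
    by metis
  have lim: "(\<lambda>i. g (P (k i))) \<longlonglongrightarrow> g X"
    if g: "smooth g" and k: "\<And>i::nat. \<bar>fst (k i)\<bar> \<le> inverse (Suc i) \<and> \<bar>snd (k i)\<bar> \<le> inverse (Suc i)" for g k
  proof -
    have "(\<lambda>i. fst (k i)) \<longlonglongrightarrow> 0" "(\<lambda>i. snd (k i)) \<longlonglongrightarrow> 0"
      by (rule Lim_null_comparison[OF _ LIMSEQ_inverse_real_of_nat], use k in simp)+
    then have "(\<lambda>i. P (k i)) \<longlonglongrightarrow> X + 0 *\<^sub>R b + 0 *\<^sub>R c"
      unfolding P_def by (intro tendsto_intros)
    then show ?thesis
      using smooth_imp_continuous[OF g] continuous_on_tendsto_compose[of UNIV g] by auto
  qed
  have "(\<lambda>i. pderiv_dir c (pderiv_dir b f) (P (n i))) \<longlonglongrightarrow> pderiv_dir c (pderiv_dir b f) X"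
    by (intro lim nm smooth_intros f)
  moreover have "(\<lambda>i. pderiv_dir b (pderiv_dir c f) (P (m i))) \<longlonglongrightarrow> pderiv_dir b (pderiv_dir c f) X"
    by (intro lim nm smooth_intros f)
  ultimately show "pderiv_dir b (pderiv_dir c f) X = pderiv_dir c (pderiv_dir b f) X"
    using nm(3) LIMSEQ_unique by fastforce
qed

section \<open>The Laplacian\<close>

lemma laplacian_eq: "laplacian f = (\<lambda>X. \<Sum>b\<in>Basis. pderiv_dir b (pderiv_dir b f) X)"
  by (rule ext) (simp add: laplacian_def)

lemma smooth_laplacian [smooth_intros]: "smooth f \<Longrightarrow> smooth (laplacian f)"
  unfolding laplacian_eq by (intro smooth_intros)

lemma laplacian_cong_open:
  assumes "open S" "X \<in> S" "\<And>Y. Y \<in> S \<Longrightarrow> f Y = g Y"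
  shows "laplacian f X = laplacian g X"
  unfolding laplacian_def
  by (intro sum.cong refl pderiv_dir_cong_open[OF assms(1,2)] pderiv_dir_cong_open[OF assms(1)]) (use assms in auto)

lemma laplacian_add: "smooth f \<Longrightarrow> smooth g \<Longrightarrow> laplacian (\<lambda>X. f X + g X) = (\<lambda>X. laplacian f X + laplacian g X)"
  by (simp add: laplacian_eq pderiv_dir_add smooth_imp_differentiable smooth_pderiv sum.distrib)

lemma laplacian_diff: "smooth f \<Longrightarrow> smooth g \<Longrightarrow> laplacian (\<lambda>X. f X - g X) = (\<lambda>X. laplacian f X - laplacian g X)"
  by (simp add: laplacian_eq pderiv_dir_diff smooth_pderiv sum_subtractf)

lemma laplacian_cmult: "smooth f \<Longrightarrow> laplacian (\<lambda>X. c * f X) = (\<lambda>X. c * laplacian f X)"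
  by (simp add: laplacian_eq pderiv_dir_cmult smooth_pderiv sum_distrib_left)

lemma laplacian_mult:
  assumes "smooth f" "smooth g"
  shows "laplacian (\<lambda>X. f X * g X) = (\<lambda>X. laplacian f X * g X
     + 2 * (\<Sum>b\<in>Basis. pderiv_dir b f X * pderiv_dir b g X) + f X * laplacian g X)"
proof -
  have "pderiv_dir b (pderiv_dir b (\<lambda>X. f X * g X)) = (\<lambda>X. pderiv_dir b (pderiv_dir b f) X * g X
      + 2 * (pderiv_dir b f X * pderiv_dir b g X) + f X * pderiv_dir b (pderiv_dir b g) X)" for b
    using assms by (simp add: pderiv_dir_mult pderiv_dir_add smooth_imp_differentiable smooth_intros algebra_simps)
  then show ?thesis
    by (simp add: laplacian_eq sum.distrib sum_distrib_left sum_distrib_right)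
qed

lemma laplacian_pderiv_commute:
  assumes "smooth f"
  shows "laplacian (pderiv_dir b f) = pderiv_dir b (laplacian f)"
proof -
  have "pderiv_dir c (pderiv_dir c (pderiv_dir b f)) = pderiv_dir b (pderiv_dir c (pderiv_dir c f))" for c
    using pderiv_dir_commute[OF assms, of c b] pderiv_dir_commute[OF smooth_pderiv[OF assms], of c b] by metis
  then show ?thesis
    unfolding laplacian_eq by (subst pderiv_dir_sum) (auto intro!: smooth_intros assms)
qed

lemma laplacian_affine_scale:
  assumes L: "bounded_linear L" "\<And>b. b \<in> Basis \<Longrightarrow> L b = s b *\<^sub>R b" "\<And>b. b \<in> Basis \<Longrightarrow> (s b)\<^sup>2 = r"
    and f: "smooth f"
  shows "laplacian (\<lambda>X. f (a + L X)) = (\<lambda>X. r * laplacian f (a + L X))"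
proof -
  have lin: "linear (\<lambda>v. pderiv_dir v g Y)" if "smooth g" for Y and g :: "'a \<Rightarrow> real"
    using smooth_has_derivative[OF that] has_derivative_bounded_linear bounded_linear.linear by blast
  have "pderiv_dir b (pderiv_dir b (\<lambda>X. f (a + L X))) = (\<lambda>X. r * pderiv_dir b (pderiv_dir b f) (a + L X))"
    if b: "b \<in> Basis" for b
  proof -
    have s: "smooth (pderiv_dir b f)" using f by (intro smooth_intros)
    have 1: "pderiv_dir b (\<lambda>X. f (a + L X)) = (\<lambda>X. s b * pderiv_dir b f (a + L X))"
      unfolding pderiv_dir_affine[OF L(1) smooth_imp_differentiable[OF f]]
      using b L(2) by (simp add: linear_scale[OF lin[OF f]])
    have 2: "pderiv_dir b (\<lambda>X. pderiv_dir b f (a + L X)) = (\<lambda>X. s b * pderiv_dir b (pderiv_dir b f) (a + L X))"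
      unfolding pderiv_dir_affine[OF L(1) smooth_imp_differentiable[OF s]]
      using b L(2) by (simp add: linear_scale[OF lin[OF s]])
    show ?thesis
      unfolding 1 by (subst pderiv_dir_cmult[OF smooth_affine[OF s L(1)]])
        (simp add: 2 L(3)[OF b, symmetric] power2_eq_square mult_ac)
  qed
  then show ?thesis by (simp add: laplacian_eq sum_distrib_left)
qed

section \<open>Smooth cutoffs\<close>

definition flat_fun :: "real poly \<Rightarrow> real \<Rightarrow> real" where
  "flat_fun p x = (if x > 0 then poly p (1 / x) * exp (- (1 / x)) else 0)"

lemma poly_times_exp_minus_tendsto_0: "((\<lambda>y::real. poly q y * exp (- y)) \<longlongrightarrow> 0) at_top"
proof -
  have "((\<lambda>y::real. \<Sum>i\<le>degree q. coeff q i * (y ^ i / exp y)) \<longlongrightarrow> (\<Sum>i\<le>degree q. coeff q i * 0)) at_top"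
    by (intro tendsto_intros tendsto_power_div_exp_0)
  then show ?thesis
    by (simp add: poly_altdef sum_distrib_left exp_minus divide_inverse mult_ac)
qed

lemma flat_fun_has_real_derivative:
  "(flat_fun p has_real_derivative flat_fun ([:0, 0, 1:] * (p - pderiv p)) x) (at x)"
proof -
  consider "x > 0" | "x < 0" | "x = 0" by linarith
  then show ?thesis
  proof cases
    case 1
    have "((\<lambda>x. poly p (1 / x) * exp (- (1 / x))) has_real_derivative
        flat_fun ([:0, 0, 1:] * (p - pderiv p)) x) (at x)"
      using 1 by (auto intro!: derivative_eq_intros DERIV_chain2[OF poly_DERIV]
          simp: flat_fun_def field_simps power2_eq_square)
    then show ?thesis
      by (rule has_field_derivative_transform_within_open[of _ _ _ "{0<..}"])
         (use 1 in \<open>auto simp: flat_fun_def\<close>)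
  next
    case 2
    have "((\<lambda>x. 0) has_real_derivative flat_fun ([:0, 0, 1:] * (p - pderiv p)) x) (at x)"
      using 2 by (simp add: flat_fun_def)
    then show ?thesis
      by (rule has_field_derivative_transform_within_open[of _ _ _ "{..<0}"])
         (use 2 in \<open>auto simp: flat_fun_def\<close>)
  next
    case 3
    have "((\<lambda>h. flat_fun p h / h) \<longlongrightarrow> 0) (at_right 0)"
    proof (rule Lim_transform_eventually)
      show "((\<lambda>h. poly ([:0, 1:] * p) (inverse h) * exp (- inverse h)) \<longlongrightarrow> 0) (at_right (0::real))"
        by (rule filterlim_compose[OF poly_times_exp_minus_tendsto_0 filterlim_inverse_at_top_right])
      show "\<forall>\<^sub>F h in at_right 0. poly ([:0, 1:] * p) (inverse h) * exp (- inverse h) = flat_fun p h / h"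
        using eventually_at_right_less[of 0] by eventually_elim (simp add: flat_fun_def divide_inverse)
    qed
    moreover have "((\<lambda>h. flat_fun p h / h) \<longlongrightarrow> 0) (at_left 0)"
      by (rule tendsto_eventually) (auto simp: flat_fun_def eventually_at_filter)
    ultimately have "((\<lambda>h. flat_fun p h / h) \<longlongrightarrow> 0) (at 0)"
      by (simp add: filterlim_split_at)
    then show ?thesis by (simp add: 3 DERIV_def flat_fun_def)
  qed
qed

lemma smooth_flat_fun [smooth_intros]: "smooth (flat_fun p)"
proof (rule smoothI_coinduct[where P = "\<lambda>f. \<exists>p. f = flat_fun p"])
  fix f :: "real \<Rightarrow> real" and b :: real
  assume f: "\<exists>p. f = flat_fun p"
  then show "f differentiable_on UNIV"
    using flat_fun_has_real_derivative
    by (metis differentiable_on_def field_differentiable_def field_differentiable_imp_differentiable)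
  assume "b \<in> Basis"
  with f show "\<exists>p. pderiv_dir b f = flat_fun p"
    using pderiv_dir_real_eq[OF flat_fun_has_real_derivative] by (auto simp: Basis_real_def)
qed blast

definition smooth_step :: "real \<Rightarrow> real" where
  "smooth_step s = flat_fun 1 s / (flat_fun 1 s + flat_fun 1 (1 - s))"

lemma flat_fun_1: "flat_fun 1 s \<ge> 0" "flat_fun 1 s > 0 \<longleftrightarrow> s > 0"
  by (auto simp: flat_fun_def)

lemma flat_fun_1_sum_pos: "flat_fun 1 s + flat_fun 1 (1 - s) > 0"
  by (cases "s > 0") (auto simp: flat_fun_def intro!: add_pos_pos)

lemma smooth_smooth_step [smooth_intros]: "smooth smooth_step"
proof -
  have "smooth (\<lambda>s::real. flat_fun 1 (1 - s))"
    by (rule smooth_comp_real) (intro smooth_intros)+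
  then show ?thesis
    unfolding smooth_step_def using flat_fun_1_sum_pos by (intro smooth_intros) (auto simp: less_imp_neq[symmetric])
qed

lemma smooth_step_0: "s \<le> 0 \<Longrightarrow> smooth_step s = 0"
  by (simp add: smooth_step_def flat_fun_def)

lemma smooth_step_1: "s \<ge> 1 \<Longrightarrow> smooth_step s = 1"
  by (simp add: smooth_step_def flat_fun_def)

lemma smooth_step_bounds: "0 \<le> smooth_step s" "smooth_step s \<le> 1"
  using flat_fun_1[of s] flat_fun_1[of "1 - s"] flat_fun_1_sum_pos[of s]
  by (auto simp: smooth_step_def divide_simps)

definition pos_reg :: "real \<Rightarrow> real" where
  "pos_reg s = s * smooth_step s + 1 - smooth_step s"

lemma smooth_pos_reg [smooth_intros]: "smooth pos_reg"
  unfolding pos_reg_def by (intro smooth_intros)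

lemma pos_reg_eq: "s \<ge> 1 \<Longrightarrow> pos_reg s = s"
  by (simp add: pos_reg_def smooth_step_1)

lemma pos_reg_pos: "pos_reg s > 0"
proof -
  consider "s \<le> 0" | "s \<ge> 1" | "0 < s" "s < 1" by linarith
  then show ?thesis
  proof cases
    case 3
    show ?thesis
    proof (cases "smooth_step s = 1")
      case False
      then have "1 - smooth_step s > 0" "s * smooth_step s \<ge> 0"
        using smooth_step_bounds[of s] 3 by auto
      then show ?thesis by (simp add: pos_reg_def)
    qed (use 3 in \<open>simp add: pos_reg_def\<close>)
  qed (auto simp: pos_reg_eq, simp add: pos_reg_def smooth_step_0)
qed

section \<open>Functions decaying together with their derivatives\<close>

primrec deriv_bound :: "nat \<Rightarrow> nat \<Rightarrow> real \<Rightarrow> ('a::euclidean_space \<Rightarrow> real) \<Rightarrow> bool" where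
  "deriv_bound 0 p C f \<longleftrightarrow> continuous_on UNIV f \<and> (\<forall>X. \<bar>f X\<bar> * (1 + norm X) ^ p \<le> C)"
| "deriv_bound (Suc k) p C f \<longleftrightarrow> f differentiable_on UNIV \<and> (\<forall>X. \<bar>f X\<bar> * (1 + norm X) ^ p \<le> C)
     \<and> (\<forall>b\<in>Basis. deriv_bound k p C (pderiv_dir b f))"

definition decays :: "nat \<Rightarrow> ('a::euclidean_space \<Rightarrow> real) \<Rightarrow> bool" where
  "decays p f \<longleftrightarrow> (\<forall>k. \<exists>C. deriv_bound k p C f)"

lemma deriv_bound_bound: "deriv_bound k p C f \<Longrightarrow> \<bar>f X\<bar> * (1 + norm X) ^ p \<le> C"
  by (cases k) auto

lemma deriv_bound_nonneg: "deriv_bound k p C f \<Longrightarrow> 0 \<le> C"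
  using deriv_bound_bound[of k p C f 0] by (smt (verit) norm_zero power_one abs_ge_zero mult_cancel_left1 mult.commute)

lemma deriv_bound_Ck: "deriv_bound k p C f \<Longrightarrow> Ck k f"
  by (induction k arbitrary: f) auto

lemma deriv_bound_SucD: "deriv_bound (Suc k) p C f \<Longrightarrow> deriv_bound k p C f"
  by (induction k arbitrary: f) (auto intro: differentiable_imp_continuous_on)

lemma deriv_bound_weaken: "deriv_bound k p C f \<Longrightarrow> C \<le> C' \<Longrightarrow> q \<le> p \<Longrightarrow> deriv_bound k q C' f"
proof (induction k arbitrary: f)
  case 0
  have "\<bar>f X\<bar> * (1 + norm X) ^ q \<le> \<bar>f X\<bar> * (1 + norm X) ^ p" for X
    using 0 by (intro mult_left_mono power_increasing) auto
  with 0 show ?case by (auto intro: order_trans[OF _ order_trans[OF deriv_bound_bound[OF 0(1)] 0(2)]])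
next
  case (Suc k)
  have "\<bar>f X\<bar> * (1 + norm X) ^ q \<le> \<bar>f X\<bar> * (1 + norm X) ^ p" for X
    using Suc by (intro mult_left_mono power_increasing) auto
  with Suc show ?case by (auto intro: order_trans[OF _ order_trans[OF deriv_bound_bound[OF Suc.prems(1)] Suc.prems(2)]])
qed

lemma deriv_bound_add:
  "deriv_bound k p C f \<Longrightarrow> deriv_bound k p C' g \<Longrightarrow> deriv_bound k p (C + C') (\<lambda>X. f X + g X)"
proof (induction k arbitrary: f g)
  case 0
  have "\<bar>f X + g X\<bar> * (1 + norm X) ^ p \<le> \<bar>f X\<bar> * (1 + norm X) ^ p + \<bar>g X\<bar> * (1 + norm X) ^ p" for X
    by (simp add: distrib_right[symmetric] mult_right_mono)
  then have "\<bar>f X + g X\<bar> * (1 + norm X) ^ p \<le> C + C'" for X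
    using 0 by (smt (verit) deriv_bound_bound)
  with 0 show ?case by (auto simp: continuous_on_add)
next
  case (Suc k)
  have "\<bar>f X + g X\<bar> * (1 + norm X) ^ p \<le> \<bar>f X\<bar> * (1 + norm X) ^ p + \<bar>g X\<bar> * (1 + norm X) ^ p" for X
    by (simp add: distrib_right[symmetric] mult_right_mono)
  then have "\<bar>f X + g X\<bar> * (1 + norm X) ^ p \<le> C + C'" for X
    using Suc.prems by (smt (verit) deriv_bound_bound)
  with Suc show ?case by (auto simp: pderiv_dir_add intro!: differentiable_on_add)
qed

lemma deriv_bound_mult:
  "deriv_bound k p C f \<Longrightarrow> deriv_bound k q C' g \<Longrightarrow> deriv_bound k (p + q) (2 ^ k * (C * C')) (\<lambda>X. f X * g X)"
proof (induction k arbitrary: f g)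
  case 0
  have "\<bar>f X * g X\<bar> * (1 + norm X) ^ (p + q) \<le> C * C'" for X
    using mult_mono[OF deriv_bound_bound[OF 0(1), of X] deriv_bound_bound[OF 0(2), of X]] deriv_bound_nonneg[OF 0(1)]
    by (simp add: abs_mult power_add mult_ac)
  with 0 show ?case by (auto simp: continuous_on_mult)
next
  case (Suc k)
  have nn: "C \<ge> 0" "C' \<ge> 0" using Suc.prems deriv_bound_nonneg by blast+
  have "\<bar>f X * g X\<bar> * (1 + norm X) ^ (p + q) \<le> C * C'" for X
    using mult_mono[OF deriv_bound_bound[OF Suc.prems(1), of X] deriv_bound_bound[OF Suc.prems(2), of X]] nn
    by (simp add: abs_mult power_add mult_ac)
  moreover have "1 * (C * C') \<le> 2 ^ Suc k * (C * C')"
    using nn by (intro mult_right_mono mult_nonneg_nonneg one_le_power) auto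
  ultimately have 1: "\<bar>f X * g X\<bar> * (1 + norm X) ^ (p + q) \<le> 2 ^ Suc k * (C * C')" for X
    by (smt (verit) mult_1)
  have "deriv_bound k (p + q) (2 ^ k * (C * C') + 2 ^ k * (C * C')) (pderiv_dir b (\<lambda>X. f X * g X))"
    if "b \<in> Basis" for b
    unfolding pderiv_dir_mult[OF conjunct1[OF Suc.prems(1)[unfolded deriv_bound.simps]]
        conjunct1[OF Suc.prems(2)[unfolded deriv_bound.simps]]]
    by (intro deriv_bound_add Suc.IH deriv_bound_SucD[OF Suc.prems(1)] deriv_bound_SucD[OF Suc.prems(2)])
       (use Suc.prems that in auto)
  then have "deriv_bound k (p + q) (2 ^ Suc k * (C * C')) (pderiv_dir b (\<lambda>X. f X * g X))" if "b \<in> Basis" for b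
    using that by (simp add: mult_ac)
  with 1 Suc.prems show ?case
    unfolding deriv_bound.simps by (blast intro!: differentiable_on_mult)
qed

lemma deriv_bound_SucI:
  assumes "f differentiable_on UNIV" "\<And>X. \<bar>f X\<bar> * (1 + norm X) ^ p \<le> C0"
    and "\<And>b. b \<in> Basis \<Longrightarrow> \<exists>C. deriv_bound k p C (pderiv_dir b f)"
  shows "\<exists>C. deriv_bound (Suc k) p C f"
proof -
  obtain c where c: "\<And>b. b \<in> Basis \<Longrightarrow> deriv_bound k p (c b) (pderiv_dir b f)"
    using assms(3) by metis
  have "deriv_bound k p (\<bar>C0\<bar> + (\<Sum>b\<in>Basis. \<bar>c b\<bar>)) (pderiv_dir b f)" if "b \<in> Basis" for b
  proof (rule deriv_bound_weaken[OF c[OF that] _ order.refl])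
    have "\<bar>c b\<bar> \<le> (\<Sum>b\<in>Basis. \<bar>c b\<bar>)" using that by (intro member_le_sum) auto
    then show "c b \<le> \<bar>C0\<bar> + (\<Sum>b\<in>Basis. \<bar>c b\<bar>)" by linarith
  qed
  moreover have "\<bar>f X\<bar> * (1 + norm X) ^ p \<le> \<bar>C0\<bar> + (\<Sum>b\<in>Basis. \<bar>c b\<bar>)" for X
    using assms(2)[of X] sum_nonneg[of Basis "\<lambda>b. \<bar>c b\<bar>"] by (smt (verit) abs_ge_zero)
  ultimately show ?thesis using assms(1) by auto
qed

lemma decays_smooth: "decays p f \<Longrightarrow> smooth f"
  unfolding decays_def smooth_def using deriv_bound_Ck by blast

lemma decays_bound: "decays p f \<Longrightarrow> \<exists>C. \<forall>X. \<bar>f X\<bar> * (1 + norm X) ^ p \<le> C"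
  unfolding decays_def using deriv_bound_bound by metis

lemma decays_add: "decays p f \<Longrightarrow> decays p g \<Longrightarrow> decays p (\<lambda>X. f X + g X)"
  unfolding decays_def using deriv_bound_add by blast

lemma decays_mult: "decays p f \<Longrightarrow> decays q g \<Longrightarrow> decays (p + q) (\<lambda>X. f X * g X)"
  unfolding decays_def using deriv_bound_mult by blast

lemma decays_weaken: "decays p f \<Longrightarrow> q \<le> p \<Longrightarrow> decays q f"
  unfolding decays_def using deriv_bound_weaken by blast

lemma deriv_bound_const: "deriv_bound k 0 \<bar>c\<bar> (\<lambda>X. c)"
proof (induction k arbitrary: c)
  case (Suc k)
  have "deriv_bound k 0 \<bar>c\<bar> (\<lambda>X::'a. 0)"
    by (rule deriv_bound_weaken[OF Suc[of 0]]) auto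
  then show ?case by auto
qed auto

lemma decays_cmult: "decays p f \<Longrightarrow> decays p (\<lambda>X. c * f X)"
  using decays_mult[of 0 "\<lambda>X. c" p f] deriv_bound_const[of _ c] by (auto simp: decays_def)

lemma decays_diff: "decays p f \<Longrightarrow> decays p g \<Longrightarrow> decays p (\<lambda>X. f X - g X)"
  using decays_add[of p f "\<lambda>X. (-1) * g X"] decays_cmult[of p g "-1"] by simp

lemma decays_zero: "decays p (\<lambda>X. 0)"
proof -
  have "deriv_bound k p 0 (\<lambda>X::'a. 0)" for k
    by (induction k) auto
  then show ?thesis unfolding decays_def by blast
qed

lemma decays_sum: "(\<And>i. i \<in> I \<Longrightarrow> decays p (f i)) \<Longrightarrow> decays p (\<lambda>X. \<Sum>i\<in>I. f i X)"
  by (induction I rule: infinite_finite_induct) (auto intro: decays_zero decays_add)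

lemma decays_pderiv: "decays p f \<Longrightarrow> b \<in> Basis \<Longrightarrow> decays p (pderiv_dir b f)"
  unfolding decays_def by (metis deriv_bound.simps(2))

lemma decays_laplacian: "decays p f \<Longrightarrow> decays p (laplacian f)"
  unfolding laplacian_eq by (intro decays_sum decays_pderiv)

lemma decays_coinduct:
  assumes "P f" and "\<And>f. P f \<Longrightarrow> f differentiable_on UNIV"
    and "\<And>f. P f \<Longrightarrow> \<exists>C. \<forall>X. \<bar>f X\<bar> * (1 + norm X) ^ p \<le> C"
    and "\<And>f b. P f \<Longrightarrow> b \<in> Basis \<Longrightarrow> P (pderiv_dir b f)"
  shows "decays p f"
proof -
  have "\<exists>C. deriv_bound k p C f" if "P f" for k f
    using that
  proof (induction k arbitrary: f)
    case 0
    then show ?case using assms(2)[OF 0] assms(3)[OF 0] by (auto intro: differentiable_imp_continuous_on)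
  next
    case (Suc k)
    obtain C where "\<And>X. \<bar>f X\<bar> * (1 + norm X) ^ p \<le> C" using assms(3)[OF Suc.prems] by blast
    with Suc assms show ?case by (intro deriv_bound_SucI) auto
  qed
  then show ?thesis using assms(1) by (simp add: decays_def)
qed

lemma decays_inner_mult:
  assumes "decays (Suc p) f"
  shows "decays p (\<lambda>X. (X \<bullet> v) * f X)"
proof -
  have "\<exists>C. deriv_bound k p C (\<lambda>X. (X \<bullet> v) * f X)" if "decays (Suc p) f" for k f
    using that
  proof (induction k arbitrary: f)
    case (0 f)
    obtain C where C: "\<And>X. \<bar>f X\<bar> * (1 + norm X) ^ Suc p \<le> C" using decays_bound[OF 0] by blast
    have "\<bar>(X \<bullet> v) * f X\<bar> * (1 + norm X) ^ p \<le> norm v * C" for X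
    proof -
      have "\<bar>X \<bullet> v\<bar> \<le> (1 + norm X) * norm v"
        using Cauchy_Schwarz_ineq2[of X v] by (simp add: algebra_simps) (use norm_ge_zero[of v] in linarith)
      then have "\<bar>X \<bullet> v\<bar> * (\<bar>f X\<bar> * (1 + norm X) ^ p) \<le> ((1 + norm X) * norm v) * (\<bar>f X\<bar> * (1 + norm X) ^ p)"
        by (intro mult_right_mono) auto
      also have "\<dots> = norm v * (\<bar>f X\<bar> * (1 + norm X) ^ Suc p)" by simp
      also have "\<dots> \<le> norm v * C" using C by (intro mult_left_mono) auto
      finally show ?thesis by (simp add: abs_mult mult_ac)
    qed
    then show ?case using smooth_imp_continuous[OF decays_smooth[OF 0]]
      by (auto intro!: continuous_intros)
  next
    case (Suc k f)
    then obtain C where C: "\<And>X. \<bar>(X \<bullet> v) * f X\<bar> * (1 + norm X) ^ p \<le> C"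
      using deriv_bound_bound by (metis (lifting))
    have s: "smooth f" by (rule decays_smooth[OF Suc.prems])
    show ?case
    proof (rule deriv_bound_SucI[OF _ C])
      show "(\<lambda>X. X \<bullet> v * f X) differentiable_on UNIV"
        by (intro smooth_imp_differentiable smooth_intros s)
      fix b :: 'a assume b: "b \<in> Basis"
      have "decays p f" by (rule decays_weaken[OF Suc.prems]) simp
      then obtain C1 where C1: "deriv_bound k p C1 (\<lambda>X. (b \<bullet> v) * f X)"
        using decays_cmult[of p f] unfolding decays_def by blast
      obtain C2 where C2: "deriv_bound k p C2 (\<lambda>X. (X \<bullet> v) * pderiv_dir b f X)"
        using Suc.IH[OF decays_pderiv[OF Suc.prems b]] by blast
      show "\<exists>C. deriv_bound k p C (pderiv_dir b (\<lambda>X. X \<bullet> v * f X))"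
        using deriv_bound_add[OF C1 C2]
        by (subst pderiv_dir_mult) (auto intro: smooth_imp_differentiable smooth_intros s)
    qed
  qed
  with assms show ?thesis by (simp add: decays_def)
qed

lemma decays_affine:
  assumes L: "bounded_linear L" and K: "\<And>X. 1 + norm X \<le> K * (1 + norm (a + L X))"
    and "decays p f"
  shows "decays p (\<lambda>X. f (a + L X))"
proof -
  have "\<exists>C. deriv_bound k p C (\<lambda>X. f (a + L X))" if "decays p f" for k f
    using that
  proof (induction k arbitrary: f)
    case (0 f)
    obtain C where C: "\<And>X. \<bar>f X\<bar> * (1 + norm X) ^ p \<le> C" using decays_bound[OF 0] by blast
    have "0 < K * (1 + norm (a + L 0))" using K[of 0] by simp
    then have K0: "K \<ge> 0" using norm_ge_zero[of "a + L 0"] by (simp add: zero_less_mult_iff)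
    have "\<bar>f (a + L X)\<bar> * (1 + norm X) ^ p \<le> K ^ p * C" for X
    proof -
      have "\<bar>f (a + L X)\<bar> * (1 + norm X) ^ p \<le> \<bar>f (a + L X)\<bar> * (K * (1 + norm (a + L X))) ^ p"
        by (intro mult_left_mono power_mono K) auto
      also have "\<dots> = K ^ p * (\<bar>f (a + L X)\<bar> * (1 + norm (a + L X)) ^ p)"
        by (simp add: power_mult_distrib)
      also have "\<dots> \<le> K ^ p * C" using C K0 by (intro mult_left_mono) auto
      finally show ?thesis .
    qed
    moreover have "continuous_on UNIV (\<lambda>X. f (a + L X))"
      by (intro smooth_imp_continuous smooth_affine L decays_smooth[OF 0])
    ultimately show ?case by auto
  next
    case (Suc k f)
    then obtain C where C: "\<And>X. \<bar>f (a + L X)\<bar> * (1 + norm X) ^ p \<le> C"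
      using deriv_bound_bound by (metis (lifting))
    have s: "smooth f" by (rule decays_smooth[OF Suc.prems])
    show ?case
    proof (rule deriv_bound_SucI[OF _ C])
      show "(\<lambda>X. f (a + L X)) differentiable_on UNIV"
        by (intro smooth_imp_differentiable smooth_affine L s)
      fix b :: 'a assume b: "b \<in> Basis"
      have d: "decays p (\<lambda>Y. \<Sum>c\<in>Basis. (L b \<bullet> c) * pderiv_dir c f Y)"
        by (intro decays_sum decays_cmult decays_pderiv Suc.prems)
      have "pderiv_dir b (\<lambda>X. f (a + L X)) = (\<lambda>X. (\<lambda>Y. \<Sum>c\<in>Basis. (L b \<bullet> c) * pderiv_dir c f Y) (a + L X))"
        unfolding pderiv_dir_affine[OF L smooth_imp_differentiable[OF s]]
        by (intro ext, subst pderiv_dir_sum_Basis)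
           (auto intro: differentiable_on_UNIV_D smooth_imp_differentiable s)
      then show "\<exists>C. deriv_bound k p C (pderiv_dir b (\<lambda>X. f (a + L X)))"
        using Suc.IH[OF d] by simp
    qed
  qed
  with assms show ?thesis by (simp add: decays_def)
qed

lemma pderiv_dir_outside:
  assumes "\<And>X. norm X > R \<Longrightarrow> f X = 0" "norm X > R"
  shows "pderiv_dir b f X = 0"
proof -
  have "pderiv_dir b f X = pderiv_dir b (\<lambda>X. 0) X"
    by (rule pderiv_dir_cong_open[of "{X. norm X > R}"])
       (use assms in \<open>auto intro!: open_Collect_less continuous_intros\<close>)
  then show ?thesis by simp
qed

lemma laplacian_outside:
  assumes "\<And>X. norm X > R \<Longrightarrow> f X = 0" "norm X > R"
  shows "laplacian f X = 0"
  unfolding laplacian_def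
  by (intro sum.neutral ballI pderiv_dir_outside[of R]) (use assms in \<open>auto intro: pderiv_dir_outside[of R]\<close>)

lemma continuous_compact_support_bound:
  fixes f :: "'a::euclidean_space \<Rightarrow> real"
  assumes "continuous_on UNIV f" "\<And>X. norm X > R \<Longrightarrow> f X = 0"
  shows "\<exists>C. \<forall>X. \<bar>f X\<bar> * (1 + norm X) ^ p \<le> C"
proof -
  have "compact ((\<lambda>X. \<bar>f X\<bar> * (1 + norm X) ^ p) ` cball 0 R)"
    by (intro compact_continuous_image continuous_intros continuous_on_subset[OF assms(1)]) auto
  then obtain C where C: "\<And>X. X \<in> cball 0 R \<Longrightarrow> \<bar>f X\<bar> * (1 + norm X) ^ p \<le> C"
    by (meson bdd_above.E bounded_imp_bdd_above compact_imp_bounded imageI)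
  have "\<bar>f X\<bar> * (1 + norm X) ^ p \<le> max 0 C" for X
    using C[of X] assms(2)[of X] by (cases "norm X > R") (auto simp: max_def not_less)
  then show ?thesis by blast
qed

lemma decays_compact_support:
  assumes "smooth f" "\<And>X. norm X > R \<Longrightarrow> f X = 0"
  shows "decays p f"
proof (rule decays_coinduct[where P = "\<lambda>f. smooth f \<and> (\<forall>X. norm X > R \<longrightarrow> f X = 0)"])
  show "smooth f \<and> (\<forall>X. norm X > R \<longrightarrow> f X = 0)" using assms by blast
next
  fix f :: "'a \<Rightarrow> real" and b :: 'a
  assume f: "smooth f \<and> (\<forall>X. norm X > R \<longrightarrow> f X = 0)"
  show "\<exists>C. \<forall>X. \<bar>f X\<bar> * (1 + norm X) ^ p \<le> C"
    by (rule continuous_compact_support_bound[of f R]) (use f smooth_imp_continuous in auto)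
  show "smooth (pderiv_dir b f) \<and> (\<forall>X. norm X > R \<longrightarrow> pderiv_dir b f X = 0)"
    using f pderiv_dir_outside[of R f] smooth_pderiv by blast
qed (use smooth_imp_differentiable in blast)

definition cutoff :: "'a::euclidean_space \<Rightarrow> real" where
  "cutoff X = 1 - smooth_step ((norm X)\<^sup>2 - 1)"

lemma smooth_cutoff [smooth_intros]: "smooth cutoff"
proof -
  have "smooth (\<lambda>X::'a. smooth_step ((norm X)\<^sup>2 - 1))"
    by (rule smooth_comp_real) (intro smooth_intros)+
  then show ?thesis unfolding cutoff_def by (intro smooth_intros)
qed

lemma cutoff_1: "norm X \<le> 1 \<Longrightarrow> cutoff X = 1"
  by (simp add: cutoff_def smooth_step_0 power_le_one)

lemma cutoff_0: "norm X > 2 \<Longrightarrow> cutoff X = 0"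
  using power_mono[of 2 "norm X" 2] by (simp add: cutoff_def smooth_step_1)

lemma smooth_scale: "smooth f \<Longrightarrow> smooth (\<lambda>X. f (c *\<^sub>R X))"
  by (rule smooth_linear) (auto intro: bounded_linear_scaleR_right)

lemma deriv_bound_scale:
  fixes f :: "'a::euclidean_space \<Rightarrow> real"
  assumes c: "\<bar>c\<bar> \<le> 1"
  shows "deriv_bound k 0 C f \<Longrightarrow> deriv_bound k 0 C (\<lambda>X. f (c *\<^sub>R X))"
proof (induction k arbitrary: f)
  case 0
  then show ?case by (auto intro!: continuous_on_compose2[of UNIV f] continuous_intros)
next
  case (Suc k)
  have L: "bounded_linear (\<lambda>X::'a. c *\<^sub>R X)" by (rule bounded_linear_scaleR_right)
  have d: "f differentiable_on UNIV" using Suc.prems by simp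
  have lin: "linear (\<lambda>v. pderiv_dir v f Y)" for Y
    using differentiable_imp_has_derivative_pderiv[OF differentiable_on_UNIV_D[OF d]] has_derivative_bounded_linear
      bounded_linear.linear by blast
  have eq: "pderiv_dir b (\<lambda>X. f (c *\<^sub>R X)) = (\<lambda>X. c * pderiv_dir b f (c *\<^sub>R X))" for b
    using pderiv_dir_affine[OF L d, of b 0] by (simp add: linear_scale[OF lin])
  have "deriv_bound k 0 C (\<lambda>X. c * pderiv_dir b f (c *\<^sub>R X))" if b: "b \<in> Basis" for b
  proof -
    have "deriv_bound k 0 C (\<lambda>X. pderiv_dir b f (c *\<^sub>R X))" using Suc b by simp
    moreover have "deriv_bound j 0 C (\<lambda>X. c * g X)" if "deriv_bound j 0 C g" for j and g :: "'a \<Rightarrow> real"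
      using that
    proof (induction j arbitrary: g)
      case 0
      have "\<bar>c * g X\<bar> \<le> C" for X
        using 0 c mult_mono[of "\<bar>c\<bar>" 1 "\<bar>g X\<bar>" C] by (simp add: abs_mult)
      with 0 show ?case by (auto intro!: continuous_intros)
    next
      case (Suc j)
      have 1: "\<bar>c * g X\<bar> \<le> C" for X
        using Suc.prems c mult_mono[of "\<bar>c\<bar>" 1 "\<bar>g X\<bar>" C] by (simp add: abs_mult)
      have "pderiv_dir b (\<lambda>X. c * g X) = (\<lambda>X. c * pderiv_dir b g X)" for b
        using Suc.prems by (subst pderiv_dir_mult) auto
      with 1 Suc show ?case by (auto intro!: differentiable_on_mult)
    qed
    ultimately show ?thesis by blast
  qed
  moreover have "(\<lambda>X. f (c *\<^sub>R X)) differentiable_on UNIV"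
    using has_derivative_affine_comp[OF L d, of 0] by (auto simp: differentiable_on_def differentiable_def)
  ultimately show ?case using Suc.prems eq by auto
qed

lemma deriv_bound_laplacian:
  fixes f :: "'a::euclidean_space \<Rightarrow> real" and C :: real
  assumes "deriv_bound (Suc (Suc k)) p C f"
  shows "deriv_bound k p (DIM('a) * C) (laplacian f)"
proof -
  have "deriv_bound k p (card I * C) (\<lambda>X. \<Sum>b\<in>I. g b X)"
    if "finite I" "\<And>b. b \<in> I \<Longrightarrow> deriv_bound k p C (g b)" for I :: "'a set" and g :: "'a \<Rightarrow> 'a \<Rightarrow> real"
    using that
  proof (induction I)
    case empty
    have "deriv_bound k p 0 (\<lambda>X::'a. 0)" by (induction k) auto
    then show ?case by (simp del: deriv_bound.simps)
  next
    case (insert b I)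
    have "deriv_bound k p (C + card I * C) (\<lambda>X. g b X + (\<Sum>b\<in>I. g b X))"
      using insert by (intro deriv_bound_add) auto
    with insert(1,2) show ?case by (simp add: algebra_simps)
  qed
  then show ?thesis using assms by (auto simp: laplacian_eq simp del: deriv_bound.simps(1))
qed

section \<open>Integration on Euclidean space\<close>

lemma lborel_integral_affine:
  fixes f :: "'a::euclidean_space \<Rightarrow> real"
  assumes [measurable]: "f \<in> borel_measurable borel" and c: "c \<noteq> 0"
  shows "(LINT X|lborel. f (a + c *\<^sub>R X)) = (LINT X|lborel. f X) / \<bar>c\<bar> ^ DIM('a)"
    and "integrable lborel (\<lambda>X. f (a + c *\<^sub>R X)) \<longleftrightarrow> integrable lborel f"
proof -
  have M: "lborel = density (distr lborel borel (\<lambda>x. a + c *\<^sub>R x)) (\<lambda>_. ennreal (\<bar>c\<bar> ^ DIM('a)))"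
    using lborel_affine[of c a] c by (simp add: ennreal_power[symmetric])
  have [measurable]: "(\<lambda>x. a + c *\<^sub>R x) \<in> borel_measurable borel" by simp
  have "(LINT X|lborel. f X) = \<bar>c\<bar> ^ DIM('a) * (LINT X|lborel. f (a + c *\<^sub>R X))"
    by (subst M, subst integral_density) (use c in \<open>auto simp: integral_distr\<close>)
  then show "(LINT X|lborel. f (a + c *\<^sub>R X)) = (LINT X|lborel. f X) / \<bar>c\<bar> ^ DIM('a)"
    using c by simp
  have "integrable lborel f \<longleftrightarrow> integrable lborel (\<lambda>X. \<bar>c\<bar> ^ DIM('a) * f (a + c *\<^sub>R X))"
    by (subst M, subst integrable_density) (use c in \<open>auto simp: integrable_distr_eq\<close>)
  then show "integrable lborel (\<lambda>X. f (a + c *\<^sub>R X)) \<longleftrightarrow> integrable lborel f"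
    using c by simp
qed

lemma lborel_integral_translate:
  fixes f :: "'a::euclidean_space \<Rightarrow> real"
  assumes [measurable]: "f \<in> borel_measurable borel"
  shows "(LINT X|lborel. f (X + a)) = (LINT X|lborel. f X)"
    and "integrable lborel (\<lambda>X. f (X + a)) \<longleftrightarrow> integrable lborel f"
  using lborel_integral_affine[of f 1 a] by (simp_all add: add.commute)

lemma AE_lborel_translate:
  fixes a :: "'a::euclidean_space"
  assumes [measurable]: "Measurable.pred borel P" and ae: "AE X in lborel. P X"
  shows "AE X in lborel. P (a + X)"
proof -
  have "AE X in distr lborel borel ((+) a). P X" unfolding lborel_distr_plus by (rule ae)
  then show ?thesis by (subst (asm) AE_distr_iff) auto
qed

lemma integrable_inverse_1_plus_square_real: "integrable lborel (\<lambda>t::real. inverse (1 + t\<^sup>2))"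
  using integrable_inverse_1_plus_square by (simp add: set_integrable_def)

lemma integrable_norm_power:
  "integrable lborel (\<lambda>X::'a::euclidean_space. inverse ((1 + norm X) ^ (2 * DIM('a))))"
proof (rule integrableI_bounded)
  have le: "(\<Prod>b\<in>Basis. (1 + (X \<bullet> b)\<^sup>2)) \<le> (1 + norm X) ^ (2 * DIM('a))" for X :: 'a
  proof -
    have "(\<Prod>b\<in>(Basis::'a set). (1 + (X \<bullet> b)\<^sup>2)) \<le> (\<Prod>b\<in>(Basis::'a set). (1 + norm X)\<^sup>2)"
    proof (rule prod_mono, safe)
      fix b :: 'a assume "b \<in> Basis"
      then have "\<bar>X \<bullet> b\<bar> \<le> norm X" by (rule Basis_le_norm)
      then have "(X \<bullet> b)\<^sup>2 \<le> (norm X)\<^sup>2" by (metis abs_ge_zero power2_abs power_mono)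
      then show "1 + (X \<bullet> b)\<^sup>2 \<le> (1 + norm X)\<^sup>2"
        using norm_ge_zero[of X] by (simp only: power2_sum power_one mult_1_right)
    qed simp
    then show ?thesis by (simp add: power_mult)
  qed
  have "(\<integral>\<^sup>+X. ennreal (norm (inverse ((1 + norm X) ^ (2 * DIM('a))))) \<partial>(lborel :: 'a measure))
     \<le> (\<integral>\<^sup>+X. (\<Prod>b\<in>Basis. ennreal (inverse (1 + (X \<bullet> b)\<^sup>2))) \<partial>(lborel :: 'a measure))"
  proof (rule nn_integral_mono)
    fix X :: 'a
    have pos: "0 < (\<Prod>b\<in>Basis. (1 + (X \<bullet> b)\<^sup>2))" by (intro prod_pos) (simp add: add_pos_nonneg)
    have "inverse ((1 + norm X) ^ (2 * DIM('a))) \<le> inverse (\<Prod>b\<in>Basis. (1 + (X \<bullet> b)\<^sup>2))"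
      by (rule le_imp_inverse_le[OF le pos])
    also have "\<dots> = (\<Prod>b\<in>Basis. inverse (1 + (X \<bullet> b)\<^sup>2))" by (simp add: prod_inversef[symmetric] o_def)
    finally show "ennreal (norm (inverse ((1 + norm X) ^ (2 * DIM('a))))) \<le> (\<Prod>b\<in>Basis. ennreal (inverse (1 + (X \<bullet> b)\<^sup>2)))"
      by (simp add: prod_ennreal ennreal_leI)
  qed
  also have "\<dots> = (\<Prod>b\<in>(Basis::'a set). (\<integral>\<^sup>+t. ennreal (inverse (1 + t\<^sup>2)) \<partial>lborel))"
    by (rule nn_integral_lborel_prod) auto
  also have "\<dots> < \<infinity>"
    using integrable_inverse_1_plus_square_real unfolding integrable_iff_bounded
    by (auto simp: power_less_top_ennreal)
  finally show "(\<integral>\<^sup>+X. ennreal (norm (inverse ((1 + norm X) ^ (2 * DIM('a))))) \<partial>(lborel :: 'a measure)) < \<infinity>" .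
qed simp

lemma integrable_growth_mult_decay:
  fixes w g :: "'a::euclidean_space \<Rightarrow> real"
  assumes [measurable]: "w \<in> borel_measurable borel" "g \<in> borel_measurable borel"
    and w: "\<And>X. \<bar>w X\<bar> \<le> C * (1 + norm X) ^ n"
    and g: "\<And>X. \<bar>g X\<bar> * (1 + norm X) ^ (n + 2 * DIM('a)) \<le> C'"
  shows "integrable lborel (\<lambda>X. w X * g X)"
    and "\<bar>w X * g X\<bar> \<le> C * C' * inverse ((1 + norm X) ^ (2 * DIM('a)))"
proof -
  have bd: "\<bar>w X * g X\<bar> \<le> C * C' * inverse ((1 + norm X) ^ (2 * DIM('a)))" for X
  proof -
    have p: "0 < (1 + norm X) ^ m" for m by (simp add: add_pos_nonneg)
    have C0: "C \<ge> 0" using w[of 0] by simp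
    have "\<bar>w X * g X\<bar> * (1 + norm X) ^ (2 * DIM('a)) \<le> C * (1 + norm X) ^ n * (\<bar>g X\<bar> * (1 + norm X) ^ (2 * DIM('a)))"
      using mult_right_mono[OF w[of X], of "\<bar>g X\<bar> * (1 + norm X) ^ (2 * DIM('a))"]
      by (simp add: abs_mult mult_ac)
    also have "\<dots> = C * (\<bar>g X\<bar> * (1 + norm X) ^ (n + 2 * DIM('a)))" by (simp add: power_add mult_ac)
    also have "\<dots> \<le> C * C'" using g C0 by (intro mult_left_mono) auto
    finally show ?thesis using p[of "2 * DIM('a)"] by (simp add: divide_inverse[symmetric] pos_le_divide_eq)
  qed
  then show "\<bar>w X * g X\<bar> \<le> C * C' * inverse ((1 + norm X) ^ (2 * DIM('a)))" .
  show "integrable lborel (\<lambda>X. w X * g X)"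
    by (rule Bochner_Integration.integrable_bound[OF integrable_mult_right[OF integrable_norm_power, of "C * C'"]])
       (use bd in \<open>auto intro: order_trans[OF _ abs_ge_self]\<close>)
qed

definition loc_integrable :: "('a::euclidean_space \<Rightarrow> real) \<Rightarrow> bool" where
  "loc_integrable w \<longleftrightarrow> w \<in> borel_measurable borel \<and> (\<forall>R. integrable lborel (\<lambda>X. indicator (cball 0 R) X * w X))"

lemma loc_integrable_measurable: "loc_integrable w \<Longrightarrow> w \<in> borel_measurable borel"
  by (simp add: loc_integrable_def)

lemma integrable_loc_bounded:
  fixes w g :: "'a::euclidean_space \<Rightarrow> real"
  assumes w: "loc_integrable w" and [measurable]: "g \<in> borel_measurable borel"
    and g: "\<And>X. \<bar>g X\<bar> \<le> C" "\<And>X. norm X > R \<Longrightarrow> g X = 0"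
  shows "integrable lborel (\<lambda>X. w X * g X)"
proof (rule Bochner_Integration.integrable_bound)
  show "integrable lborel (\<lambda>X. C * (indicator (cball 0 R) X * w X))"
    using w by (auto simp: loc_integrable_def)
  show "(\<lambda>X. w X * g X) \<in> borel_measurable lborel" using w by (auto simp: loc_integrable_def)
  have "\<bar>w X\<bar> * \<bar>g X\<bar> \<le> \<bar>C\<bar> * (indicator (cball 0 R) X * \<bar>w X\<bar>)" for X
    using g(1)[of X] g(2)[of X] mult_right_mono[of "\<bar>g X\<bar>" C "\<bar>w X\<bar>"] by (auto simp: indicator_def mult.commute)
  then show "AE X in lborel. norm (w X * g X) \<le> norm (C * (indicator (cball 0 R) X * w X))"
    by (simp add: abs_mult)
qed

lemma loc_integrable_bounded:
  fixes w :: "'a::euclidean_space \<Rightarrow> real"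
  assumes [measurable]: "w \<in> borel_measurable borel" and w: "\<And>X. \<bar>w X\<bar> \<le> C * (1 + norm X) ^ n"
  shows "loc_integrable w"
  unfolding loc_integrable_def
proof (intro conjI allI)
  fix R
  have "integrable lborel (\<lambda>X. w X * indicator (cball 0 R) X)"
  proof (rule integrable_growth_mult_decay(1)[OF _ _ w])
    fix X :: 'a
    show "\<bar>indicator (cball 0 R) X\<bar> * (1 + norm X) ^ (n + 2 * DIM('a)) \<le> (1 + \<bar>R\<bar>) ^ (n + 2 * DIM('a))"
      by (auto simp: indicator_def intro!: power_mono)
  qed (auto intro!: borel_measurable_indicator)
  then show "integrable lborel (\<lambda>X. indicator (cball 0 R) X * w X)" by (simp add: mult.commute)
qed simp

lemma loc_integrable_diff: "loc_integrable v \<Longrightarrow> loc_integrable w \<Longrightarrow> loc_integrable (\<lambda>X. v X - w X)"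
  by (auto simp: loc_integrable_def algebra_simps)

lemma loc_integrable_translate:
  fixes w :: "'a::euclidean_space \<Rightarrow> real"
  assumes "loc_integrable w"
  shows "loc_integrable (\<lambda>X. w (X + a))"
  unfolding loc_integrable_def
proof (intro conjI allI)
  have [measurable]: "w \<in> borel_measurable borel" using assms by (rule loc_integrable_measurable)
  show "(\<lambda>X. w (X + a)) \<in> borel_measurable borel" by simp
  fix R
  have "integrable lborel (\<lambda>X. w X * indicator (cball 0 R) (X - a))"
    by (rule integrable_loc_bounded[OF assms, of _ 1 "R + norm a"])
       (auto simp: indicator_def dest: order.strict_trans2[OF _ norm_triangle_sub[of _ a]])
  then have "integrable lborel (\<lambda>X. w (X + a) * indicator (cball 0 R) ((X + a) - a))"
    by (subst lborel_integral_translate(2)) simp_all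
  then show "integrable lborel (\<lambda>X. indicator (cball 0 R) X * w (X + a))" by (simp add: mult.commute)
qed

lemma smooth_difference_bound:
  fixes f :: "'a::euclidean_space \<Rightarrow> real"
  assumes f: "smooth f" and C: "\<And>X. \<bar>pderiv_dir b f X\<bar> \<le> C"
  shows "\<bar>f (X + h *\<^sub>R b) - f X\<bar> \<le> C * \<bar>h\<bar>"
proof -
  define g where "g t = f (X + t *\<^sub>R b)" for t
  have "norm (g h - g 0) \<le> C * norm (h - 0)"
  proof (rule field_differentiable_bound[of UNIV])
    show "(g has_field_derivative pderiv_dir b f (X + t *\<^sub>R b)) (at t within UNIV)" for t
      unfolding g_def by (rule smooth_has_real_derivative_line[OF f])
  qed (use C in auto)
  then show ?thesis by (simp add: g_def)
qed

lemma has_real_derivative_integral_translate: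
  fixes f w :: "'a::euclidean_space \<Rightarrow> real"
  assumes w: "loc_integrable w" and f: "smooth f" "\<And>X. norm X > R \<Longrightarrow> f X = 0"
  shows "((\<lambda>t. LINT X|lborel. w X * f (X + t *\<^sub>R b)) has_real_derivative
           (LINT X|lborel. w X * pderiv_dir b f X)) (at 0)"
proof -
  have [measurable]: "w \<in> borel_measurable borel" "f \<in> borel_measurable borel" "pderiv_dir b f \<in> borel_measurable borel"
    using w f by (auto intro: loc_integrable_measurable smooth_imp_measurable smooth_pderiv)
  obtain C where C: "\<And>X. \<bar>pderiv_dir b f X\<bar> \<le> C"
    using continuous_compact_support_bound[of "pderiv_dir b f" R 0, OF smooth_imp_continuous[OF smooth_pderiv[OF f(1)]]]
      pderiv_dir_outside[of R f _ b, OF f(2)] by auto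
  have C0: "C \<ge> 0" using C[of 0] by linarith
  obtain C1 where C1: "\<And>X. \<bar>f X\<bar> \<le> C1"
    using continuous_compact_support_bound[of f R 0] f smooth_imp_continuous by auto
  have int: "integrable lborel (\<lambda>X. w X * f (X + t *\<^sub>R b))" for t
    by (rule integrable_loc_bounded[OF w, of _ C1 "\<bar>R\<bar> + \<bar>t\<bar> * norm b"])
       (use C1 f(2) in \<open>auto dest: order.strict_trans2[OF _ norm_triangle_sub[of _ "- (t *\<^sub>R b)"]]\<close>)
  show ?thesis
    unfolding DERIV_def tendsto_at_iff_sequentially
  proof (intro allI impI)
    fix h :: "nat \<Rightarrow> real" assume h: "\<forall>i. h i \<in> UNIV - {0}" "h \<longlonglongrightarrow> 0"
    obtain B where B: "\<And>i. \<bar>h i\<bar> \<le> B"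
      using h(2) by (metis (no_types, lifting) Bseq_def convergentI convergent_imp_Bseq real_norm_def)
    have B0: "B \<ge> 0" using B[of 0] by linarith
    have lim: "(\<lambda>i. LINT X|lborel. w X * ((f (X + h i *\<^sub>R b) - f X) / h i)) \<longlonglongrightarrow> (LINT X|lborel. w X * pderiv_dir b f X)"
    proof (rule integral_dominated_convergence[where w = "\<lambda>X. \<bar>w X * (C * indicator (cball 0 (\<bar>R\<bar> + B * norm b)) X)\<bar>"])
      show "integrable lborel (\<lambda>X. \<bar>w X * (C * indicator (cball 0 (\<bar>R\<bar> + B * norm b)) X)\<bar>)"
        by (rule integrable_abs, rule integrable_loc_bounded[OF w, of _ "C" "\<bar>R\<bar> + B * norm b"])
           (use C0 in \<open>auto simp: indicator_def\<close>)
      show "AE X in lborel. (\<lambda>i. w X * ((f (X + h i *\<^sub>R b) - f X) / h i)) \<longlonglongrightarrow> w X * pderiv_dir b f X"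
      proof (intro AE_I2 tendsto_intros)
        fix X
        have "((\<lambda>t. f (X + t *\<^sub>R b)) has_real_derivative pderiv_dir b f (X + 0 *\<^sub>R b)) (at 0)"
          by (rule smooth_has_real_derivative_line[OF f(1)])
        then show "(\<lambda>i. (f (X + h i *\<^sub>R b) - f X) / h i) \<longlonglongrightarrow> pderiv_dir b f X"
          using h unfolding DERIV_def tendsto_at_iff_sequentially by (auto simp: o_def)
      qed
      fix i
      have "\<bar>(f (X + h i *\<^sub>R b) - f X) / h i\<bar> \<le> \<bar>C * indicator (cball 0 (\<bar>R\<bar> + B * norm b)) X\<bar>" for X
      proof (cases "norm X \<le> \<bar>R\<bar> + B * norm b")
        case True
        have "h i \<noteq> 0" using h by auto
        with smooth_difference_bound[OF f(1) C, of X "h i"] C0 True show ?thesis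
          by (simp add: divide_le_eq indicator_def)
      next
        case False
        have "\<bar>h i\<bar> * norm b \<le> B * norm b" using B by (intro mult_right_mono) auto
        moreover have "norm X \<le> norm (X + h i *\<^sub>R b) + \<bar>h i\<bar> * norm b"
          using norm_triangle_sub[of X "- (h i *\<^sub>R b)"] by simp
        ultimately have "norm (X + h i *\<^sub>R b) > R" "norm X > R" using False mult_nonneg_nonneg[OF B0, of "norm b"] by auto
        then show ?thesis using f(2) by simp
      qed
      then show "AE X in lborel. norm (w X * ((f (X + h i *\<^sub>R b) - f X) / h i)) \<le> \<bar>w X * (C * indicator (cball 0 (\<bar>R\<bar> + B * norm b)) X)\<bar>"
        by (intro AE_I2) (simp only: real_norm_def abs_mult[of "w _"] mult_left_mono abs_ge_zero)
    qed auto
    have eq: "(LINT X|lborel. w X * ((f (X + h i *\<^sub>R b) - f X) / h i))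
       = ((LINT X|lborel. w X * f (X + (0 + h i) *\<^sub>R b)) - (LINT X|lborel. w X * f (X + 0 *\<^sub>R b))) / h i" for i
      by (subst Bochner_Integration.integral_diff[symmetric])
         (use int[of "h i"] int[of 0] in \<open>auto simp: algebra_simps diff_divide_distrib\<close>)
    from lim show "((\<lambda>t. ((LINT X|lborel. w X * f (X + (0 + t) *\<^sub>R b)) - (LINT X|lborel. w X * f (X + 0 *\<^sub>R b))) / t) \<circ> h)
       \<longlonglongrightarrow> (LINT X|lborel. w X * pderiv_dir b f X)"
      unfolding o_def eq .
  qed
qed

lemma integral_pderiv_zero:
  fixes f :: "'a::euclidean_space \<Rightarrow> real"
  assumes [measurable]: "S \<in> sets borel" and S: "\<And>X t. X + t *\<^sub>R b \<in> S \<longleftrightarrow> X \<in> S"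
    and f: "smooth f" "\<And>X. norm X > R \<Longrightarrow> f X = 0"
  shows "(LINT X|lborel. indicator S X * pderiv_dir b f X) = 0"
proof -
  have [measurable]: "f \<in> borel_measurable borel" using f smooth_imp_measurable by blast
  have "loc_integrable (indicator S :: 'a \<Rightarrow> real)"
    by (rule loc_integrable_bounded[of _ 1 0]) (auto simp: indicator_def)
  from has_real_derivative_integral_translate[OF this f, where b = b]
  have "((\<lambda>t. LINT X|lborel. indicator S X * f (X + t *\<^sub>R b)) has_real_derivative
           (LINT X|lborel. indicator S X * pderiv_dir b f X)) (at 0)" .
  moreover have "(LINT X|lborel. indicator S X * f (X + t *\<^sub>R b)) = (LINT X|lborel. indicator S X * f X)" for t
  proof -
    have "(LINT X|lborel. indicator S X * f (X + t *\<^sub>R b)) = (LINT X|lborel. indicator S (X + t *\<^sub>R b) * f (X + t *\<^sub>R b))"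
      by (simp add: indicator_def S)
    also have "\<dots> = (LINT X|lborel. indicator S X * f X)"
      by (rule lborel_integral_translate(1)) measurable
    finally show ?thesis .
  qed
  ultimately have "((\<lambda>t::real. LINT X|lborel. indicator S X * f X) has_real_derivative
           (LINT X|lborel. indicator S X * pderiv_dir b f X)) (at 0)" by simp
  then show ?thesis using DERIV_unique DERIV_const by blast
qed

lemma AE_zero_if_box_integrals_zero:
  fixes f :: "'a::euclidean_space \<Rightarrow> real"
  assumes f: "loc_integrable f" and box: "\<And>a b. (LINT X|lborel. f X * indicator (box a b) X) = 0"
  shows "AE X in lborel. f X = 0"
proof -
  have [measurable]: "f \<in> borel_measurable borel" by (rule loc_integrable_measurable[OF f])
  have int: "integrable lborel (\<lambda>X. f X * indicator (box a b) X)" for a b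
  proof -
    obtain R where "\<forall>X\<in>box a b. norm X \<le> R" using bounded_box[of a b] unfolding bounded_iff by blast
    then show ?thesis
      by (intro integrable_loc_bounded[OF f, of _ 1 R]) (auto simp: indicator_def)
  qed
  have fin: "(\<integral>\<^sup>+X. ennreal (s * f X) * indicator (box a b) X \<partial>lborel) < \<infinity>" if "\<bar>s\<bar> = 1" for a b s
  proof -
    have "(\<integral>\<^sup>+X. ennreal (s * f X) * indicator (box a b) X \<partial>lborel) \<le> (\<integral>\<^sup>+X. ennreal (norm (f X * indicator (box a b) X)) \<partial>lborel)"
    proof (rule nn_integral_mono)
      fix X
      have "s * f X \<le> \<bar>f X\<bar>" using that abs_ge_self[of "s * f X"] by (simp add: abs_mult)
      then show "ennreal (s * f X) * indicator (box a b) X \<le> ennreal (norm (f X * indicator (box a b) X))"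
        by (simp add: indicator_def ennreal_leI)
    qed
    also have "\<dots> < \<infinity>" using int[of a b] unfolding integrable_iff_bounded by simp
    finally show ?thesis .
  qed
  have "density lborel (\<lambda>X. ennreal (f X)) = density lborel (\<lambda>X. ennreal (- f X))"
  proof (rule measure_eqI_generator_eq[where E = "range (\<lambda>(a, b). box a b)" and \<Omega> = UNIV
        and A = "\<lambda>n::nat. box (- (real n *\<^sub>R One)) (real n *\<^sub>R One)"])
    show "Int_stable (range (\<lambda>(a, b). box a b::'a set))" by (auto simp: Int_stable_def box_Int_box)
    show "sets (density lborel (\<lambda>X. ennreal (f X))) = sigma_sets UNIV (range (\<lambda>(a, b). box a b))"
      "sets (density lborel (\<lambda>X. ennreal (- f X))) = sigma_sets UNIV (range (\<lambda>(a, b). box a b))"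
      by (simp_all add: borel_eq_box)
    show "range (\<lambda>n::nat. box (- (real n *\<^sub>R One)) (real n *\<^sub>R One)) \<subseteq> range (\<lambda>(a, b). box a b::'a set)"
      "(\<Union>n::nat. box (- (real n *\<^sub>R One)) (real n *\<^sub>R One)) = (UNIV :: 'a set)"
      unfolding UN_box_eq_UNIV by auto
    show "emeasure (density lborel (\<lambda>X. ennreal (f X))) (box (- (real n *\<^sub>R One)) (real n *\<^sub>R One)) \<noteq> \<infinity>" for n
      using fin[of 1 "- (real n *\<^sub>R One)" "real n *\<^sub>R One"] by (simp add: emeasure_density)
    fix Y :: "'a set" assume "Y \<in> range (\<lambda>(a, b). box a b)"
    then obtain a b where Y: "Y = box a b" by auto
    have p: "ennreal (s * f X) * indicator (box a b) X = ennreal (s * (f X * indicator (box a b) X))" for X s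
      by (simp add: indicator_def)
    have "(\<integral>\<^sup>+X. ennreal (f X * indicator Y X) \<partial>lborel) = (\<integral>\<^sup>+X. ennreal (- (f X * indicator Y X)) \<partial>lborel)"
    proof -
      define P where "P s = (\<integral>\<^sup>+X. ennreal (s * (f X * indicator Y X)) \<partial>lborel)" for s
      have P: "P 1 < top" "P (- 1) < top" using fin[of 1 a b] fin[of "- 1" a b] unfolding p P_def Y by simp_all
      have e: "enn2real (P 1) - enn2real (P (- 1)) = 0"
        using real_lebesgue_integral_def[OF int[of a b]] box[of a b] unfolding P_def Y by simp
      have "P 1 = ennreal (enn2real (P 1))" using P by simp
      also have "\<dots> = ennreal (enn2real (P (- 1)))" using e by (simp only: right_minus_eq)
      also have "\<dots> = P (- 1)" using P by simp
      finally have "P 1 = P (- 1)" .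
      then show ?thesis by (simp add: P_def)
    qed
    then show "emeasure (density lborel (\<lambda>X. ennreal (f X))) Y = emeasure (density lborel (\<lambda>X. ennreal (- f X))) Y"
      using p[of 1] p[of "-1"] by (simp add: emeasure_density Y)
  qed auto
  then have "AE X in lborel. ennreal (f X) = ennreal (- f X)"
    by (subst (asm) sigma_finite_measure.density_unique_iff[OF sigma_finite_lborel]) auto
  then show ?thesis
  proof eventually_elim
    fix X assume eq: "ennreal (f X) = ennreal (- f X)"
    have "f X \<le> 0" if "- f X \<le> 0" using that eq ennreal_eq_0_iff ennreal_neg by metis
    moreover have "- f X \<le> 0" if "f X \<le> 0" using that eq ennreal_eq_0_iff ennreal_neg by metis
    ultimately show "f X = 0" by linarith
  qed
qed

section \<open>Green's identities for the bilaplacian\<close>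

lemma Basis_R4: "(Basis :: R4 set) = insert e\<^sub>y ((\<lambda>c. (c, 0)) ` Basis)"
  by (auto simp: Basis_prod_def)

lemma sum_Basis_R4: "(\<Sum>b\<in>(Basis :: R4 set). F b) = F e\<^sub>y + (\<Sum>c\<in>Basis. F (c, 0))"
  unfolding Basis_R4
  by (subst sum.insert) (auto simp: sum.reindex inj_on_def)

lemma e\<^sub>y_Basis: "e\<^sub>y \<in> Basis"
  by (simp add: Basis_R4)

lemma inner_e\<^sub>y: "X \<bullet> e\<^sub>y = snd X"
  by (cases X) simp

lemma open_half_space: "open half_space"
  unfolding half_space_def by (intro open_Collect_less continuous_intros)

lemma half_space_measurable [measurable]: "half_space \<in> sets borel"
  by (rule borel_open[OF open_half_space])

lemma integral_half_space_pderiv_tangential: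
  fixes f :: "R4 \<Rightarrow> real"
  assumes "smooth f" "\<And>X. norm X > R \<Longrightarrow> f X = 0"
  shows "(LINT X|lborel. indicator half_space X * pderiv_dir (c, 0) f X) = 0"
  by (rule integral_pderiv_zero[OF half_space_measurable _ assms]) (auto simp: half_space_def)

lemma integrable_lborel_compact_support:
  fixes f :: "'a::euclidean_space \<Rightarrow> real"
  assumes f: "smooth f" "\<And>X. norm X > R \<Longrightarrow> f X = 0" and [measurable]: "S \<in> sets borel"
  shows "integrable lborel (\<lambda>X. indicator S X * f X)" "integrable lborel f"
proof -
  obtain C where "\<And>X. \<bar>f X\<bar> \<le> C"
    using continuous_compact_support_bound[of f R 0] f smooth_imp_continuous by auto
  then have 1: "integrable lborel (\<lambda>X. indicator S X * f X)" if [measurable]: "S \<in> sets borel" for S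
    using f by (intro integrable_loc_bounded[of _ _ C R] loc_integrable_bounded[of _ 1 0])
      (auto simp: indicator_def smooth_imp_measurable)
  show "integrable lborel (\<lambda>X. indicator S X * f X)" "integrable lborel f"
    using 1[of S] 1[of UNIV] by auto
qed

lemma integral_half_space_pderiv_normal:
  fixes f :: "R4 \<Rightarrow> real"
  assumes f: "smooth f" "\<And>X. norm X > R \<Longrightarrow> f X = 0"
  shows "(LINT X|lborel. indicator half_space X * pderiv_dir e\<^sub>y f X) = - (LINT x|lborel. f (x, 0))"
proof -
  have s: "smooth (pderiv_dir e\<^sub>y f)" by (intro smooth_intros f)
  have int: "integrable (lborel \<Otimes>\<^sub>M lborel) (\<lambda>X. indicator half_space X * pderiv_dir e\<^sub>y f X)"
    unfolding lborel_prod
    by (rule integrable_lborel_compact_support[OF s, of R]) (use f pderiv_dir_outside[of R f] in auto)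
  have inner: "(LINT y|lborel. indicator half_space (x, y) * pderiv_dir e\<^sub>y f (x, y)) = - f (x, 0)" for x
  proof -
    define b where "b = \<bar>R\<bar> + 1"
    have b: "b > 0" by (simp add: b_def)
    have d: "((\<lambda>y. f (x, y)) has_real_derivative pderiv_dir e\<^sub>y f (x, y)) (at y)" for y
      using smooth_has_real_derivative_line[OF f(1), of "(x, 0)" e\<^sub>y y UNIV] by simp
    have "(LINT y|lborel. pderiv_dir e\<^sub>y f (x, y) * indicator {0..b} y) = f (x, b) - f (x, 0)"
    proof (rule integral_FTC_Icc_real)
      show "DERIV (\<lambda>y. f (x, y)) y :> pderiv_dir e\<^sub>y f (x, y)" for y by (rule d)
      have "continuous_on UNIV (\<lambda>y. pderiv_dir e\<^sub>y f (x, y))"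
        by (rule continuous_on_compose2[OF smooth_imp_continuous[OF s]]) (auto intro!: continuous_intros)
      then show "isCont (\<lambda>y. pderiv_dir e\<^sub>y f (x, y)) y" for y
        by (simp add: continuous_on_eq_continuous_at)
    qed (use b in simp)
    moreover have "norm (x, b) > R"
      using norm_snd_le[of b x] unfolding b_def by simp
    moreover have "(LINT y|lborel. indicator half_space (x, y) * pderiv_dir e\<^sub>y f (x, y))
       = (LINT y|lborel. pderiv_dir e\<^sub>y f (x, y) * indicator {0..b} y)"
    proof (rule integral_cong_AE)
      have m: "pderiv_dir e\<^sub>y f \<in> borel_measurable borel" by (rule smooth_imp_measurable[OF s])
      then have m': "(\<lambda>y. pderiv_dir e\<^sub>y f (x, y)) \<in> borel_measurable borel"
        by (rule measurable_compose[rotated]) (auto intro!: borel_measurable_continuous_onI continuous_intros)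
      have "(\<lambda>y. indicator half_space (x, y) :: real) = indicator {0<..}"
        by (auto simp: half_space_def indicator_def)
      with m' show "(\<lambda>y. indicator half_space (x, y) * pderiv_dir e\<^sub>y f (x, y)) \<in> borel_measurable lborel"
        by simp
      show "(\<lambda>y. pderiv_dir e\<^sub>y f (x, y) * indicator {0..b} y) \<in> borel_measurable lborel" using m' by simp
      show "AE y in lborel. indicator half_space (x, y) * pderiv_dir e\<^sub>y f (x, y) = pderiv_dir e\<^sub>y f (x, y) * indicator {0..b} y"
        using AE_lborel_singleton[of 0]
      proof eventually_elim
        fix y :: real assume "y \<noteq> 0"
        moreover have "pderiv_dir e\<^sub>y f (x, y) = 0" if "y > b"
          by (rule pderiv_dir_outside[of R, OF f(2)]) (use norm_snd_le[of y x] that b_def in auto)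
        ultimately show "indicator half_space (x, y) * pderiv_dir e\<^sub>y f (x, y) = pderiv_dir e\<^sub>y f (x, y) * indicator {0..b} y"
          by (cases "y > b") (auto simp: half_space_def indicator_def)
      qed
    qed
    ultimately show ?thesis using f(2) by simp
  qed
  have "(LINT X|lborel. indicator half_space X * pderiv_dir e\<^sub>y f X)
     = (LINT x|lborel. LINT y|lborel. indicator half_space (x, y) * pderiv_dir e\<^sub>y f (x, y))"
    using lborel_pair.integral_fst'[OF int] by (simp add: lborel_prod)
  then show ?thesis by (simp add: inner)
qed

lemma bilaplacian_divergence:
  fixes F \<phi> :: "'a::euclidean_space \<Rightarrow> real"
  assumes [smooth_intros]: "smooth F" "smooth \<phi>"
  defines "V b \<equiv> \<lambda>X. F X * pderiv_dir b (laplacian \<phi>) X - pderiv_dir b F X * laplacian \<phi> X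
      + (laplacian F X * pderiv_dir b \<phi> X - pderiv_dir b (laplacian F) X * \<phi> X)"
  shows "smooth (V b)"
    and "F X * laplacian (laplacian \<phi>) X - \<phi> X * laplacian (laplacian F) X = (\<Sum>b\<in>Basis. pderiv_dir b (V b) X)"
proof -
  show "smooth (V b)" unfolding V_def by (intro smooth_intros)
  have "pderiv_dir b (V b) = (\<lambda>X. F X * pderiv_dir b (pderiv_dir b (laplacian \<phi>)) X
     - pderiv_dir b (pderiv_dir b F) X * laplacian \<phi> X
     + (laplacian F X * pderiv_dir b (pderiv_dir b \<phi>) X - pderiv_dir b (pderiv_dir b (laplacian F)) X * \<phi> X))" for b
    unfolding V_def
    by (subst pderiv_dir_add, (intro smooth_imp_differentiable smooth_intros)+,
        (subst pderiv_dir_diff, (intro smooth_intros)+)+,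
        (subst pderiv_dir_mult, (intro smooth_imp_differentiable smooth_intros)+)+)
       (auto simp: algebra_simps)
  then have "(\<Sum>b\<in>Basis. pderiv_dir b (V b) X) = F X * laplacian (laplacian \<phi>) X - laplacian F X * laplacian \<phi> X
     + (laplacian F X * laplacian \<phi> X - laplacian (laplacian F) X * \<phi> X)"
    by (simp add: sum.distrib sum_subtractf flip: sum_distrib_left sum_distrib_right laplacian_def)
  then show "F X * laplacian (laplacian \<phi>) X - \<phi> X * laplacian (laplacian F) X = (\<Sum>b\<in>Basis. pderiv_dir b (V b) X)"
    by simp
qed

lemma green_whole_space:
  fixes F \<phi> :: "'a::euclidean_space \<Rightarrow> real"
  assumes F: "smooth F" and \<phi>: "smooth \<phi>" "\<And>X. norm X > R \<Longrightarrow> \<phi> X = 0"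
  shows "(LINT X|lborel. F X * laplacian (laplacian \<phi>) X) = (LINT X|lborel. \<phi> X * laplacian (laplacian F) X)"
proof -
  define V where "V b X = F X * pderiv_dir b (laplacian \<phi>) X - pderiv_dir b F X * laplacian \<phi> X
      + (laplacian F X * pderiv_dir b \<phi> X - pderiv_dir b (laplacian F) X * \<phi> X)" for b X
  note div = bilaplacian_divergence[OF F \<phi>(1), folded V_def]
  have out: "laplacian \<phi> X = 0" "pderiv_dir b (laplacian \<phi>) X = 0" "pderiv_dir b \<phi> X = 0"
      "laplacian (laplacian \<phi>) X = 0" if "norm X > R" for X b
    using that \<phi>(2) by (auto intro!: laplacian_outside[of R] pderiv_dir_outside[of R])
  have V0: "V b X = 0" if "norm X > R" for b X
    using out that \<phi>(2) by (simp add: V_def)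
  have 0: "(LINT X|lborel. pderiv_dir b (V b) X) = 0" for b
    using integral_pderiv_zero[of UNIV b "V b" R] div(1)[of b] V0 by auto
  have int: "integrable lborel (pderiv_dir b (V b))" for b
    by (rule integrable_lborel_compact_support(2)[OF smooth_pderiv[OF div(1)] pderiv_dir_outside[OF V0]]) auto
  have "(LINT X|lborel. F X * laplacian (laplacian \<phi>) X - \<phi> X * laplacian (laplacian F) X) = 0"
    unfolding div(2) by (subst Bochner_Integration.integral_sum) (simp_all add: 0 int)
  moreover have "integrable lborel (\<lambda>X. F X * laplacian (laplacian \<phi>) X)"
    by (rule integrable_lborel_compact_support(2)[of _ R]) (auto intro!: smooth_intros F \<phi> simp: out)
  moreover have "integrable lborel (\<lambda>X. \<phi> X * laplacian (laplacian F) X)"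
    by (rule integrable_lborel_compact_support(2)[of _ R]) (auto intro!: smooth_intros F \<phi> simp: \<phi>)
  ultimately show ?thesis by simp
qed

lemma green_half_space:
  fixes F \<phi> :: "R4 \<Rightarrow> real"
  assumes F: "smooth F" and \<phi>: "smooth \<phi>" "\<And>X. norm X > R \<Longrightarrow> \<phi> X = 0"
    and dirichlet: "\<And>x. \<phi> (x, 0) = 0" "\<And>x. pderiv_dir e\<^sub>y \<phi> (x, 0) = 0"
  shows "(LINT X|lborel. indicator half_space X * (F X * laplacian (laplacian \<phi>) X))
     = (LINT X|lborel. indicator half_space X * (\<phi> X * laplacian (laplacian F) X))
       - (LINT x|lborel. F (x, 0) * pderiv_dir e\<^sub>y (laplacian \<phi>) (x, 0) - pderiv_dir e\<^sub>y F (x, 0) * laplacian \<phi> (x, 0))"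
proof -
  define V where "V b X = F X * pderiv_dir b (laplacian \<phi>) X - pderiv_dir b F X * laplacian \<phi> X
      + (laplacian F X * pderiv_dir b \<phi> X - pderiv_dir b (laplacian F) X * \<phi> X)" for b X
  note div = bilaplacian_divergence[OF F \<phi>(1), folded V_def]
  have out: "laplacian \<phi> X = 0" "pderiv_dir b (laplacian \<phi>) X = 0" "pderiv_dir b \<phi> X = 0"
      "laplacian (laplacian \<phi>) X = 0" if "norm X > R" for X b
    using that \<phi>(2) by (auto intro!: laplacian_outside[of R] pderiv_dir_outside[of R])
  have V0: "V b X = 0" if "norm X > R" for b X
    using out that \<phi>(2) by (simp add: V_def)
  have int: "integrable lborel (\<lambda>X. indicator half_space X * pderiv_dir b (V b) X)" for b
    by (rule integrable_lborel_compact_support(1)[OF smooth_pderiv[OF div(1)] pderiv_dir_outside[OF V0]]) auto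
  have "(LINT X|lborel. indicator half_space X * (F X * laplacian (laplacian \<phi>) X - \<phi> X * laplacian (laplacian F) X))
      = (\<Sum>b\<in>Basis. LINT X|lborel. indicator half_space X * pderiv_dir b (V b) X)"
    unfolding div(2) sum_distrib_left by (subst Bochner_Integration.integral_sum) (simp_all add: int)
  also have "\<dots> = - (LINT x|lborel. V e\<^sub>y (x, 0))"
    using integral_half_space_pderiv_tangential[OF div(1) V0]
    by (simp add: sum_Basis_R4 integral_half_space_pderiv_normal[OF div(1) V0])
  also have "\<dots> = - (LINT x|lborel. F (x, 0) * pderiv_dir e\<^sub>y (laplacian \<phi>) (x, 0) - pderiv_dir e\<^sub>y F (x, 0) * laplacian \<phi> (x, 0))"
    by (simp add: V_def dirichlet)
  finally have "(LINT X|lborel. indicator half_space X * (F X * laplacian (laplacian \<phi>) X)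
       - indicator half_space X * (\<phi> X * laplacian (laplacian F) X)) = \<dots>"
    by (simp only: right_diff_distrib)
  moreover have "integrable lborel (\<lambda>X. indicator half_space X * (F X * laplacian (laplacian \<phi>) X))"
    by (rule integrable_lborel_compact_support(1)[of _ R]) (auto intro!: smooth_intros F \<phi> simp: out)
  moreover have "integrable lborel (\<lambda>X. indicator half_space X * (\<phi> X * laplacian (laplacian F) X))"
    by (rule integrable_lborel_compact_support(1)[of _ R]) (auto intro!: smooth_intros F \<phi> simp: \<phi>)
  ultimately show ?thesis by simp
qed

section \<open>Laplacians of radial functions\<close>

lemma sum_inner_square: "(\<Sum>b\<in>Basis. (X \<bullet> b)\<^sup>2) = (norm X)\<^sup>2"
  for X :: "'a::euclidean_space"
  unfolding power2_norm_eq_inner by (subst euclidean_inner) (simp add: power2_eq_square)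

lemma laplacian_radial:
  fixes \<theta> \<theta>1 \<theta>2 :: "real \<Rightarrow> real"
  assumes 1: "\<And>s. s \<ge> 0 \<Longrightarrow> (\<theta> has_real_derivative \<theta>1 s) (at s)"
    and 2: "\<And>s. s \<ge> 0 \<Longrightarrow> (\<theta>1 has_real_derivative \<theta>2 s) (at s)"
  shows "laplacian (\<lambda>X::'a::euclidean_space. \<theta> ((norm X)\<^sup>2))
       = (\<lambda>X. 4 * (norm X)\<^sup>2 * \<theta>2 ((norm X)\<^sup>2) + 2 * DIM('a) * \<theta>1 ((norm X)\<^sup>2))"
proof
  fix X :: 'a
  have d1: "pderiv_dir b (\<lambda>X::'a. \<theta> ((norm X)\<^sup>2)) = (\<lambda>X. \<theta>1 ((norm X)\<^sup>2) * (2 * (X \<bullet> b)))" for b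
  proof
    fix X :: 'a
    have "(\<theta> has_real_derivative \<theta>1 ((norm X)\<^sup>2)) (at ((norm X)\<^sup>2))" by (rule 1) simp
    from pderiv_dir_chain[where g = "\<lambda>X. (norm X)\<^sup>2", OF this smooth_norm_square]
    show "pderiv_dir b (\<lambda>X::'a. \<theta> ((norm X)\<^sup>2)) X = \<theta>1 ((norm X)\<^sup>2) * (2 * (X \<bullet> b))"
      by (simp add: pderiv_dir_norm_square)
  qed
  have d2: "pderiv_dir b (\<lambda>X::'a. \<theta>1 ((norm X)\<^sup>2) * (2 * (X \<bullet> b))) X
      = 4 * \<theta>2 ((norm X)\<^sup>2) * (X \<bullet> b)\<^sup>2 + 2 * \<theta>1 ((norm X)\<^sup>2)" if "b \<in> Basis" for b
  proof -
    have h: "((\<lambda>X::'a. \<theta>1 ((norm X)\<^sup>2)) has_derivative (\<lambda>v. \<theta>2 ((norm X)\<^sup>2) * (2 * (X \<bullet> v)))) (at X)"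
      using diff_chain_at[OF smooth_has_derivative[OF smooth_norm_square, of X] 2[unfolded has_field_derivative_def]]
      by (simp add: o_def pderiv_dir_norm_square)
    have "((\<lambda>X::'a. \<theta>1 ((norm X)\<^sup>2) * (2 * (X \<bullet> b))) has_derivative
       (\<lambda>v. \<theta>1 ((norm X)\<^sup>2) * (2 * (v \<bullet> b)) + \<theta>2 ((norm X)\<^sup>2) * (2 * (X \<bullet> v)) * (2 * (X \<bullet> b)))) (at X)"
      by (rule has_derivative_mult[OF h]) (auto intro!: derivative_eq_intros)
    from pderiv_dir_eq[OF this, of b] that show ?thesis
      by (simp add: power2_eq_square algebra_simps)
  qed
  have "laplacian (\<lambda>X::'a. \<theta> ((norm X)\<^sup>2)) X
     = (\<Sum>b\<in>Basis. 4 * \<theta>2 ((norm X)\<^sup>2) * (X \<bullet> b)\<^sup>2 + 2 * \<theta>1 ((norm X)\<^sup>2))"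
    unfolding laplacian_def d1 by (intro sum.cong refl d2)
  also have "\<dots> = 4 * \<theta>2 ((norm X)\<^sup>2) * (norm X)\<^sup>2 + DIM('a) * (2 * \<theta>1 ((norm X)\<^sup>2))"
    by (simp add: sum.distrib sum_distrib_left[symmetric] sum_inner_square)
  finally show "laplacian (\<lambda>X::'a. \<theta> ((norm X)\<^sup>2)) X
      = 4 * (norm X)\<^sup>2 * \<theta>2 ((norm X)\<^sup>2) + 2 * DIM('a) * \<theta>1 ((norm X)\<^sup>2)" by simp
qed

lemma smooth_radial [smooth_intros]: "smooth \<tau> \<Longrightarrow> smooth (\<lambda>X::'a::euclidean_space. \<tau> ((norm X)\<^sup>2))"
  by (rule smooth_comp_real) (auto intro: smooth_intros)

lemma pderiv_dir_radial:
  assumes "smooth \<tau>"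
  shows "pderiv_dir b (\<lambda>X::'a::euclidean_space. \<tau> ((norm X)\<^sup>2)) = (\<lambda>X. 2 * (X \<bullet> b) * pderiv_dir 1 \<tau> ((norm X)\<^sup>2))"
  using pderiv_dir_chain[OF smooth_has_real_derivative[OF assms] smooth_norm_square, of b]
  by (auto simp: pderiv_dir_norm_square mult_ac)

lemma pderiv_dir_inner_power: "pderiv_dir b (\<lambda>X. (X \<bullet> e) ^ a) = (\<lambda>X. real a * (X \<bullet> e) ^ (a - 1) * (b \<bullet> e))"
  by (rule ext, rule pderiv_dir_eq) (auto intro!: derivative_eq_intros simp: mult_ac)

lemma laplacian_inner_power:
  fixes e :: "'a::euclidean_space" assumes e: "e \<in> Basis"
  shows "laplacian (\<lambda>X. (X \<bullet> e) ^ a) = (\<lambda>X. real (a * (a - 1)) * (X \<bullet> e) ^ (a - 2))"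
proof
  fix X :: 'a
  have "pderiv_dir b (\<lambda>X::'a. real a * (X \<bullet> e) ^ (a - 1) * (b \<bullet> e)) = (\<lambda>X. real (a * (a - 1)) * (X \<bullet> e) ^ (a - 2) * (b \<bullet> e)\<^sup>2)" for b
  proof -
    have "(\<lambda>X::'a. real a * (X \<bullet> e) ^ (a - 1) * (b \<bullet> e)) = (\<lambda>X. (real a * (b \<bullet> e)) * (X \<bullet> e) ^ (a - 1))"
      by (simp add: mult_ac)
    then show ?thesis
      by (simp only:, subst pderiv_dir_cmult, intro smooth_intros)
         (auto simp: pderiv_dir_inner_power power2_eq_square mult_ac numeral_2_eq_2)
  qed
  then have "laplacian (\<lambda>X. (X \<bullet> e) ^ a) X = (\<Sum>b\<in>Basis. real (a * (a - 1)) * (X \<bullet> e) ^ (a - 2) * (e \<bullet> b)\<^sup>2)"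
    unfolding laplacian_def pderiv_dir_inner_power by (simp add: inner_commute)
  also have "\<dots> = real (a * (a - 1)) * (X \<bullet> e) ^ (a - 2)"
    using e by (simp add: sum_distrib_left[symmetric] sum_inner_square)
  finally show "laplacian (\<lambda>X. (X \<bullet> e) ^ a) X = real (a * (a - 1)) * (X \<bullet> e) ^ (a - 2)" .
qed

lemma laplacian_power_radial:
  fixes e :: "'a::euclidean_space" and \<tau> \<tau>1 \<tau>2 :: "real \<Rightarrow> real"
  assumes e: "e \<in> Basis" and \<tau>: "smooth \<tau>"
  defines "\<tau>1 \<equiv> pderiv_dir 1 \<tau>"
  defines "\<tau>2 \<equiv> pderiv_dir 1 \<tau>1"
  shows "laplacian (\<lambda>X. (X \<bullet> e) ^ a * \<tau> ((norm X)\<^sup>2)) =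
    (\<lambda>X. real (a * (a - 1)) * ((X \<bullet> e) ^ (a - 2) * \<tau> ((norm X)\<^sup>2))
       + (X \<bullet> e) ^ a * (4 * (norm X)\<^sup>2 * \<tau>2 ((norm X)\<^sup>2) + (2 * DIM('a) + 4 * a) * \<tau>1 ((norm X)\<^sup>2)))"
proof
  fix X :: 'a
  have s: "smooth \<tau>1" using \<tau> unfolding \<tau>1_def by (rule smooth_pderiv)
  have 1: "laplacian (\<lambda>X::'a. \<tau> ((norm X)\<^sup>2)) = (\<lambda>X. 4 * (norm X)\<^sup>2 * \<tau>2 ((norm X)\<^sup>2) + 2 * DIM('a) * \<tau>1 ((norm X)\<^sup>2))"
    using smooth_has_real_derivative[OF \<tau>] smooth_has_real_derivative[OF s]
    by (intro laplacian_radial) (simp_all add: \<tau>1_def \<tau>2_def)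
  have "(\<Sum>b\<in>Basis. pderiv_dir b (\<lambda>X. (X \<bullet> e) ^ a) X * pderiv_dir b (\<lambda>X. \<tau> ((norm X)\<^sup>2)) X)
     = (\<Sum>b\<in>Basis. (X \<bullet> b) * (e \<bullet> b) * (2 * real a * (X \<bullet> e) ^ (a - 1) * \<tau>1 ((norm X)\<^sup>2)))"
    by (simp add: pderiv_dir_inner_power pderiv_dir_radial[OF \<tau>] \<tau>1_def inner_commute mult_ac)
  also have "\<dots> = 2 * real a * ((X \<bullet> e) ^ (a - 1) * (X \<bullet> e)) * \<tau>1 ((norm X)\<^sup>2)"
    by (simp add: sum_distrib_right[symmetric] euclidean_inner[of X e, symmetric])
  also have "\<dots> = 2 * real a * (X \<bullet> e) ^ a * \<tau>1 ((norm X)\<^sup>2)"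
    by (cases a) auto
  finally show "laplacian (\<lambda>X. (X \<bullet> e) ^ a * \<tau> ((norm X)\<^sup>2)) X =
    real (a * (a - 1)) * ((X \<bullet> e) ^ (a - 2) * \<tau> ((norm X)\<^sup>2))
       + (X \<bullet> e) ^ a * (4 * (norm X)\<^sup>2 * \<tau>2 ((norm X)\<^sup>2) + (2 * DIM('a) + 4 * a) * \<tau>1 ((norm X)\<^sup>2))"
    by (subst laplacian_mult) (auto intro!: smooth_intros \<tau> simp: laplacian_inner_power[OF e] 1 algebra_simps)
qed

lemma pderiv_dir_inverse_power_tail:
  assumes \<tau>: "\<And>s. s > d \<Longrightarrow> \<tau> s = c / s ^ k" and d: "d \<ge> 0" and s: "s > d"
  shows "pderiv_dir 1 \<tau> s = (- (real k * c)) / s ^ Suc k"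
proof -
  have "((\<lambda>s. c * inverse s ^ k) has_real_derivative c * (real k * inverse s ^ (k - 1) * - (inverse s)\<^sup>2)) (at s)"
    using s d by (auto intro!: derivative_eq_intros simp: power2_eq_square)
  moreover have "c * (real k * inverse s ^ (k - 1) * - (inverse s)\<^sup>2) = (- (real k * c)) / s ^ Suc k"
    by (cases k) (simp_all add: power_inverse divide_inverse power2_eq_square)
  moreover have "(\<lambda>s. c * inverse s ^ k) = (\<lambda>s. c / s ^ k)"
    by (simp add: divide_inverse power_inverse)
  ultimately have "((\<lambda>s. c / s ^ k) has_real_derivative (- (real k * c)) / s ^ Suc k) (at s)"
    by (simp only:)
  then have "(\<tau> has_real_derivative (- (real k * c)) / s ^ Suc k) (at s)"
    by (rule has_field_derivative_transform_within_open[of _ _ _ "{d<..}"]) (use s \<tau> in auto)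
  then show ?thesis by (rule pderiv_dir_real_eq)
qed

inductive radial_symbol :: "nat \<Rightarrow> ('a::euclidean_space \<Rightarrow> real) \<Rightarrow> bool" where
  radial: "smooth \<tau> \<Longrightarrow> (\<And>s. s > 1 \<Longrightarrow> \<tau> s = c / s ^ k) \<Longrightarrow> radial_symbol (2 * k) (\<lambda>X. \<tau> ((norm X)\<^sup>2))"
| coord: "radial_symbol (Suc m) f \<Longrightarrow> b \<in> Basis \<Longrightarrow> radial_symbol m (\<lambda>X. (X \<bullet> b) * f X)"
| add: "radial_symbol m f \<Longrightarrow> radial_symbol m g \<Longrightarrow> radial_symbol m (\<lambda>X. f X + g X)"
| scale: "radial_symbol m f \<Longrightarrow> radial_symbol m (\<lambda>X. c * f X)"

lemma radial_symbol_smooth: "radial_symbol m f \<Longrightarrow> smooth f"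
  by (induction rule: radial_symbol.induct) (auto intro: smooth_intros)

lemma radial_symbol_pderiv:
  "radial_symbol m f \<Longrightarrow> b \<in> Basis \<Longrightarrow> radial_symbol (Suc m) (pderiv_dir b f)"
proof (induction rule: radial_symbol.induct)
  case (radial \<tau> c k)
  have "pderiv_dir 1 \<tau> s = (- (real k * c)) / s ^ Suc k" if s: "s > 1" for s
    by (rule pderiv_dir_inverse_power_tail[OF radial(2) _ s]) auto
  then have "radial_symbol (2 * Suc k) (\<lambda>X::'a. pderiv_dir 1 \<tau> ((norm X)\<^sup>2))"
    using radial by (intro radial_symbol.radial[where c = "- (real k * c)"] smooth_pderiv) auto
  then have "radial_symbol (Suc (2 * k)) (\<lambda>X::'a. 2 * ((X \<bullet> b) * pderiv_dir 1 \<tau> ((norm X)\<^sup>2)))"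
    using radial by (intro radial_symbol.scale radial_symbol.coord) auto
  then show ?case by (simp add: pderiv_dir_radial[OF radial(1)] mult.assoc)
next
  case (coord m f c)
  have "pderiv_dir b (\<lambda>X. (X \<bullet> c) * f X) = (\<lambda>X. (b \<bullet> c) * f X + (X \<bullet> c) * pderiv_dir b f X)"
    using radial_symbol_smooth[OF coord(1)]
    by (subst pderiv_dir_mult) (auto intro: smooth_imp_differentiable smooth_intros)
  then show ?case using coord by (auto intro!: radial_symbol.add radial_symbol.scale radial_symbol.coord)
next
  case (add m f g)
  then show ?case
    by (subst pderiv_dir_add) (auto intro: smooth_imp_differentiable radial_symbol_smooth radial_symbol.add)
next
  case (scale m f c)
  then show ?case
    by (subst pderiv_dir_cmult) (auto intro: radial_symbol_smooth radial_symbol.scale)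
qed

lemma radial_symbol_bound: "radial_symbol m f \<Longrightarrow> \<exists>C. \<forall>X. \<bar>f X\<bar> * (1 + norm X) ^ m \<le> C"
proof (induction rule: radial_symbol.induct)
  case (radial \<tau> c k)
  have "compact ((\<lambda>X::'a. \<bar>\<tau> ((norm X)\<^sup>2)\<bar> * (1 + norm X) ^ (2 * k)) ` cball 0 1)"
    by (intro compact_continuous_image continuous_intros continuous_on_compose2[OF smooth_imp_continuous[OF radial(1)]]) auto
  then obtain C where C: "\<And>X::'a. X \<in> cball 0 1 \<Longrightarrow> \<bar>\<tau> ((norm X)\<^sup>2)\<bar> * (1 + norm X) ^ (2 * k) \<le> C"
    by (meson bdd_above.E bounded_imp_bdd_above compact_imp_bounded imageI)
  have "\<bar>\<tau> ((norm X)\<^sup>2)\<bar> * (1 + norm X) ^ (2 * k) \<le> max C (\<bar>c\<bar> * 2 ^ (2 * k))" for X :: 'a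
  proof (cases "norm X \<le> 1")
    case False
    then have "\<bar>\<tau> ((norm X)\<^sup>2)\<bar> * (1 + norm X) ^ (2 * k) = \<bar>c\<bar> * ((1 + norm X) / norm X) ^ (2 * k)"
      using radial(2)[of "(norm X)\<^sup>2"] by (simp add: power_mult[symmetric] power_divide one_less_power)
    also have "\<dots> \<le> \<bar>c\<bar> * 2 ^ (2 * k)"
      using False by (intro mult_left_mono power_mono) (auto simp: divide_simps)
    finally show ?thesis by simp
  qed (use C[of X] in auto)
  then show ?case by blast
next
  case (coord m f b)
  then obtain C where C: "\<And>X. \<bar>f X\<bar> * (1 + norm X) ^ Suc m \<le> C" by blast
  have "\<bar>(X \<bullet> b) * f X\<bar> * (1 + norm X) ^ m \<le> C" for X
  proof -
    have "\<bar>X \<bullet> b\<bar> \<le> 1 + norm X" using Basis_le_norm[OF coord(2), of X] by simp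
    then have "\<bar>X \<bullet> b\<bar> * (\<bar>f X\<bar> * (1 + norm X) ^ m) \<le> (1 + norm X) * (\<bar>f X\<bar> * (1 + norm X) ^ m)"
      by (intro mult_right_mono) auto
    also have "\<dots> \<le> C" using C[of X] by (simp add: mult_ac)
    finally show ?thesis by (simp add: abs_mult mult_ac)
  qed
  then show ?case by blast
next
  case (add m f g)
  then obtain C D where CD: "\<And>X. \<bar>f X\<bar> * (1 + norm X) ^ m \<le> C" "\<And>X. \<bar>g X\<bar> * (1 + norm X) ^ m \<le> D" by blast
  have "\<bar>f X + g X\<bar> * (1 + norm X) ^ m \<le> C + D" for X
  proof -
    have "\<bar>f X + g X\<bar> * (1 + norm X) ^ m \<le> (\<bar>f X\<bar> + \<bar>g X\<bar>) * (1 + norm X) ^ m"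
      by (intro mult_right_mono) auto
    then show ?thesis using CD[of X] by (simp add: distrib_right)
  qed
  then show ?case by blast
next
  case (scale m f c)
  then obtain C where C: "\<And>X. \<bar>f X\<bar> * (1 + norm X) ^ m \<le> C" by blast
  have "\<bar>c * f X\<bar> * (1 + norm X) ^ m \<le> \<bar>c\<bar> * C" for X
    using mult_left_mono[OF C[of X], of "\<bar>c\<bar>"] by (simp add: abs_mult mult_ac)
  then show ?case by blast
qed

lemma radial_symbol_decays:
  fixes f :: "'a::euclidean_space \<Rightarrow> real"
  assumes "radial_symbol m f"
  shows "decays m f"
proof (rule decays_coinduct[where P = "\<lambda>f. \<exists>j\<ge>m. radial_symbol j f"])
  show "\<exists>j\<ge>m. radial_symbol j f" using assms by blast
  fix f :: "'a \<Rightarrow> real" assume "\<exists>j\<ge>m. radial_symbol j f"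
  then obtain j where j: "j \<ge> m" "radial_symbol j f" by blast
  show "f differentiable_on UNIV" using j radial_symbol_smooth smooth_imp_differentiable by blast
  obtain C where C: "\<And>X. \<bar>f X\<bar> * (1 + norm X) ^ j \<le> C" using radial_symbol_bound[OF j(2)] by blast
  have "\<bar>f X\<bar> * (1 + norm X) ^ m \<le> C" for X
    using C[of X] j(1) by (smt (verit) mult_left_mono norm_ge_zero power_increasing abs_ge_zero)
  then show "\<exists>C. \<forall>X. \<bar>f X\<bar> * (1 + norm X) ^ m \<le> C" by blast
  fix b :: 'a assume "b \<in> Basis"
  then show "\<exists>j\<ge>m. radial_symbol j (pderiv_dir b f)"
    using radial_symbol_pderiv[OF j(2)] j(1) by (intro exI[of _ "Suc j"]) auto
qed

section \<open>The kernel\<close>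

lemma nn_integral_gaussian:
  assumes t: "t > 0"
  shows "(\<integral>\<^sup>+ s. ennreal (exp (- t * s\<^sup>2)) \<partial>lborel) = ennreal (sqrt (pi / t))"
proof -
  define \<sigma> where "\<sigma> = sqrt (1 / (2 * t))"
  have \<sigma>: "\<sigma> > 0" "\<sigma>\<^sup>2 = 1 / (2 * t)" using t by (auto simp: \<sigma>_def)
  have "exp (- t * s\<^sup>2) = sqrt (pi / t) * normal_density 0 \<sigma> s" for s
    using t unfolding normal_density_def \<sigma>(2) by (simp add: field_simps)
  then have "(\<integral>\<^sup>+ s. ennreal (exp (- t * s\<^sup>2)) \<partial>lborel) = ennreal (sqrt (pi / t)) * (\<integral>\<^sup>+ s. ennreal (normal_density 0 \<sigma> s) \<partial>lborel)"
    using t by (simp add: ennreal_mult nn_integral_cmult)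
  also have "(\<integral>\<^sup>+ s. ennreal (normal_density 0 \<sigma> s) \<partial>lborel) = 1"
    using \<sigma> by (subst nn_integral_eq_integral) (auto simp: integral_normal_density)
  finally show ?thesis by simp
qed

lemma nn_integral_gaussian_3:
  assumes t: "t > 0"
  shows "(\<integral>\<^sup>+ z. ennreal (exp (- t * (norm z)\<^sup>2)) \<partial>(lborel :: (real^3) measure)) = ennreal (sqrt (pi / t) ^ 3)"
proof -
  have "ennreal (exp (- t * (norm z)\<^sup>2)) = (\<Prod>b\<in>Basis. ennreal (exp (- t * (z \<bullet> b)\<^sup>2)))" for z :: "real^3"
    by (simp add: prod_ennreal exp_sum[symmetric] sum_distrib_left[symmetric] sum_inner_square sum_negf)
  then have "(\<integral>\<^sup>+ z. ennreal (exp (- t * (norm z)\<^sup>2)) \<partial>(lborel :: (real^3) measure))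
      = (\<Prod>b\<in>(Basis :: (real^3) set). (\<integral>\<^sup>+ s. ennreal (exp (- t * s\<^sup>2)) \<partial>lborel))"
    by (simp only:) (rule nn_integral_lborel_prod, auto)
  then show ?thesis using t nn_integral_gaussian[OF t] by (simp add: ennreal_power)
qed

lemma nn_integral_power_exp:
  assumes l: "l > 0"
  shows "(\<integral>\<^sup>+ t. ennreal (indicator {0..} t * (t ^ k * exp (- l * t) / fact k)) \<partial>lborel) = ennreal (inverse (l ^ Suc k))"
proof -
  have "1 = (\<integral>\<^sup>+ x. ennreal (erlang_density k l x) \<partial>lborel)"
    using nn_integral_erlang_ith_moment[OF l, of k 0] by simp
  also have "\<dots> = (\<integral>\<^sup>+ t. ennreal (l ^ Suc k) * ennreal (indicator {0..} t * (t ^ k * exp (- l * t) / fact k)) \<partial>lborel)"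
    using l by (intro nn_integral_cong)
      (auto simp: erlang_density_def indicator_def ennreal_mult[symmetric] simp del: power_Suc)
  also have "\<dots> = ennreal (l ^ Suc k) * (\<integral>\<^sup>+ t. ennreal (indicator {0..} t * (t ^ k * exp (- l * t) / fact k)) \<partial>lborel)"
    by (rule nn_integral_cmult) simp
  finally have eq: "1 = ennreal (l ^ Suc k) * (\<integral>\<^sup>+ t. ennreal (indicator {0..} t * (t ^ k * exp (- l * t) / fact k)) \<partial>lborel)" .
  have "ennreal (inverse (l ^ Suc k)) * (ennreal (l ^ Suc k) * I) = I" for I
    using l by (simp add: mult.assoc[symmetric] ennreal_mult[symmetric] del: power_Suc)
  from this[of "(\<integral>\<^sup>+ t. ennreal (indicator {0..} t * (t ^ k * exp (- l * t) / fact k)) \<partial>lborel)"]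
  show ?thesis unfolding eq[symmetric] by simp
qed

text \<open>Writing the power as a Gamma integral turns the integrand into a Gaussian.\<close>

lemma nn_integral_inverse_power_3:
  assumes k: "k \<ge> 1"
  shows "(\<integral>\<^sup>+ z. ennreal (inverse ((1 + (norm z)\<^sup>2) ^ Suc k)) \<partial>(lborel :: (real^3) measure))
     = ennreal (pi powr (3/2) / fact k) * ennreal (Gamma (real k - 1/2))"
proof -
  have "(\<integral>\<^sup>+ z. ennreal (inverse ((1 + (norm z)\<^sup>2) ^ Suc k)) \<partial>(lborel :: (real^3) measure))
     = (\<integral>\<^sup>+ z. (\<integral>\<^sup>+ t. ennreal (indicator {0..} t * (t ^ k * exp (- (1 + (norm z)\<^sup>2) * t) / fact k)) \<partial>lborel) \<partial>(lborel :: (real^3) measure))"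
    by (intro nn_integral_cong nn_integral_power_exp[symmetric]) (simp add: add_pos_nonneg)
  also have "\<dots> = (\<integral>\<^sup>+ t. (\<integral>\<^sup>+ z. ennreal (indicator {0..} t * (t ^ k * exp (- (1 + (norm z)\<^sup>2) * t) / fact k)) \<partial>(lborel :: (real^3) measure)) \<partial>lborel)"
    by (rule lborel_pair.Fubini') simp
  also have "\<dots> = (\<integral>\<^sup>+ t. ennreal (pi powr (3/2) / fact k) * ennreal (indicator {0..} t * t powr ((real k - 1/2) - 1) / exp t) \<partial>lborel)"
  proof (rule nn_integral_cong_AE)
    show "AE t in lborel. (\<integral>\<^sup>+ z. ennreal (indicator {0..} t * (t ^ k * exp (- (1 + (norm z)\<^sup>2) * t) / fact k)) \<partial>(lborel :: (real^3) measure))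
       = ennreal (pi powr (3/2) / fact k) * ennreal (indicator {0..} t * t powr ((real k - 1/2) - 1) / exp t)"
      using AE_lborel_singleton[of 0]
    proof eventually_elim
      fix t :: real assume t0: "t \<noteq> 0"
      show "(\<integral>\<^sup>+ z. ennreal (indicator {0..} t * (t ^ k * exp (- (1 + (norm z)\<^sup>2) * t) / fact k)) \<partial>(lborel :: (real^3) measure))
       = ennreal (pi powr (3/2) / fact k) * ennreal (indicator {0..} t * t powr ((real k - 1/2) - 1) / exp t)"
      proof (cases "t > 0")
        case True
        have "(\<integral>\<^sup>+ z. ennreal (indicator {0..} t * (t ^ k * exp (- (1 + (norm z)\<^sup>2) * t) / fact k)) \<partial>(lborel :: (real^3) measure))
           = (\<integral>\<^sup>+ z. ennreal (t ^ k * exp (- t) / fact k) * ennreal (exp (- t * (norm z)\<^sup>2)) \<partial>(lborel :: (real^3) measure))"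
          using True by (intro nn_integral_cong) (simp add: ennreal_mult[symmetric] mult_exp_exp algebra_simps)
        also have "\<dots> = ennreal (t ^ k * exp (- t) / fact k) * ennreal (sqrt (pi / t) ^ 3)"
          by (subst nn_integral_cmult) (simp_all only: nn_integral_gaussian_3[OF True], simp)
        also have "\<dots> = ennreal (t ^ k * exp (- t) / fact k * sqrt (pi / t) ^ 3)"
          using True by (simp add: ennreal_mult[symmetric])
        also have "sqrt (pi / t) ^ 3 = (pi / t) powr (3/2)"
          using True by (simp add: powr_half_sqrt[symmetric] powr_power)
        also have "t ^ k * exp (- t) / fact k * (pi / t) powr (3/2) = pi powr (3/2) / fact k * (t powr ((real k - 1/2) - 1) / exp t)"
        proof -
          have "t powr ((real k - 1/2) - 1) = t ^ k / t powr (3/2)"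
            using True by (simp add: powr_realpow[symmetric] powr_diff[symmetric])
          then show ?thesis using True by (simp add: powr_divide exp_minus field_simps)
        qed
        finally show ?thesis using True by (simp add: ennreal_mult[symmetric])
      qed (use t0 in auto)
    qed
  qed
  also have "\<dots> = ennreal (pi powr (3/2) / fact k) * ennreal (Gamma (real k - 1/2))"
    using Gamma_conv_nn_integral_real[of "real k - 1/2"] k by (simp add: nn_integral_cmult)
  finally show ?thesis .
qed

lemma integral_inverse_power_3:
  shows "has_bochner_integral (lborel :: (real^3) measure) (\<lambda>z. inverse ((1 + (norm z)\<^sup>2) ^ 3)) (pi\<^sup>2 / 4)"
    and "has_bochner_integral (lborel :: (real^3) measure) (\<lambda>z. inverse ((1 + (norm z)\<^sup>2) ^ 4)) (pi\<^sup>2 / 8)"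
    and "integrable (lborel :: (real^3) measure) (\<lambda>z. inverse ((1 + (norm z)\<^sup>2) ^ 2))"
proof -
  have p: "pi powr (3/2) * sqrt pi = pi\<^sup>2"
    by (simp add: powr_half_sqrt[symmetric] powr_add[symmetric])
  have G1: "Gamma (3/2 :: real) = sqrt pi / 2"
    using Gamma_plus1[of "1/2 :: real"] nonpos_Ints_nonpos[of "1/2 :: real"]
    by (auto simp: Gamma_one_half_real)
  have "Gamma (5/2 :: real) = 3 * sqrt pi / 4"
    using Gamma_plus1[of "3/2 :: real"] nonpos_Ints_nonpos[of "3/2 :: real"] G1 by auto
  note G = G1 this
  have G0: "Gamma (1/2 :: real) = sqrt pi" by (rule Gamma_one_half_real)
  have nn: "0 \<le> inverse ((1 + (norm z)\<^sup>2) ^ n)" for z :: "real^3" and n by simp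
  show "has_bochner_integral (lborel :: (real^3) measure) (\<lambda>z. inverse ((1 + (norm z)\<^sup>2) ^ 3)) (pi\<^sup>2 / 4)"
    using nn_integral_inverse_power_3[of 2] p
    by (intro has_bochner_integral_nn_integral)
       (auto simp: G ennreal_mult[symmetric] eval_nat_numeral fact_numeral intro!: arg_cong[where f = ennreal])
  show "has_bochner_integral (lborel :: (real^3) measure) (\<lambda>z. inverse ((1 + (norm z)\<^sup>2) ^ 4)) (pi\<^sup>2 / 8)"
    using nn_integral_inverse_power_3[of 3] p[unfolded mult.commute[of "pi powr _"]]
    by (intro has_bochner_integral_nn_integral)
       (auto simp: G ennreal_mult[symmetric] eval_nat_numeral fact_numeral intro!: arg_cong[where f = ennreal])
  show "integrable (lborel :: (real^3) measure) (\<lambda>z. inverse ((1 + (norm z)\<^sup>2) ^ 2))"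
    using nn_integral_inverse_power_3[of 1]
    by (intro integrableI_nonneg) (auto simp: eval_nat_numeral ennreal_mult_less_top)
qed

lemma fst_snd_measurable_R4 [measurable]:
  "(\<lambda>X::R4. fst X) \<in> borel_measurable borel" "(\<lambda>X::R4. snd X) \<in> borel_measurable borel"
  by (intro borel_measurable_continuous_onI continuous_intros)+

lemma poisson_kernel_measurable [measurable]: "poisson_kernel \<in> borel_measurable borel"
proof -
  have "poisson_kernel = (\<lambda>X. 4 / pi\<^sup>2 * (snd X ^ 3 / ((snd X)\<^sup>2 + (norm (fst X))\<^sup>2) ^ 3))"
    by (auto simp: poisson_kernel_def)
  also have "\<dots> \<in> borel_measurable borel" by measurable
  finally show ?thesis .
qed

lemma poisson_kernel_nonneg: "y \<ge> 0 \<Longrightarrow> poisson_kernel (x, y) \<ge> 0"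
  by (simp add: poisson_kernel_def)

lemma poisson_kernel_0: "poisson_kernel (x, 0) = 0"
  by (simp add: poisson_kernel_def)

lemma poisson_kernel_scaled:
  assumes s: "s > 0"
  shows "poisson_kernel (s *\<^sub>R z, s) = 4 / pi\<^sup>2 * inverse ((1 + (norm z)\<^sup>2) ^ 3) / s ^ 3"
proof -
  have "s\<^sup>2 + (norm (s *\<^sub>R z))\<^sup>2 = s\<^sup>2 * (1 + (norm z)\<^sup>2)"
    by (simp add: power_mult_distrib algebra_simps)
  then show ?thesis using s
    by (simp add: poisson_kernel_def power_mult_distrib divide_simps)
qed

lemma has_bochner_integral_poisson_kernel:
  assumes y: "y > 0"
  shows "has_bochner_integral lborel (\<lambda>x. poisson_kernel (x - x', y)) 1"
proof -
  define f where "f x = poisson_kernel (x - x', y)" for x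
  have [measurable]: "f \<in> borel_measurable borel" unfolding f_def by measurable
  have eq: "f (x' + y *\<^sub>R z) = 4 / pi\<^sup>2 * inverse ((1 + (norm z)\<^sup>2) ^ 3) / y ^ 3" for z
    using poisson_kernel_scaled[OF y, of z] by (simp add: f_def)
  have "has_bochner_integral (lborel :: (real^3) measure) (\<lambda>z. 4 / pi\<^sup>2 * inverse ((1 + (norm z)\<^sup>2) ^ 3) / y ^ 3 :: real) (4 / pi\<^sup>2 * (pi\<^sup>2 / 4) / y ^ 3)"
    by (intro has_bochner_integral_divide has_bochner_integral_mult_right) (rule integral_inverse_power_3(1))
  then have "has_bochner_integral lborel (\<lambda>z. f (x' + y *\<^sub>R z)) (1 / y ^ 3)"
    by (simp add: eq)
  then have "integrable lborel (\<lambda>z. f (x' + y *\<^sub>R z))" "(LINT z|lborel. f (x' + y *\<^sub>R z)) = 1 / y ^ 3"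
    by (auto simp: has_bochner_integral_iff)
  then have "integrable lborel f" "(LINT x|lborel. f x) = 1"
    using lborel_integral_affine[of f y x'] y by auto
  then show ?thesis by (simp add: has_bochner_integral_iff f_def[abs_def])
qed

lemma nn_integral_poisson_kernel:
  "y > 0 \<Longrightarrow> (\<integral>\<^sup>+ x. ennreal (poisson_kernel (x - x', y)) \<partial>lborel) = 1"
  using has_bochner_integral_poisson_kernel[of y x']
  by (subst nn_integral_eq_integral) (auto simp: has_bochner_integral_iff poisson_kernel_nonneg)

lemma poisson_kernel_bound:
  assumes R: "R \<ge> 1" and x: "norm x \<le> R" and y: "0 < y" "y \<le> R"
  shows "poisson_kernel (x - x', y) * (1 + norm x' ^ 6) \<le> (1 + (2 * R) ^ 6) * poisson_kernel (x - x', y) + 128 * R ^ 3"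
proof (cases "norm x' \<le> 2 * R")
  case True
  then have "1 + norm x' ^ 6 \<le> 1 + (2 * R) ^ 6" by (intro add_left_mono power_mono) auto
  then have "poisson_kernel (x - x', y) * (1 + norm x' ^ 6) \<le> poisson_kernel (x - x', y) * (1 + (2 * R) ^ 6)"
    using y poisson_kernel_nonneg by (intro mult_left_mono) auto
  then show ?thesis using R by (simp add: mult.commute add_increasing2)
next
  case False
  define r where "r = norm x'"
  have r: "r > 2 * R" using False by (simp add: r_def)
  have pos: "r > 0" "r \<ge> 1" using r R by auto
  have "r / 2 \<le> norm (x - x')" using norm_triangle_ineq3[of x x'] x r unfolding r_def by linarith
  then have "(r / 2)\<^sup>2 \<le> (norm (x - x'))\<^sup>2" using pos by (intro power_mono) auto
  then have q: "(r / 2)\<^sup>2 \<le> y\<^sup>2 + (norm (x - x'))\<^sup>2" by (smt (verit) zero_le_power2)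
  have "poisson_kernel (x - x', y) \<le> 4 / pi\<^sup>2 * (R ^ 3 / ((r / 2)\<^sup>2) ^ 3)"
    unfolding poisson_kernel_def split
    using y pos q by (intro mult_left_mono frac_le power_mono) auto
  also have "\<dots> \<le> 1 * (R ^ 3 / ((r / 2)\<^sup>2) ^ 3)"
  proof (rule mult_right_mono)
    have "2\<^sup>2 \<le> pi\<^sup>2" using pi_ge_two by (intro power_mono) auto
    then show "4 / pi\<^sup>2 \<le> 1" by simp
  qed (use R in auto)
  also have "\<dots> = 64 * R ^ 3 / r ^ 6"
    using pos by (simp add: power_divide power_mult[symmetric])
  finally have K: "poisson_kernel (x - x', y) \<le> 64 * R ^ 3 / r ^ 6" .
  have r6: "1 + r ^ 6 \<le> 2 * r ^ 6" using pos by simp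
  have "poisson_kernel (x - x', y) * (1 + r ^ 6) \<le> 64 * R ^ 3 / r ^ 6 * (2 * r ^ 6)"
    using K r6 R pos by (intro mult_mono) auto
  also have "\<dots> = 128 * R ^ 3" using pos by simp
  also have "\<dots> \<le> (1 + (2 * R) ^ 6) * poisson_kernel (x - x', y) + 128 * R ^ 3"
    using R y poisson_kernel_nonneg[of y "x - x'"] by simp
  finally show ?thesis by (simp add: r_def)
qed

section \<open>The extension is a weak solution\<close>

lemma lborel_integral_uminus:
  fixes f :: "'a::euclidean_space \<Rightarrow> real"
  assumes "f \<in> borel_measurable borel"
  shows "(LINT X|lborel. f (- X)) = (LINT X|lborel. f X)"
  using lborel_integral_affine(1)[OF assms, of "-1" 0] by simp

lemma cball_borel [measurable]: "cball a r \<in> sets borel"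
  by (rule borel_closed) simp

lemma poisson_kernel_translate_measurable [measurable]:
  "(\<lambda>X. poisson_kernel (fst X - x', snd X)) \<in> borel_measurable borel"
  by (rule measurable_compose[OF _ poisson_kernel_measurable],
      intro borel_measurable_continuous_onI continuous_intros)

lemma L1_loc_closed_measurable:
  assumes f: "f \<in> L1_loc S" and S: "closed S"
  shows "(\<lambda>X. indicator S X * f X) \<in> borel_measurable lebesgue"
proof (rule borel_measurable_LIMSEQ_real)
  fix n :: nat
  have "compact (S \<inter> cball 0 (real n))" using S by (intro closed_Int_compact) auto
  then have "f absolutely_integrable_on (S \<inter> cball 0 (real n))"
    using f unfolding L1_loc_def by blast
  then show "(\<lambda>X. indicator (S \<inter> cball 0 (real n)) X * f X) \<in> borel_measurable lebesgue"
    unfolding set_integrable_def by auto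
next
  fix X :: 'a
  obtain m :: nat where m: "norm X \<le> m" using real_arch_simple by blast
  have "\<forall>\<^sub>F n in sequentially. indicator (S \<inter> cball 0 (real n)) X * f X = indicator S X * f X"
    using eventually_ge_at_top[of m] by eventually_elim (use m in \<open>auto simp: indicator_def\<close>)
  then show "(\<lambda>n. indicator (S \<inter> cball 0 (real n)) X * f X) \<longlonglongrightarrow> indicator S X * f X"
    by (rule tendsto_eventually)
qed

lemma L6_borel_version:
  assumes "u \<in> L\<^sub>6"
  obtains v where "v \<in> borel_measurable borel" "AE x in lebesgue. u x = v x" "u \<in> borel_measurable lebesgue"
    "integrable lborel (\<lambda>x. \<bar>v x\<bar> / (1 + norm x ^ 6))"
proof -
  have u: "u \<in> L1_loc UNIV" "integrable lebesgue (\<lambda>x. \<bar>u x\<bar> / (1 + norm x ^ 6))"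
    using assms by (auto simp: L\<^sub>6_def)
  have m: "u \<in> borel_measurable lebesgue" using L1_loc_closed_measurable[OF u(1)] by simp
  obtain v where v: "v \<in> borel_measurable lborel" "AE x in lborel. u x = v x"
    using completion_ex_borel_measurable_real[OF m] by blast
  have ae: "AE x in lebesgue. u x = v x" by (rule AE_completion[OF v(2)])
  have [measurable]: "v \<in> borel_measurable borel" using v by simp
  have vm: "(\<lambda>x. \<bar>v x\<bar> / (1 + norm x ^ 6)) \<in> borel_measurable lborel" by measurable
  have "integrable lebesgue (\<lambda>x. \<bar>v x\<bar> / (1 + norm x ^ 6))"
    by (rule integrable_cong_AE_imp[OF u(2)]) (use vm ae in \<open>auto intro: measurable_completion\<close>)
  then have "integrable lborel (\<lambda>x. \<bar>v x\<bar> / (1 + norm x ^ 6))"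
    using integrable_completion[OF vm] by simp
  from that[OF _ ae m this] show ?thesis by simp
qed

lemma nn_integral_poisson_kernel_half_ball:
  assumes R: "R \<ge> 1"
  shows "\<exists>B\<ge>0. \<forall>x'. (\<integral>\<^sup>+ X. ennreal (indicator (half_space \<inter> cball 0 R) X * poisson_kernel (fst X - x', snd X)) \<partial>lborel)
     \<le> ennreal (B / (1 + norm x' ^ 6))"
proof -
  define a where "a = 1 + (2 * R) ^ 6"
  define b where "b = 128 * R ^ 3"
  have ab: "a \<ge> 0" "b \<ge> 0" using R by (auto simp: a_def b_def)
  define E where "E = ennreal a + ennreal b * emeasure lborel (cball (0::real^3) R)"
  have Efin: "E < top"
    unfolding E_def using emeasure_lborel_cball_finite[of "0::real^3" R]
    by (auto simp: ennreal_mult_less_top less_top)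
  define B where "B = enn2real (E * ennreal R)"
  have B: "ennreal B = E * ennreal R" unfolding B_def using Efin by (simp add: ennreal_mult_less_top)
  have "(\<integral>\<^sup>+ X. ennreal (indicator (half_space \<inter> cball 0 R) X * poisson_kernel (fst X - x', snd X)) \<partial>lborel)
     \<le> ennreal (B / (1 + norm x' ^ 6))" for x' :: "real^3"
  proof -
    define w where "w = 1 / (1 + norm x' ^ 6)"
    have w: "w > 0" by (simp add: w_def add_pos_nonneg)
    define g where "g X = indicator {0<..R} (snd X) * (a * poisson_kernel (fst X - x', snd X) + b * indicator (cball 0 R) (fst X))" for X :: R4
    have g0: "0 \<le> g X" for X
      using ab poisson_kernel_nonneg[of "snd X" "fst X - x'"] by (auto simp: g_def indicator_def)
    have "(\<lambda>X::R4. indicator {0<..R} (snd X) :: real) \<in> borel_measurable borel"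
      by (rule measurable_compose[OF fst_snd_measurable_R4(2)]) simp
    moreover have "(\<lambda>X::R4. indicator (cball 0 R) (fst X) :: real) \<in> borel_measurable borel"
      by (rule measurable_compose[OF fst_snd_measurable_R4(1)]) (simp add: borel_measurable_indicator)
    ultimately have [measurable]: "g \<in> borel_measurable borel"
      unfolding g_def by (intro borel_measurable_times borel_measurable_add borel_measurable_const poisson_kernel_translate_measurable)
    have le: "indicator (half_space \<inter> cball 0 R) X * poisson_kernel (fst X - x', snd X) \<le> w * g X" for X
    proof (cases "X \<in> half_space \<inter> cball 0 R")
      case True
      obtain x y where X: "X = (x, y)" by (cases X)
      have *: "norm x \<le> R" "0 < y" "y \<le> R"
        using True norm_fst_le[of x y] norm_snd_le[of y x] unfolding X half_space_def by auto
      from poisson_kernel_bound[OF R *, of x'] have "poisson_kernel (x - x', y) * (1 + norm x' ^ 6) \<le> g X"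
        using * by (simp add: X g_def a_def b_def)
      moreover have "0 < 1 + norm x' ^ 6" by (simp add: add_pos_nonneg)
      ultimately show ?thesis using True by (simp add: X w_def field_simps)
    qed (use g0[of X] w in simp)
    have "(\<integral>\<^sup>+ X. ennreal (g X) \<partial>lborel) = (\<integral>\<^sup>+ y. (\<integral>\<^sup>+ x. ennreal (g (x, y)) \<partial>lborel) \<partial>lborel)"
      unfolding lborel_prod[symmetric] by (rule lborel_pair.nn_integral_snd[symmetric]) (simp add: lborel_prod)
    also have "\<dots> \<le> (\<integral>\<^sup>+ y. E * indicator {0..R} y \<partial>lborel)"
    proof (rule nn_integral_mono)
      fix y :: real
      show "(\<integral>\<^sup>+ x. ennreal (g (x, y)) \<partial>lborel) \<le> E * indicator {0..R} y"
      proof (cases "0 < y \<and> y \<le> R")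
        case True
        have "(\<integral>\<^sup>+ x. ennreal (g (x, y)) \<partial>lborel)
          = (\<integral>\<^sup>+ x. ennreal a * ennreal (poisson_kernel (x - x', y)) + ennreal b * indicator (cball 0 R) x \<partial>lborel)"
          using True ab poisson_kernel_nonneg
          by (intro nn_integral_cong) (auto simp: g_def ennreal_plus[symmetric] ennreal_mult[symmetric] indicator_def simp del: ennreal_plus)
        also have "\<dots> = E"
          using True by (subst nn_integral_add) (measurable, simp add: nn_integral_cmult nn_integral_poisson_kernel E_def)
        finally show ?thesis using True by simp
      qed (simp add: g_def indicator_def)
    qed
    also have "\<dots> = E * ennreal R" using R by (simp add: nn_integral_cmult)
    finally have gE: "(\<integral>\<^sup>+ X. ennreal (g X) \<partial>lborel) \<le> E * ennreal R" .
    have "(\<integral>\<^sup>+ X. ennreal (indicator (half_space \<inter> cball 0 R) X * poisson_kernel (fst X - x', snd X)) \<partial>lborel)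
       \<le> (\<integral>\<^sup>+ X. ennreal w * ennreal (g X) \<partial>lborel)"
      using le w g0 by (intro nn_integral_mono) (simp add: ennreal_mult[symmetric] ennreal_leI)
    also have "\<dots> \<le> ennreal w * (E * ennreal R)"
      using gE by (simp add: nn_integral_cmult mult_left_mono)
    also have "\<dots> = ennreal (B / (1 + norm x' ^ 6))"
      unfolding B[symmetric] using w by (simp add: ennreal_mult[symmetric] w_def B_def)
    finally show ?thesis .
  qed
  then show ?thesis by (intro exI[of _ B]) (auto simp: B_def)
qed

lemma poisson_kernel_test_integrable:
  assumes [measurable]: "f \<in> borel_measurable borel"
    and f: "\<And>X. \<bar>f X\<bar> \<le> M" "\<And>X. X \<notin> half_space \<inter> cball 0 R \<Longrightarrow> f X = 0" and R: "R \<ge> 1"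
  shows "integrable lborel (\<lambda>X. f X * poisson_kernel (fst X - x', snd X))"
proof -
  obtain B where "B \<ge> 0" and B: "\<And>x'. (\<integral>\<^sup>+ X. ennreal (indicator (half_space \<inter> cball 0 R) X * poisson_kernel (fst X - x', snd X)) \<partial>lborel)
     \<le> ennreal (B / (1 + norm x' ^ 6))"
    using nn_integral_poisson_kernel_half_ball[OF R] by blast
  have M: "M \<ge> 0" using f(1)[of 0] by simp
  have "integrable lborel (\<lambda>X. M * (indicator (half_space \<inter> cball 0 R) X * poisson_kernel (fst X - x', snd X)))"
  proof (rule integrable_mult_right, rule integrableI_nonneg)
    show "AE X in lborel. 0 \<le> indicator (half_space \<inter> cball 0 R) X * poisson_kernel (fst X - x', snd X)"
      by (rule AE_I2) (auto simp: indicator_def half_space_def intro!: poisson_kernel_nonneg)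
    show "(\<integral>\<^sup>+ X. ennreal (indicator (half_space \<inter> cball 0 R) X * poisson_kernel (fst X - x', snd X)) \<partial>lborel) < \<infinity>"
      using B by (rule le_less_trans) simp
  qed measurable
  then show ?thesis
  proof (rule Bochner_Integration.integrable_bound)
    show "AE X in lborel. norm (f X * poisson_kernel (fst X - x', snd X))
       \<le> norm (M * (indicator (half_space \<inter> cball 0 R) X * poisson_kernel (fst X - x', snd X)))"
    proof (rule AE_I2)
      fix X
      show "norm (f X * poisson_kernel (fst X - x', snd X))
         \<le> norm (M * (indicator (half_space \<inter> cball 0 R) X * poisson_kernel (fst X - x', snd X)))"
        using f(1)[of X] f(2)[of X] M
        by (cases "X \<in> half_space \<inter> cball 0 R") (auto simp: abs_mult intro!: mult_right_mono)
    qed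
  qed simp
qed

lemma poisson_fubini:
  assumes v[measurable]: "v \<in> borel_measurable borel" "integrable lborel (\<lambda>x. \<bar>v x\<bar> / (1 + norm x ^ 6))"
    and [measurable]: "f \<in> borel_measurable borel"
    and f: "\<And>X. \<bar>f X\<bar> \<le> M" "\<And>X. X \<notin> half_space \<inter> cball 0 R \<Longrightarrow> f X = 0" and R: "R \<ge> 1"
  shows "integrable lborel (\<lambda>X. f X * (LINT x'|lborel. poisson_kernel (fst X - x', snd X) * v x'))"
    and "(LINT X|lborel. f X * (LINT x'|lborel. poisson_kernel (fst X - x', snd X) * v x'))
       = (LINT x'|lborel. v x' * (LINT X|lborel. f X * poisson_kernel (fst X - x', snd X)))"
proof -
  define G where "G x' X = v x' * (f X * poisson_kernel (fst X - x', snd X))" for x' :: "real^3" and X :: R4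
  obtain B where B0: "B \<ge> 0" and B: "\<And>x'. (\<integral>\<^sup>+ X. ennreal (indicator (half_space \<inter> cball 0 R) X * poisson_kernel (fst X - x', snd X)) \<partial>lborel)
     \<le> ennreal (B / (1 + norm x' ^ 6))"
    using nn_integral_poisson_kernel_half_ball[OF R] by blast
  have M: "M \<ge> 0" using f(1)[of 0] by simp
  have bd: "norm (f X * poisson_kernel (fst X - x', snd X)) \<le> M * (indicator (half_space \<inter> cball 0 R) X * poisson_kernel (fst X - x', snd X))" for X x'
    using f(1)[of X] f(2)[of X] M poisson_kernel_nonneg[of "snd X" "fst X - x'"]
    by (cases "X \<in> half_space \<inter> cball 0 R") (auto simp: abs_mult half_space_def intro!: mult_right_mono)
  have "(\<integral>\<^sup>+ x'. (\<integral>\<^sup>+ X. ennreal (norm (G x' X)) \<partial>lborel) \<partial>lborel)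
      \<le> (\<integral>\<^sup>+ x'. ennreal (M * B) * ennreal (\<bar>v x'\<bar> / (1 + norm x' ^ 6)) \<partial>lborel)"
  proof (rule nn_integral_mono)
    fix x' :: "real^3"
    have "(\<integral>\<^sup>+ X. ennreal (norm (G x' X)) \<partial>lborel)
       \<le> (\<integral>\<^sup>+ X. ennreal (\<bar>v x'\<bar> * M) * ennreal (indicator (half_space \<inter> cball 0 R) X * poisson_kernel (fst X - x', snd X)) \<partial>lborel)"
    proof (rule nn_integral_mono)
      fix X
      have "norm (G x' X) \<le> \<bar>v x'\<bar> * (M * (indicator (half_space \<inter> cball 0 R) X * poisson_kernel (fst X - x', snd X)))"
        unfolding G_def norm_mult[of "v x'"] real_norm_def[of "v x'"] by (intro mult_left_mono bd) auto
      then show "ennreal (norm (G x' X)) \<le> ennreal (\<bar>v x'\<bar> * M) * ennreal (indicator (half_space \<inter> cball 0 R) X * poisson_kernel (fst X - x', snd X))"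
        using M by (subst ennreal_mult[symmetric])
          (auto simp: mult.assoc indicator_def half_space_def intro!: poisson_kernel_nonneg ennreal_leI)
    qed
    also have "\<dots> \<le> ennreal (\<bar>v x'\<bar> * M) * ennreal (B / (1 + norm x' ^ 6))"
      by (subst nn_integral_cmult) (auto intro!: mult_left_mono B)
    also have "\<dots> = ennreal (M * B) * ennreal (\<bar>v x'\<bar> / (1 + norm x' ^ 6))"
      using M B0 by (simp add: ennreal_mult[symmetric] add_nonneg_nonneg mult_ac)
    finally show "(\<integral>\<^sup>+ X. ennreal (norm (G x' X)) \<partial>lborel) \<le> ennreal (M * B) * ennreal (\<bar>v x'\<bar> / (1 + norm x' ^ 6))" .
  qed
  also have "\<dots> < \<infinity>"
    using v(2) unfolding integrable_iff_bounded
    by (subst nn_integral_cmult) (auto simp: ennreal_mult_less_top abs_div add_nonneg_nonneg)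
  finally have fin: "(\<integral>\<^sup>+ x'. (\<integral>\<^sup>+ X. ennreal (norm (G x' X)) \<partial>lborel) \<partial>lborel) < \<infinity>" .
  have Gm: "(\<lambda>(x', X). G x' X) \<in> borel_measurable (lborel \<Otimes>\<^sub>M lborel)"
    unfolding G_def by measurable
  have int: "integrable (lborel \<Otimes>\<^sub>M lborel) (\<lambda>(x', X). G x' X)"
  proof (rule integrableI_bounded[OF Gm])
    have "(\<integral>\<^sup>+ z. ennreal (norm (case z of (x', X) \<Rightarrow> G x' X)) \<partial>(lborel \<Otimes>\<^sub>M lborel))
       = (\<integral>\<^sup>+ x'. (\<integral>\<^sup>+ X. ennreal (norm (G x' X)) \<partial>lborel) \<partial>lborel)"
      using Gm by (subst lborel.nn_integral_fst[symmetric]) (auto simp: case_prod_beta)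
    with fin show "(\<integral>\<^sup>+ z. ennreal (norm (case z of (x', X) \<Rightarrow> G x' X)) \<partial>(lborel \<Otimes>\<^sub>M lborel)) < \<infinity>" by simp
  qed
  have eq: "(LINT x'|lborel. G x' X) = f X * (LINT x'|lborel. poisson_kernel (fst X - x', snd X) * v x')" for X
    unfolding G_def by (subst integral_mult_right_zero[symmetric]) (simp add: mult_ac)
  have eq2: "(LINT X|lborel. G x' X) = v x' * (LINT X|lborel. f X * poisson_kernel (fst X - x', snd X))" for x'
    unfolding G_def by simp
  show "integrable lborel (\<lambda>X. f X * (LINT x'|lborel. poisson_kernel (fst X - x', snd X) * v x'))"
    using lborel_pair.integrable_snd[OF int] by (simp add: eq)
  show "(LINT X|lborel. f X * (LINT x'|lborel. poisson_kernel (fst X - x', snd X) * v x'))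
       = (LINT x'|lborel. v x' * (LINT X|lborel. f X * poisson_kernel (fst X - x', snd X)))"
    using lborel_pair.integral_snd[OF int] lborel_pair.integral_fst[OF int] by (simp add: eq eq2)
qed

lemma integral_poisson_kernel_tendsto:
  fixes g :: "real^3 \<Rightarrow> real"
  assumes g: "continuous_on UNIV g" "\<And>x. \<bar>g x\<bar> \<le> M" and s: "\<And>n. s n > 0" "s \<longlonglongrightarrow> 0"
  shows "(\<lambda>n. LINT x|lborel. poisson_kernel (x - x', s n) * g x) \<longlonglongrightarrow> g x'"
proof -
  have [measurable]: "g \<in> borel_measurable borel" using g(1) by (rule borel_measurable_continuous_onI)
  have [measurable]: "(\<lambda>x. poisson_kernel (x - x', t)) \<in> borel_measurable borel" for t by measurable
  define k where "k z = 4 / pi\<^sup>2 * inverse ((1 + (norm z)\<^sup>2) ^ 3)" for z :: "real^3"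
  have [measurable]: "k \<in> borel_measurable borel" unfolding k_def by measurable
  have k0: "k z \<ge> 0" for z by (simp add: k_def)
  have k: "has_bochner_integral lborel k 1"
    using has_bochner_integral_mult_right[OF integral_inverse_power_3(1), of "4 / pi\<^sup>2"] by (simp add: k_def[abs_def])
  have eq: "(LINT x|lborel. poisson_kernel (x - x', s n) * g x) = (LINT z|lborel. k z * g (x' + s n *\<^sub>R z))" for n
  proof -
    have "(LINT z|lborel. poisson_kernel ((x' + s n *\<^sub>R z) - x', s n) * g (x' + s n *\<^sub>R z))
       = (LINT x|lborel. poisson_kernel (x - x', s n) * g x) / \<bar>s n\<bar> ^ DIM(real^3)"
      by (rule lborel_integral_affine(1)) (use s in \<open>auto simp: less_imp_neq[symmetric]\<close>)
    moreover have "poisson_kernel ((x' + s n *\<^sub>R z) - x', s n) = k z / s n ^ 3" for z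
      using poisson_kernel_scaled[OF s(1), of n z] by (simp add: k_def)
    ultimately show ?thesis using s(1)[of n] by (simp add: abs_of_pos)
  qed
  have "(\<lambda>n. LINT z|lborel. k z * g (x' + s n *\<^sub>R z)) \<longlonglongrightarrow> (LINT z|lborel. k z * g x')"
  proof (rule integral_dominated_convergence[where w = "\<lambda>z. k z * M"])
    show "integrable lborel (\<lambda>z. k z * M)" using k by (auto simp: has_bochner_integral_iff)
    show "AE z in lborel. (\<lambda>n. k z * g (x' + s n *\<^sub>R z)) \<longlonglongrightarrow> k z * g x'"
    proof (intro AE_I2 tendsto_intros)
      fix z
      have "(\<lambda>n. x' + s n *\<^sub>R z) \<longlonglongrightarrow> x' + 0 *\<^sub>R z" by (intro tendsto_intros s)
      then show "(\<lambda>n. g (x' + s n *\<^sub>R z)) \<longlonglongrightarrow> g x'"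
        using continuous_on_tendsto_compose[OF g(1)] by simp
    qed
    show "AE z in lborel. norm (k z * g (x' + s n *\<^sub>R z)) \<le> k z * M" for n
      using k0 g(2) by (intro AE_I2) (simp add: abs_mult mult_left_mono)
  qed measurable
  then show ?thesis using k by (simp add: eq has_bochner_integral_iff)
qed

definition poisson_kernel_dy :: "R4 \<Rightarrow> real" where
  "poisson_kernel_dy = (\<lambda>(x, y). 4 / pi\<^sup>2 * (3 * y\<^sup>2 / (y\<^sup>2 + (norm x)\<^sup>2) ^ 3 - 6 * y ^ 4 / (y\<^sup>2 + (norm x)\<^sup>2) ^ 4))"

lemma poisson_kernel_has_real_derivative:
  assumes "y > 0"
  shows "((\<lambda>y. poisson_kernel (x, y)) has_real_derivative poisson_kernel_dy (x, y)) (at y)"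
proof -
  define q where "q = y\<^sup>2 + (norm x)\<^sup>2"
  have q: "q \<noteq> 0" using assms by (simp add: q_def add_pos_nonneg less_imp_neq[symmetric])
  have d1: "((\<lambda>y. y ^ 3) has_real_derivative 3 * y\<^sup>2) (at y)"
    by (auto intro!: derivative_eq_intros)
  have d2: "((\<lambda>y. (y\<^sup>2 + (norm x)\<^sup>2) ^ 3) has_real_derivative 3 * q\<^sup>2 * (2 * y)) (at y)"
    by (auto intro!: derivative_eq_intros simp: q_def)
  have "((\<lambda>y. poisson_kernel (x, y)) has_real_derivative
      4 / pi\<^sup>2 * ((3 * y\<^sup>2 * q ^ 3 - y ^ 3 * (3 * q\<^sup>2 * (2 * y))) / (q ^ 3 * q ^ 3))) (at y)"
    unfolding poisson_kernel_def split
    using DERIV_cmult[OF DERIV_divide[OF d1 d2], of "4 / pi\<^sup>2"] q by (simp add: q_def)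
  also have "(3 * y\<^sup>2 * q ^ 3 - y ^ 3 * (3 * q\<^sup>2 * (2 * y))) / (q ^ 3 * q ^ 3) = 3 * y\<^sup>2 / q ^ 3 - 6 * y ^ 4 / q ^ 4"
  proof -
    have "3 * y\<^sup>2 * q ^ 3 - y ^ 3 * (3 * q\<^sup>2 * (2 * y)) = q\<^sup>2 * (3 * y\<^sup>2 * q - 6 * y ^ 4)"
      by (simp add: algebra_simps power_numeral_reduce)
    moreover have "q ^ 3 * q ^ 3 = q\<^sup>2 * q ^ 4" by (simp add: power_add[symmetric])
    ultimately have "(3 * y\<^sup>2 * q ^ 3 - y ^ 3 * (3 * q\<^sup>2 * (2 * y))) / (q ^ 3 * q ^ 3) = (3 * y\<^sup>2 * q - 6 * y ^ 4) / q ^ 4"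
      using q by (simp only:) (rule mult_divide_mult_cancel_left, simp)
    also have "\<dots> = 3 * y\<^sup>2 / q ^ 3 - 6 * y ^ 4 / q ^ 4"
      using q by (simp add: diff_divide_distrib power_numeral_reduce)
    finally show ?thesis .
  qed
  finally show ?thesis by (simp add: poisson_kernel_dy_def q_def)
qed

text \<open>The limit exists because the profile of \<open>poisson_kernel_dy\<close> has mean zero and is even.\<close>

lemma integral_poisson_kernel_dy_tendsto:
  fixes g :: "real^3 \<Rightarrow> real"
  assumes g: "smooth g" "\<And>x. norm x > R \<Longrightarrow> g x = 0" and s: "\<And>n. s n > 0" "s \<longlonglongrightarrow> 0"
  shows "(\<lambda>n. LINT x|lborel. poisson_kernel_dy (x - x', s n) * g x) \<longlonglongrightarrow> 0"
proof -
  have [measurable]: "g \<in> borel_measurable borel" using g(1) by (rule smooth_imp_measurable)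
  define k where "k z = 4 / pi\<^sup>2 * (3 * inverse ((1 + (norm z)\<^sup>2) ^ 3) - 6 * inverse ((1 + (norm z)\<^sup>2) ^ 4))" for z :: "real^3"
  have [measurable]: "k \<in> borel_measurable borel" unfolding k_def by measurable
  have "has_bochner_integral lborel k (4 / pi\<^sup>2 * (3 * (pi\<^sup>2 / 4) - 6 * (pi\<^sup>2 / 8)))"
    unfolding k_def[abs_def]
    by (rule has_bochner_integral_mult_right, rule has_bochner_integral_diff)
       (rule has_bochner_integral_mult_right, rule integral_inverse_power_3)+
  then have k: "integrable lborel k" "(LINT z|lborel. k z) = 0" by (auto simp: has_bochner_integral_iff)
  have kb: "\<bar>k z\<bar> * norm z \<le> 9 * inverse ((1 + (norm z)\<^sup>2)\<^sup>2)" for z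
  proof -
    define q where "q = 1 + (norm z)\<^sup>2"
    have "0 \<le> (norm z - 1)\<^sup>2" by simp
    then have "2 * norm z \<le> 1 + (norm z)\<^sup>2" by (simp add: power2_diff)
    then have q: "q \<ge> 1" "norm z \<le> q"
      unfolding q_def using norm_ge_zero[of z] by (simp, linarith)
    have "2\<^sup>2 \<le> pi\<^sup>2" using pi_ge_two by (intro power_mono) auto
    then have p: "4 / pi\<^sup>2 \<le> 1" by simp
    have "inverse (q ^ 4) \<le> inverse (q ^ 3)" using q by (intro le_imp_inverse_le power_increasing) auto
    moreover have "0 \<le> inverse (q ^ 4)" using q by simp
    ultimately have "\<bar>3 * inverse (q ^ 3) - 6 * inverse (q ^ 4)\<bar> \<le> 9 * inverse (q ^ 3)"
      by linarith
    then have "\<bar>k z\<bar> \<le> 1 * (9 * inverse (q ^ 3))"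
      unfolding k_def q_def[symmetric] abs_mult by (intro mult_mono) (use p q in auto)
    then have "\<bar>k z\<bar> * norm z \<le> 9 * inverse (q ^ 3) * q" using q by (intro mult_mono) auto
    also have "\<dots> = 9 * inverse (q\<^sup>2)" using q by (simp add: power_numeral_reduce field_simps)
    finally show ?thesis by (simp add: q_def)
  qed
  obtain L where L: "\<And>z x. \<bar>pderiv_dir z g x\<bar> \<le> L * norm z" "L \<ge> 0"
  proof -
    have "\<exists>C. \<forall>x. \<bar>pderiv_dir b g x\<bar> \<le> C" for b
      using continuous_compact_support_bound[of "pderiv_dir b g" R 0, OF smooth_imp_continuous[OF smooth_pderiv[OF g(1)]]]
      pderiv_dir_outside[of R g _ b, OF g(2)] by auto
    then obtain c where c: "\<And>b x. \<bar>pderiv_dir b g x\<bar> \<le> c b" by metis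
    have "\<bar>pderiv_dir z g x\<bar> \<le> (\<Sum>b\<in>Basis. c b) * norm z" for z x
    proof -
      have "\<bar>pderiv_dir z g x\<bar> \<le> (\<Sum>b\<in>Basis. \<bar>(z \<bullet> b) * pderiv_dir b g x\<bar>)"
        unfolding pderiv_dir_sum_Basis[OF differentiable_on_UNIV_D[OF smooth_imp_differentiable[OF g(1)]], of z]
        by (rule sum_abs)
      also have "\<dots> \<le> (\<Sum>b\<in>Basis. norm z * c b)"
        unfolding abs_mult by (intro sum_mono mult_mono Basis_le_norm c) auto
      finally show ?thesis by (simp add: sum_distrib_left mult.commute)
    qed
    moreover have "(\<Sum>b\<in>(Basis :: (real^3) set). c b) \<ge> 0"
      by (intro sum_nonneg) (use c in \<open>auto intro: order_trans[OF abs_ge_zero]\<close>)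
    ultimately show ?thesis using that by blast
  qed
  have eq: "(LINT x|lborel. poisson_kernel_dy (x - x', s n) * g x) = (LINT z|lborel. k z * ((g (x' + s n *\<^sub>R z) - g x') / s n))" for n
  proof -
    have [measurable]: "(\<lambda>x. poisson_kernel_dy (x - x', s n) * g x) \<in> borel_measurable borel"
      unfolding poisson_kernel_dy_def split by measurable
    have "(LINT z|lborel. poisson_kernel_dy ((x' + s n *\<^sub>R z) - x', s n) * g (x' + s n *\<^sub>R z))
       = (LINT x|lborel. poisson_kernel_dy (x - x', s n) * g x) / \<bar>s n\<bar> ^ DIM(real^3)"
      by (rule lborel_integral_affine(1)) (use s in \<open>auto simp: less_imp_neq[symmetric]\<close>)
    moreover have "poisson_kernel_dy ((x' + s n *\<^sub>R z) - x', s n) = k z / s n ^ 4" for z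
    proof -
      have "(s n)\<^sup>2 + (norm (s n *\<^sub>R z))\<^sup>2 = (s n)\<^sup>2 * (1 + (norm z)\<^sup>2)"
        by (simp add: power_mult_distrib algebra_simps)
      moreover have "1 + (norm z)\<^sup>2 \<noteq> 0" by (smt (verit) zero_le_power2)
      ultimately show ?thesis using s(1)[of n]
        by (simp add: poisson_kernel_dy_def k_def power_mult_distrib divide_simps)
           (simp add: power_numeral_reduce algebra_simps)
    qed
    ultimately have "(LINT x|lborel. poisson_kernel_dy (x - x', s n) * g x) = s n ^ 3 * (LINT z|lborel. k z / s n ^ 4 * g (x' + s n *\<^sub>R z))"
      using s(1)[of n] by (simp add: abs_of_pos)
    also have "\<dots> = (LINT z|lborel. k z * (g (x' + s n *\<^sub>R z) / s n))"
      using s(1)[of n] by (subst integral_mult_right_zero[symmetric])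
        (auto intro!: Bochner_Integration.integral_cong simp: field_simps power_numeral_reduce)
    also have "\<dots> = (LINT z|lborel. k z * (g (x' + s n *\<^sub>R z) / s n)) - (LINT z|lborel. k z * (g x' / s n))"
      using k(2) by simp
    also have "\<dots> = (LINT z|lborel. k z * (g (x' + s n *\<^sub>R z) / s n) - k z * (g x' / s n))"
    proof (rule Bochner_Integration.integral_diff[symmetric])
      obtain C where C: "\<And>x. \<bar>g x\<bar> \<le> C"
        using continuous_compact_support_bound[of g R 0] g smooth_imp_continuous by auto
      show "integrable lborel (\<lambda>z. k z * (g (x' + s n *\<^sub>R z) / s n))"
        by (rule Bochner_Integration.integrable_bound[OF integrable_mult_left[OF k(1), of "C / s n"]])
           (use C s(1)[of n] in \<open>auto intro!: AE_I2 simp: abs_mult mult_left_mono divide_right_mono order_trans[OF _ abs_ge_self]\<close>)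
    qed (use k(1) in simp)
    finally show ?thesis by (simp add: right_diff_distrib diff_divide_distrib)
  qed
  have "(\<lambda>n. LINT z|lborel. k z * ((g (x' + s n *\<^sub>R z) - g x') / s n)) \<longlonglongrightarrow> (LINT z|lborel. k z * pderiv_dir z g x')"
  proof (rule integral_dominated_convergence[where w = "\<lambda>z. L * (9 * inverse ((1 + (norm z)\<^sup>2)\<^sup>2))"])
    show "integrable lborel (\<lambda>z::real^3. L * (9 * inverse ((1 + (norm z)\<^sup>2)\<^sup>2)))"
      using integral_inverse_power_3(3) by (intro integrable_mult_right)
    show "AE z in lborel. (\<lambda>n. k z * ((g (x' + s n *\<^sub>R z) - g x') / s n)) \<longlonglongrightarrow> k z * pderiv_dir z g x'"
    proof (intro AE_I2 tendsto_intros)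
      fix z
      have "((\<lambda>t. g (x' + t *\<^sub>R z)) has_real_derivative pderiv_dir z g (x' + 0 *\<^sub>R z)) (at 0)"
        by (rule smooth_has_real_derivative_line[OF g(1)])
      then show "(\<lambda>n. (g (x' + s n *\<^sub>R z) - g x') / s n) \<longlonglongrightarrow> pderiv_dir z g x'"
        using s unfolding DERIV_def tendsto_at_iff_sequentially
        by (auto simp: o_def less_imp_neq[symmetric])
    qed
    show "AE z in lborel. norm (k z * ((g (x' + s n *\<^sub>R z) - g x') / s n)) \<le> L * (9 * inverse ((1 + (norm z)\<^sup>2)\<^sup>2))" for n
    proof (rule AE_I2)
      fix z
      have "\<bar>(g (x' + s n *\<^sub>R z) - g x') / s n\<bar> \<le> L * norm z"
        using smooth_difference_bound[OF g(1) L(1), of x' "s n" z] s(1)[of n] by (simp add: divide_le_eq)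
      then have "\<bar>k z\<bar> * \<bar>(g (x' + s n *\<^sub>R z) - g x') / s n\<bar> \<le> \<bar>k z\<bar> * (L * norm z)"
        by (rule mult_left_mono) simp
      also have "\<dots> = L * (\<bar>k z\<bar> * norm z)" by simp
      also have "\<dots> \<le> L * (9 * inverse ((1 + (norm z)\<^sup>2)\<^sup>2))" using kb L(2) by (intro mult_left_mono)
      finally show "norm (k z * ((g (x' + s n *\<^sub>R z) - g x') / s n)) \<le> L * (9 * inverse ((1 + (norm z)\<^sup>2)\<^sup>2))"
        unfolding real_norm_def abs_mult .
    qed
    have "(\<lambda>z. pderiv_dir z g x') = (\<lambda>z. \<Sum>b\<in>Basis. (z \<bullet> b) * pderiv_dir b g x')"
      by (rule ext, rule pderiv_dir_sum_Basis, rule differentiable_on_UNIV_D[OF smooth_imp_differentiable[OF g(1)]])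
    then have [measurable]: "(\<lambda>z. pderiv_dir z g x') \<in> borel_measurable borel" by simp
    show "(\<lambda>z. k z * pderiv_dir z g x') \<in> borel_measurable lborel" by simp
  qed measurable
  moreover have "(LINT z|lborel. k z * pderiv_dir z g x') = 0"
  proof -
    have "(\<lambda>z. pderiv_dir z g x') = (\<lambda>z. \<Sum>b\<in>Basis. (z \<bullet> b) * pderiv_dir b g x')"
      by (rule ext, rule pderiv_dir_sum_Basis, rule differentiable_on_UNIV_D[OF smooth_imp_differentiable[OF g(1)]])
    then have [measurable]: "(\<lambda>z. pderiv_dir z g x') \<in> borel_measurable borel" by simp
    have m: "(\<lambda>z. k z * pderiv_dir z g x') \<in> borel_measurable borel" by measurable
    have "linear (\<lambda>z. pderiv_dir z g x')"
      using smooth_has_derivative[OF g(1)] has_derivative_bounded_linear bounded_linear.linear by blast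
    from linear_neg[OF this] have odd: "pderiv_dir (- z) g x' = - pderiv_dir z g x'" for z .
    have "k (- z) = k z" for z by (simp add: k_def)
    with lborel_integral_uminus[OF m] show ?thesis by (simp add: odd)
  qed
  ultimately show ?thesis by (simp add: eq)
qed

lemma poisson_kernel_smooth_extension:
  assumes s: "s > 0"
  obtains H where "smooth H" "\<And>x y. y > - s / 2 \<Longrightarrow> H (x, y) = poisson_kernel (x - x', y + s)"
    "\<And>X. X \<in> half_space \<Longrightarrow> laplacian (laplacian H) X = 0"
proof -
  define d where "d = s\<^sup>2 / 4"
  have d: "d > 0" using s by (simp add: d_def)
  define \<tau> where "\<tau> r = inverse ((d * pos_reg (r / d)) ^ 3)" for r
  have "smooth (\<lambda>r. pos_reg (r / d))"
    by (rule smooth_comp_real[OF smooth_pos_reg]) (use d in \<open>auto intro!: smooth_intros\<close>)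
  then have \<tau>: "smooth \<tau>"
    unfolding \<tau>_def using d pos_reg_pos by (intro smooth_intros) (auto simp: less_imp_neq[symmetric])
  have t0: "\<tau> r = 1 / r ^ 3" if "r > d" for r
  proof -
    have "pos_reg (r / d) = r / d" using that d by (intro pos_reg_eq) simp
    then have "d * pos_reg (r / d) = r" using d by simp
    then show ?thesis unfolding \<tau>_def by (simp only:) (simp add: inverse_eq_divide)
  qed
  define \<tau>1 where "\<tau>1 = pderiv_dir 1 \<tau>"
  define \<tau>2 where "\<tau>2 = pderiv_dir 1 \<tau>1"
  have t1: "\<tau>1 r = (- 3) / r ^ 4" if "r > d" for r
    using pderiv_dir_inverse_power_tail[of d \<tau> 1 3, OF t0 _ that] d by (simp add: \<tau>1_def)
  have t2: "\<tau>2 r = 12 / r ^ 5" if "r > d" for r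
    using pderiv_dir_inverse_power_tail[of d \<tau>1 "-3" 4, OF t1 _ that] d by (simp add: \<tau>2_def)
  define \<sigma> where "\<sigma> r = 4 * r * \<tau>2 r + 20 * \<tau>1 r" for r
  have s0: "\<sigma> r = (- 12) / r ^ 4" if "r > d" for r
    using that d by (simp add: \<sigma>_def t1 t2 field_simps power_numeral_reduce)
  have \<sigma>: "smooth \<sigma>" unfolding \<sigma>_def \<tau>1_def \<tau>2_def by (intro smooth_intros \<tau>)
  define \<sigma>1 where "\<sigma>1 = pderiv_dir 1 \<sigma>"
  define \<sigma>2 where "\<sigma>2 = pderiv_dir 1 \<sigma>1"
  have s1: "\<sigma>1 r = 48 / r ^ 5" if "r > d" for r
    using pderiv_dir_inverse_power_tail[of d \<sigma> "-12" 4, OF s0 _ that] d by (simp add: \<sigma>1_def)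
  have s2: "\<sigma>2 r = (- 240) / r ^ 6" if "r > d" for r
    using pderiv_dir_inverse_power_tail[of d \<sigma>1 48 5, OF s1 _ that] d by (simp add: \<sigma>2_def)
  define H0 where "H0 X = 4 / pi\<^sup>2 * ((X \<bullet> e\<^sub>y) ^ 3 * \<tau> ((norm X)\<^sup>2))" for X :: R4
  have H0: "smooth H0" unfolding H0_def by (intro smooth_intros \<tau>)
  have L1: "laplacian (\<lambda>X::R4. (X \<bullet> e\<^sub>y) ^ 3 * \<tau> ((norm X)\<^sup>2))
     = (\<lambda>X. 6 * ((X \<bullet> e\<^sub>y) ^ 1 * \<tau> ((norm X)\<^sup>2)) + (X \<bullet> e\<^sub>y) ^ 3 * \<sigma> ((norm X)\<^sup>2))"
    by (subst laplacian_power_radial[OF e\<^sub>y_Basis \<tau>]) (simp add: \<sigma>_def \<tau>1_def \<tau>2_def algebra_simps)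
  have L2: "laplacian (laplacian H0) X = 0" if "(norm X)\<^sup>2 > d" for X :: R4
  proof -
    define r where "r = (norm X)\<^sup>2"
    have r: "r > d" "r > 0" using that d by (auto simp: r_def)
    have sm: "smooth (\<lambda>X::R4. (X \<bullet> e\<^sub>y) ^ n * \<rho> ((norm X)\<^sup>2))" if "smooth \<rho>" for n \<rho>
      by (intro smooth_intros that)
    have "laplacian (laplacian H0) X = 4 / pi\<^sup>2 * (6 * laplacian (\<lambda>X::R4. (X \<bullet> e\<^sub>y) ^ 1 * \<tau> ((norm X)\<^sup>2)) X
        + laplacian (\<lambda>X::R4. (X \<bullet> e\<^sub>y) ^ 3 * \<sigma> ((norm X)\<^sup>2)) X)"
      unfolding H0_def laplacian_cmult[OF sm[OF \<tau>]] L1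
      by (subst laplacian_cmult, intro smooth_add smooth_mult[OF smooth_const] sm \<tau> \<sigma>,
          subst laplacian_add, intro smooth_mult[OF smooth_const] sm \<tau> \<sigma>, intro sm \<tau> \<sigma>,
          subst laplacian_cmult, intro sm \<tau> \<sigma>) simp
    also have "\<dots> = 4 / pi\<^sup>2 * (6 * ((X \<bullet> e\<^sub>y) * (4 * r * \<tau>2 r + 12 * \<tau>1 r))
        + (6 * (X \<bullet> e\<^sub>y) * \<sigma> r + (X \<bullet> e\<^sub>y) ^ 3 * (4 * r * \<sigma>2 r + 20 * \<sigma>1 r)))"
      unfolding laplacian_power_radial[OF e\<^sub>y_Basis \<tau>] laplacian_power_radial[OF e\<^sub>y_Basis \<sigma>]
      by (simp add: \<tau>1_def \<tau>2_def \<sigma>1_def \<sigma>2_def r_def algebra_simps)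
    also have "\<dots> = 0"
      using r by (simp add: t1 t2 s0 s1 s2 field_simps power_numeral_reduce)
    finally show ?thesis .
  qed
  define H where "H X = H0 ((- x', s) + X)" for X
  have H: "smooth H" unfolding H_def by (rule smooth_affine[OF H0]) (rule bounded_linear_ident)
  have tr: "laplacian (\<lambda>X. f ((- x', s) + X)) = (\<lambda>X. laplacian f ((- x', s) + X))" if "smooth f" for f
    using laplacian_affine_scale[of "\<lambda>X. X" "\<lambda>_. 1" 1 f "(- x', s)"] that bounded_linear_ident by simp
  have nm: "(norm ((- x', s) + (x, y)))\<^sup>2 = (y + s)\<^sup>2 + (norm (x - x'))\<^sup>2" for x y
    by (simp add: norm_Pair add.commute)
  have gt: "(norm ((- x', s) + (x, y)))\<^sup>2 > d" if "y > - s / 2" for x y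
  proof -
    have "(s / 2)\<^sup>2 < (y + s)\<^sup>2" using that s by (intro power_strict_mono) auto
    moreover have "(s / 2)\<^sup>2 = d" by (simp add: d_def power_divide)
    ultimately show ?thesis unfolding nm using zero_le_power2[of "norm (x - x')"] by linarith
  qed
  show ?thesis
  proof (rule that[OF H])
    show "H (x, y) = poisson_kernel (x - x', y + s)" if "y > - s / 2" for x y
      using gt[OF that, of x] unfolding H_def H0_def
      by (simp only: t0 nm) (simp add: poisson_kernel_def add.commute)
    show "laplacian (laplacian H) X = 0" if "X \<in> half_space" for X
    proof -
      have "laplacian (laplacian H) X = laplacian (laplacian H0) ((- x', s) + X)"
        unfolding H_def by (simp only: tr[OF H0] tr[OF smooth_laplacian[OF H0]])
      also have "\<dots> = 0"
        by (rule L2) (use gt[of "snd X" "fst X"] that s in \<open>auto simp: half_space_def\<close>)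
      finally show ?thesis .
    qed
  qed
qed

lemma Cc_infinity_support:
  assumes "f \<in> Cc_infinity S"
  obtains R where "R \<ge> 1" "\<And>X. norm X > R \<Longrightarrow> f X = 0"
proof -
  have "bounded (closure {X. f X \<noteq> 0})" using assms by (auto simp: Cc_infinity_def compact_imp_bounded)
  then obtain B where "\<forall>X\<in>closure {X. f X \<noteq> 0}. norm X \<le> B"
    unfolding bounded_iff by blast
  moreover have "X \<in> closure {X. f X \<noteq> 0}" if "f X \<noteq> 0" for X
    using that closure_subset[of "{X. f X \<noteq> 0}"] by auto
  ultimately have B: "norm X \<le> B" if "f X \<noteq> 0" for X
    using that by blast
  show ?thesis
  proof (rule that[of "max B 1"])
    show "f X = 0" if "norm X > max B 1" for X
      using that B[of X] by (cases "f X = 0") auto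
  qed simp
qed

lemma smooth_restrict_boundary [smooth_intros]: "smooth f \<Longrightarrow> smooth (\<lambda>x. f (x, 0))"
  by (rule smooth_linear) (auto intro!: bounded_linear_intros bounded_linear_Pair)

lemma poisson_kernel_green_shifted:
  assumes \<phi>: "\<phi> \<in> boundary_test_functions" and s: "s > 0"
  shows "(LINT X|lborel. indicator half_space X * (poisson_kernel (fst X - x', snd X + s) * laplacian (laplacian \<phi>) X))
     = (LINT x|lborel. poisson_kernel_dy (x - x', s) * laplacian \<phi> (x, 0))
       - (LINT x|lborel. poisson_kernel (x - x', s) * pderiv_dir e\<^sub>y (laplacian \<phi>) (x, 0))"
proof -
  have sm: "smooth \<phi>" and bc: "\<And>x. \<phi> (x, 0) = 0" "\<And>x. pderiv_dir e\<^sub>y \<phi> (x, 0) = 0"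
    and cc: "\<phi> \<in> Cc_infinity UNIV"
    using \<phi> by (auto simp: boundary_test_functions_def Cc_infinity_def)
  obtain R where R: "R \<ge> 1" "\<And>X. norm X > R \<Longrightarrow> \<phi> X = 0" using Cc_infinity_support[OF cc] by blast
  obtain H where H: "smooth H" "\<And>x y. y > - s / 2 \<Longrightarrow> H (x, y) = poisson_kernel (x - x', y + s)"
    "\<And>X. X \<in> half_space \<Longrightarrow> laplacian (laplacian H) X = 0"
    using poisson_kernel_smooth_extension[OF s, of x'] by blast
  have Hy: "pderiv_dir e\<^sub>y H (x, 0) = poisson_kernel_dy (x - x', s)" for x
  proof -
    have "((\<lambda>y. poisson_kernel (x - x', y)) has_real_derivative poisson_kernel_dy (x - x', s)) (at (0 + s))"
      using poisson_kernel_has_real_derivative[OF s] by simp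
    then have "((\<lambda>y. poisson_kernel (x - x', y + s)) has_real_derivative poisson_kernel_dy (x - x', s)) (at 0)"
      by (simp only: DERIV_shift)
    then have "((\<lambda>y. H (x, y)) has_real_derivative poisson_kernel_dy (x - x', s)) (at 0)"
      by (rule has_field_derivative_transform_within_open[of _ _ _ "{- s / 2<..}"]) (use s H(2) in auto)
    moreover have "((\<lambda>y. H (x, y)) has_real_derivative pderiv_dir e\<^sub>y H (x, 0)) (at 0)"
      using smooth_has_real_derivative_line[OF H(1), of "(x, 0)" e\<^sub>y 0 UNIV] by simp
    ultimately show ?thesis using DERIV_unique by blast
  qed
  have H0: "H (x, 0) = poisson_kernel (x - x', s)" for x using H(2)[of 0] s by simp
  have out: "laplacian \<phi> X = 0" "pderiv_dir b (laplacian \<phi>) X = 0" if "norm X > R" for X b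
    using that R(2) by (auto intro!: laplacian_outside[of R] pderiv_dir_outside[of R])
  have "(LINT X|lborel. indicator half_space X * (poisson_kernel (fst X - x', snd X + s) * laplacian (laplacian \<phi>) X))
      = (LINT X|lborel. indicator half_space X * (H X * laplacian (laplacian \<phi>) X))"
    using H(2) s by (intro Bochner_Integration.integral_cong refl) (auto simp: indicator_def half_space_def)
  also have "\<dots> = (LINT X|lborel. indicator half_space X * (\<phi> X * laplacian (laplacian H) X))
       - (LINT x|lborel. H (x, 0) * pderiv_dir e\<^sub>y (laplacian \<phi>) (x, 0) - pderiv_dir e\<^sub>y H (x, 0) * laplacian \<phi> (x, 0))"
    by (rule green_half_space[OF H(1) sm R(2) bc])
  also have "(LINT X|lborel. indicator half_space X * (\<phi> X * laplacian (laplacian H) X)) = (LINT X|(lborel :: R4 measure). 0)"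
    using H(3) by (intro Bochner_Integration.integral_cong refl) (auto simp: indicator_def)
  also have "(LINT x|lborel. H (x, 0) * pderiv_dir e\<^sub>y (laplacian \<phi>) (x, 0) - pderiv_dir e\<^sub>y H (x, 0) * laplacian \<phi> (x, 0))
      = (LINT x|lborel. H (x, 0) * pderiv_dir e\<^sub>y (laplacian \<phi>) (x, 0)) - (LINT x|lborel. pderiv_dir e\<^sub>y H (x, 0) * laplacian \<phi> (x, 0))"
    by (rule Bochner_Integration.integral_diff; rule integrable_lborel_compact_support(2)[of _ R])
       (auto intro!: smooth_intros H sm simp: out norm_Pair)
  finally show ?thesis by (simp add: Hy H0)
qed

lemma poisson_kernel_green:
  assumes \<phi>: "\<phi> \<in> boundary_test_functions"
  shows "(LINT X|lborel. (indicator half_space X * laplacian (laplacian \<phi>) X) * poisson_kernel (fst X - x', snd X))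
     = - pderiv_dir e\<^sub>y (laplacian \<phi>) (x', 0)"
proof -
  have sm: "smooth \<phi>" and cc: "\<phi> \<in> Cc_infinity UNIV"
    using \<phi> by (auto simp: boundary_test_functions_def Cc_infinity_def)
  obtain R where R: "R \<ge> 1" "\<And>X. norm X > R \<Longrightarrow> \<phi> X = 0" using Cc_infinity_support[OF cc] by blast
  define g where "g = laplacian (laplacian \<phi>)"
  have g: "smooth g" unfolding g_def by (intro smooth_intros sm)
  have [measurable]: "g \<in> borel_measurable borel" by (rule smooth_imp_measurable[OF g])
  have out: "laplacian \<phi> X = 0" "pderiv_dir b (laplacian \<phi>) X = 0" "g X = 0" if "norm X > R" for X b
    using that R(2) unfolding g_def by (auto intro!: laplacian_outside[of R] pderiv_dir_outside[of R])
  obtain M where M: "\<And>X. \<bar>g X\<bar> \<le> M"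
    using continuous_compact_support_bound[of g R 0] out(3) smooth_imp_continuous[OF g] by auto
  have M0: "M \<ge> 0" using M[of 0] by simp
  define s where "s n = inverse (real (Suc n))" for n
  have s: "s n > 0" "s n \<le> 1" for n by (auto simp: s_def inverse_le_1_iff)
  have s0: "s \<longlonglongrightarrow> 0" unfolding s_def by (rule LIMSEQ_inverse_real_of_nat)
  define h where "h n X = indicator half_space (X + (0, - s n)) * (poisson_kernel (fst X - x', snd X) * g (X + (0, - s n)))" for n X
  have [measurable]: "(\<lambda>X::R4. X + (0, - s n)) \<in> borel \<rightarrow>\<^sub>M borel" for n
    by (intro borel_measurable_continuous_onI continuous_on_add continuous_on_id continuous_on_const)
  have hm: "h n \<in> borel_measurable borel" for n unfolding h_def by measurable
  have h: "(LINT X|lborel. h n X) = (LINT x|lborel. poisson_kernel_dy (x - x', s n) * laplacian \<phi> (x, 0))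
       - (LINT x|lborel. poisson_kernel (x - x', s n) * pderiv_dir e\<^sub>y (laplacian \<phi>) (x, 0))" for n
  proof -
    have "(LINT X|lborel. h n X) = (LINT X|lborel. h n (X + (0, s n)))"
      by (rule lborel_integral_translate(1)[OF hm, symmetric])
    also have "\<dots> = (LINT X|lborel. indicator half_space X * (poisson_kernel (fst X - x', snd X + s n) * laplacian (laplacian \<phi>) X))"
      by (simp add: h_def g_def add.assoc zero_prod_def[symmetric])
    finally show ?thesis unfolding poisson_kernel_green_shifted[OF \<phi> s(1)] .
  qed
  have "(\<lambda>n. LINT X|lborel. h n X) \<longlonglongrightarrow> (LINT X|lborel. (indicator half_space X * g X) * poisson_kernel (fst X - x', snd X))"
  proof (rule integral_dominated_convergence[where w = "\<lambda>X. (M * indicator (half_space \<inter> cball 0 (R + 1)) X) * poisson_kernel (fst X - x', snd X)"])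
    show "integrable lborel (\<lambda>X. (M * indicator (half_space \<inter> cball 0 (R + 1)) X) * poisson_kernel (fst X - x', snd X))"
      by (rule poisson_kernel_test_integrable[where M = M and R = "R + 1"])
         (use M0 R(1) in \<open>auto simp: indicator_def\<close>)
    show "AE X in lborel. (\<lambda>n. h n X) \<longlonglongrightarrow> (indicator half_space X * g X) * poisson_kernel (fst X - x', snd X)"
    proof (rule AE_I2)
      fix X :: R4
      have "(\<lambda>n. X + (0, - s n)) \<longlonglongrightarrow> X + (0, - 0)" by (intro tendsto_intros s0)
      then have gl: "(\<lambda>n. g (X + (0, - s n))) \<longlonglongrightarrow> g X"
        using continuous_on_tendsto_compose[OF smooth_imp_continuous[OF g]] by (simp add: zero_prod_def[symmetric])
      show "(\<lambda>n. h n X) \<longlonglongrightarrow> (indicator half_space X * g X) * poisson_kernel (fst X - x', snd X)"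
      proof (cases "snd X > 0")
        case True
        have "\<forall>\<^sub>F n in sequentially. s n < snd X" using order_tendstoD(2)[OF s0 True] .
        then have "\<forall>\<^sub>F n in sequentially. h n X = poisson_kernel (fst X - x', snd X) * g (X + (0, - s n))"
          by eventually_elim (simp add: h_def half_space_def)
        moreover have "(\<lambda>n. poisson_kernel (fst X - x', snd X) * g (X + (0, - s n))) \<longlonglongrightarrow> poisson_kernel (fst X - x', snd X) * g X"
          by (intro tendsto_intros gl)
        ultimately show ?thesis
          using True by (subst tendsto_cong) (auto simp: half_space_def mult.commute)
      next
        case False
        then have "h n X = 0" for n using s(1)[of n] by (simp add: h_def half_space_def)
        then show ?thesis using False by (simp add: half_space_def)
      qed
    qed
    fix n
    show "AE X in lborel. norm (h n X) \<le> (M * indicator (half_space \<inter> cball 0 (R + 1)) X) * poisson_kernel (fst X - x', snd X)"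
    proof (rule AE_I2)
      fix X :: R4
      show "norm (h n X) \<le> (M * indicator (half_space \<inter> cball 0 (R + 1)) X) * poisson_kernel (fst X - x', snd X)"
      proof (cases "snd X > s n \<and> norm (X + (0, - s n)) \<le> R")
        case True
        have "norm X \<le> norm (X + (0, - s n)) + norm ((0, s n) :: R4)"
          using norm_triangle_ineq[of "X + (0, - s n)" "(0, s n)"] by (simp add: add.assoc zero_prod_def[symmetric])
        also have "norm ((0, s n) :: R4) = s n" using s(1)[of n] by (simp add: norm_Pair)
        finally have X: "norm X \<le> R + 1" "snd X > 0" using True s[of n] by auto
        then have K: "poisson_kernel (fst X - x', snd X) \<ge> 0" by (intro poisson_kernel_nonneg) simp
        have "norm (h n X) \<le> poisson_kernel (fst X - x', snd X) * M"
          using K True M by (simp add: h_def half_space_def abs_mult mult_left_mono)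
        then show ?thesis using X by (simp add: half_space_def mult.commute)
      next
        case False
        then have "h n X = 0" using out(3)[of "X + (0, - s n)"] by (auto simp: h_def half_space_def indicator_def)
        then show ?thesis
          using M0 by (auto simp: indicator_def half_space_def intro!: mult_nonneg_nonneg poisson_kernel_nonneg)
      qed
    qed
  qed (use hm in measurable)
  moreover have "(\<lambda>n. LINT X|lborel. h n X) \<longlonglongrightarrow> 0 - pderiv_dir e\<^sub>y (laplacian \<phi>) (x', 0)"
    unfolding h
  proof (rule tendsto_diff)
    show "(\<lambda>n. LINT x|lborel. poisson_kernel_dy (x - x', s n) * laplacian \<phi> (x, 0)) \<longlonglongrightarrow> 0"
      by (rule integral_poisson_kernel_dy_tendsto[of _ R, OF _ _ s(1) s0])
         (auto intro!: smooth_intros sm simp: out norm_Pair)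
    have sp: "smooth (\<lambda>x. pderiv_dir e\<^sub>y (laplacian \<phi>) (x, 0))" by (intro smooth_intros sm)
    obtain C where "\<And>x. \<bar>pderiv_dir e\<^sub>y (laplacian \<phi>) (x, 0)\<bar> \<le> C"
      using continuous_compact_support_bound[OF smooth_imp_continuous[OF sp], of R 0]
      by (auto simp: out norm_Pair)
    then show "(\<lambda>n. LINT x|lborel. poisson_kernel (x - x', s n) * pderiv_dir e\<^sub>y (laplacian \<phi>) (x, 0))
        \<longlonglongrightarrow> pderiv_dir e\<^sub>y (laplacian \<phi>) (x', 0)"
      by (rule integral_poisson_kernel_tendsto[OF smooth_imp_continuous[OF sp] _ s(1) s0])
  qed
  ultimately show ?thesis using LIMSEQ_unique unfolding g_def by fastforce
qed

lemma poisson_kernel_integrable: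
  assumes u: "u \<in> L\<^sub>6" and y: "y > 0"
  shows "integrable lebesgue (\<lambda>x'. poisson_kernel (x - x', y) * u x')"
proof -
  have um: "u \<in> borel_measurable lebesgue" using L6_borel_version[OF u] by blast
  have ui: "integrable lebesgue (\<lambda>x. \<bar>u x\<bar> / (1 + norm x ^ 6))" using u by (simp add: L\<^sub>6_def)
  define R where "R = max 1 (max (norm x) y)"
  define C where "C = (1 + (2 * R) ^ 6) * (4 / pi\<^sup>2 * (y ^ 3 / (y\<^sup>2) ^ 3)) + 128 * R ^ 3"
  have bd: "poisson_kernel (x - x', y) * (1 + norm x' ^ 6) \<le> C" for x'
  proof -
    have "poisson_kernel (x - x', y) \<le> 4 / pi\<^sup>2 * (y ^ 3 / (y\<^sup>2) ^ 3)"
      unfolding poisson_kernel_def split using y by (intro mult_left_mono frac_le power_mono) auto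
    then have "(1 + (2 * R) ^ 6) * poisson_kernel (x - x', y) \<le> (1 + (2 * R) ^ 6) * (4 / pi\<^sup>2 * (y ^ 3 / (y\<^sup>2) ^ 3))"
      by (intro mult_left_mono) (auto simp: R_def)
    moreover have "poisson_kernel (x - x', y) * (1 + norm x' ^ 6) \<le> (1 + (2 * R) ^ 6) * poisson_kernel (x - x', y) + 128 * R ^ 3"
      by (rule poisson_kernel_bound) (use y in \<open>auto simp: R_def\<close>)
    ultimately show ?thesis by (simp add: C_def)
  qed
  show ?thesis
  proof (rule Bochner_Integration.integrable_bound[OF integrable_mult_right[OF ui, of C]])
    have "(\<lambda>x'. poisson_kernel (x - x', y)) \<in> borel_measurable lebesgue"
      by (rule measurable_completion) simp
    then show "(\<lambda>x'. poisson_kernel (x - x', y) * u x') \<in> borel_measurable lebesgue"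
      using um by (rule borel_measurable_times)
    show "AE x' in lebesgue. norm (poisson_kernel (x - x', y) * u x') \<le> norm (C * (\<bar>u x'\<bar> / (1 + norm x' ^ 6)))"
    proof (rule AE_I2)
      fix x' :: "real^3"
      have p: "1 + norm x' ^ 6 > 0" by (simp add: add_pos_nonneg)
      have "poisson_kernel (x - x', y) \<le> C / (1 + norm x' ^ 6)"
        using bd[of x'] p by (simp add: pos_le_divide_eq)
      then have "poisson_kernel (x - x', y) * \<bar>u x'\<bar> \<le> C / (1 + norm x' ^ 6) * \<bar>u x'\<bar>"
        by (rule mult_right_mono) simp
      then have "norm (poisson_kernel (x - x', y) * u x') \<le> C * (\<bar>u x'\<bar> / (1 + norm x' ^ 6))"
        using y by (simp add: abs_mult poisson_kernel_nonneg abs_of_nonneg)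
      then show "norm (poisson_kernel (x - x', y) * u x') \<le> norm (C * (\<bar>u x'\<bar> / (1 + norm x' ^ 6)))"
        by (rule order_trans) (simp only: real_norm_def abs_ge_self)
    qed
  qed
qed

lemma poisson_extension_L1_loc_weak_solution:
  assumes u: "u \<in> L\<^sub>6"
  shows "poisson_extension u \<in> L1_loc closed_half_space" "weak_solution u (poisson_extension u)"
proof -
  obtain v where v: "v \<in> borel_measurable borel" "AE x in lebesgue. u x = v x" "u \<in> borel_measurable lebesgue"
    "integrable lborel (\<lambda>x. \<bar>v x\<bar> / (1 + norm x ^ 6))"
    by (rule L6_borel_version[OF u])
  have [measurable]: "v \<in> borel_measurable borel" by (rule v(1))
  have vl: "g \<in> borel_measurable lebesgue" if "g \<in> borel_measurable borel" for g :: "real^3 \<Rightarrow> real"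
    using that by (intro measurable_completion) simp
  have ext: "poisson_extension u X = (LINT x'|lborel. poisson_kernel (fst X - x', snd X) * v x')" for X
  proof -
    have m: "(\<lambda>x'. poisson_kernel (fst X - x', snd X) * v x') \<in> borel_measurable borel" by measurable
    have "poisson_extension u X = (LINT x'|lebesgue. poisson_kernel (fst X - x', snd X) * u x')"
      by (simp add: poisson_extension_def case_prod_beta)
    also have "\<dots> = (LINT x'|lebesgue. poisson_kernel (fst X - x', snd X) * v x')"
    proof (rule integral_cong_AE)
      show "(\<lambda>x'. poisson_kernel (fst X - x', snd X) * u x') \<in> borel_measurable lebesgue"
        by (rule borel_measurable_times[OF vl v(3)]) simp
      show "(\<lambda>x'. poisson_kernel (fst X - x', snd X) * v x') \<in> borel_measurable lebesgue" by (rule vl[OF m])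
      show "AE x' in lebesgue. poisson_kernel (fst X - x', snd X) * u x' = poisson_kernel (fst X - x', snd X) * v x'"
        using v(2) by eventually_elim simp
    qed
    also have "\<dots> = (LINT x'|lborel. poisson_kernel (fst X - x', snd X) * v x')"
      using m by (intro integral_completion) simp
    finally show ?thesis .
  qed
  show "poisson_extension u \<in> L1_loc closed_half_space"
    unfolding L1_loc_def
  proof (intro CollectI allI impI)
    fix K :: "R4 set" assume K: "compact K \<and> K \<subseteq> closed_half_space"
    then obtain R where R: "\<And>X. X \<in> K \<Longrightarrow> norm X \<le> R"
      by (meson bounded_iff compact_imp_bounded)
    have [measurable]: "K \<in> sets borel" using K by (intro borel_closed compact_imp_closed) auto
    have "integrable lborel (\<lambda>X. indicator (K \<inter> half_space) X * poisson_extension u X)"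
      unfolding ext by (rule poisson_fubini(1)[OF v(1,4), where M = 1 and R = "max R 1"])
        (use R in \<open>force simp: indicator_def\<close>)+
    also have "(\<lambda>X. indicator (K \<inter> half_space) X * poisson_extension u X) = (\<lambda>X. indicator K X *\<^sub>R poisson_extension u X)"
    proof
      fix X :: R4
      have "poisson_extension u X = 0" if "X \<in> K" "X \<notin> half_space"
      proof -
        have "snd X = 0" using that K by (auto simp: half_space_def closed_half_space_def)
        then show ?thesis by (simp add: ext poisson_kernel_0)
      qed
      then show "indicator (K \<inter> half_space) X * poisson_extension u X = indicator K X *\<^sub>R poisson_extension u X"
        by (auto simp: indicator_def)
    qed
    finally have i: "integrable lborel (\<lambda>X. indicator K X *\<^sub>R poisson_extension u X)" .
    show "poisson_extension u absolutely_integrable_on K"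
      unfolding set_integrable_def using i by (subst integrable_completion) auto
  qed
  show "weak_solution u (poisson_extension u)"
    unfolding weak_solution_def
  proof
    fix \<phi> assume \<phi>: "\<phi> \<in> boundary_test_functions"
    then have sm: "smooth \<phi>" and cc: "\<phi> \<in> Cc_infinity UNIV"
      by (auto simp: boundary_test_functions_def Cc_infinity_def)
    obtain R where R: "R \<ge> 1" "\<And>X. norm X > R \<Longrightarrow> \<phi> X = 0" using Cc_infinity_support[OF cc] by blast
    define f where "f X = indicator half_space X * laplacian (laplacian \<phi>) X" for X
    have sl: "smooth (laplacian (laplacian \<phi>))" by (intro smooth_intros sm)
    have lm: "laplacian (laplacian \<phi>) \<in> borel_measurable borel" by (rule smooth_imp_measurable[OF sl])
    then have [measurable]: "f \<in> borel_measurable borel" unfolding f_def by measurable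
    have out: "laplacian (laplacian \<phi>) X = 0" if "norm X > R" for X
      using that R(2) by (auto intro!: laplacian_outside[of R])
    obtain M where M: "\<And>X. \<bar>laplacian (laplacian \<phi>) X\<bar> \<le> M"
      using continuous_compact_support_bound[of "laplacian (laplacian \<phi>)" R 0] out smooth_imp_continuous[OF sl] by auto
    have M0: "M \<ge> 0" using M[of 0] by simp
    have fM: "\<bar>f X\<bar> \<le> M" for X using M[of X] M0 by (simp add: f_def indicator_def)
    have f0: "f X = 0" if "X \<notin> half_space \<inter> cball 0 R" for X
      using that out[of X] by (auto simp: f_def)
    have fub: "integrable lborel (\<lambda>X. f X * (LINT x'|lborel. poisson_kernel (fst X - x', snd X) * v x'))"
      "(LINT X|lborel. f X * (LINT x'|lborel. poisson_kernel (fst X - x', snd X) * v x'))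
       = (LINT x'|lborel. v x' * (LINT X|lborel. f X * poisson_kernel (fst X - x', snd X)))"
      using poisson_fubini[OF v(1,4) \<open>f \<in> borel_measurable borel\<close> fM f0 R(1)] by simp_all
    have pm: "(\<lambda>x. pderiv_dir e\<^sub>y (laplacian \<phi>) (x, 0)) \<in> borel_measurable borel"
      by (intro smooth_imp_measurable smooth_intros sm)
    have "(LINT X:half_space|lebesgue. poisson_extension u X * laplacian (laplacian \<phi>) X)
        = (LINT X|lebesgue. f X * (LINT x'|lborel. poisson_kernel (fst X - x', snd X) * v x'))"
      unfolding set_lebesgue_integral_def ext by (simp add: f_def mult_ac)
    also have "\<dots> = (LINT X|lborel. f X * (LINT x'|lborel. poisson_kernel (fst X - x', snd X) * v x'))"
      by (rule integral_completion) (use fub(1) in \<open>rule borel_measurable_integrable\<close>)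
    also have "\<dots> = (LINT x'|lborel. v x' * (- pderiv_dir e\<^sub>y (laplacian \<phi>) (x', 0)))"
      unfolding fub(2) by (simp only: f_def poisson_kernel_green[OF \<phi>])
    also have "\<dots> = - (LINT x'|lborel. v x' * pderiv_dir e\<^sub>y (laplacian \<phi>) (x', 0))"
      by simp
    also have "(LINT x'|lborel. v x' * pderiv_dir e\<^sub>y (laplacian \<phi>) (x', 0)) = (LINT x'|lebesgue. v x' * pderiv_dir e\<^sub>y (laplacian \<phi>) (x', 0))"
      by (rule integral_completion[symmetric]) (use pm in simp)
    also have "\<dots> = (LINT x'|lebesgue. u x' * pderiv_dir e\<^sub>y (laplacian \<phi>) (x', 0))"
    proof (rule integral_cong_AE)
      show "(\<lambda>x'. v x' * pderiv_dir e\<^sub>y (laplacian \<phi>) (x', 0)) \<in> borel_measurable lebesgue"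
        by (intro borel_measurable_times vl v pm)
      show "(\<lambda>x'. u x' * pderiv_dir e\<^sub>y (laplacian \<phi>) (x', 0)) \<in> borel_measurable lebesgue"
        by (intro borel_measurable_times v(3) vl[OF pm])
      show "AE x' in lebesgue. v x' * pderiv_dir e\<^sub>y (laplacian \<phi>) (x', 0) = u x' * pderiv_dir e\<^sub>y (laplacian \<phi>) (x', 0)"
        using v(2) by eventually_elim simp
    qed
    finally show "(LINT X:half_space|lebesgue. poisson_extension u X * laplacian (laplacian \<phi>) X)
        = - (LINT x|lebesgue. u x * pderiv_dir e\<^sub>y (laplacian \<phi>) (x, 0))" .
  qed
qed

section \<open>Reflection\<close>

definition reflect :: "R4 \<Rightarrow> R4" where
  "reflect X = (fst X, - snd X)"

lemma bounded_linear_reflect: "bounded_linear reflect"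
  unfolding reflect_def
  by (intro bounded_linear_Pair bounded_linear_fst bounded_linear_minus bounded_linear_snd)

lemma norm_reflect [simp]: "norm (reflect X) = norm X"
  by (simp add: reflect_def norm_prod_def)

lemma smooth_reflect [smooth_intros]: "smooth f \<Longrightarrow> smooth (\<lambda>X. f (reflect X))"
  by (rule smooth_linear[OF _ bounded_linear_reflect])

lemma decays_reflect: "decays p f \<Longrightarrow> decays p (\<lambda>X. f (reflect X))"
  using decays_affine[OF bounded_linear_reflect, of 1 0 p f] by simp

lemma laplacian_reflect:
  assumes "smooth f"
  shows "laplacian (\<lambda>X. f (reflect X)) = (\<lambda>X. laplacian f (reflect X))"
proof -
  have "laplacian (\<lambda>X. f (0 + reflect X)) = (\<lambda>X. 1 * laplacian f (0 + reflect X))"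
    by (rule laplacian_affine_scale[OF bounded_linear_reflect, of "\<lambda>b. if b = e\<^sub>y then - 1 else 1"])
       (auto simp: reflect_def Basis_R4 assms)
  then show ?thesis by simp
qed

lemma pderiv_dir_reflect:
  assumes "smooth f"
  shows "pderiv_dir e\<^sub>y (\<lambda>X. f (reflect X)) = (\<lambda>X. - pderiv_dir e\<^sub>y f (reflect X))"
proof -
  have lin: "linear (\<lambda>v. pderiv_dir v f Y)" for Y
    using smooth_has_derivative[OF assms] has_derivative_bounded_linear bounded_linear.linear by blast
  have "pderiv_dir (reflect e\<^sub>y) f Z = - pderiv_dir e\<^sub>y f Z" for Z
    using linear_neg[OF lin[of Z], of e\<^sub>y] by (simp add: reflect_def)
  then show ?thesis
    using pderiv_dir_affine[OF bounded_linear_reflect smooth_imp_differentiable[OF assms], of e\<^sub>y 0]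
    by simp
qed

lemma pderiv_dir_inner_mult:
  assumes "smooth g" "e \<in> Basis"
  shows "pderiv_dir e (\<lambda>X. (X \<bullet> e) * g X) = (\<lambda>X. g X + (X \<bullet> e) * pderiv_dir e g X)"
  using assms by (subst pderiv_dir_mult) (auto intro!: smooth_imp_differentiable smooth_intros)

lemma laplacian_inner_mult:
  fixes g :: "'a::euclidean_space \<Rightarrow> real"
  assumes g: "smooth g" and e: "e \<in> Basis"
  shows "laplacian (\<lambda>X. (X \<bullet> e) * g X) = (\<lambda>X. (X \<bullet> e) * laplacian g X + 2 * pderiv_dir e g X)"
proof
  fix X :: 'a
  have 1: "laplacian (\<lambda>X::'a. X \<bullet> e) X = 0" by (simp add: laplacian_def)
  have "(\<Sum>b\<in>Basis. (b \<bullet> e) * pderiv_dir b g X) = pderiv_dir e g X"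
    using pderiv_dir_sum_Basis[OF differentiable_on_UNIV_D[OF smooth_imp_differentiable[OF g]], of e X]
    by (simp add: inner_commute)
  with 1 show "laplacian (\<lambda>X. (X \<bullet> e) * g X) X = (X \<bullet> e) * laplacian g X + 2 * pderiv_dir e g X"
    by (subst laplacian_mult) (auto intro!: smooth_intros g)
qed

text \<open>Duffin's reflection: if \<open>\<psi>\<close> is biharmonic below the boundary, then the subtracted terms are
  biharmonic above it and carry the Dirichlet data of \<open>\<psi>\<close>.\<close>

definition dirichlet_correction :: "(R4 \<Rightarrow> real) \<Rightarrow> R4 \<Rightarrow> real" where
  "dirichlet_correction \<psi> X = \<psi> X - (\<psi> (reflect X) + (2 * ((X \<bullet> e\<^sub>y) * pderiv_dir e\<^sub>y \<psi> (reflect X))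
     + (X \<bullet> e\<^sub>y) * ((X \<bullet> e\<^sub>y) * laplacian \<psi> (reflect X))))"

lemma decays_dirichlet_correction:
  assumes "decays (Suc (Suc p)) \<psi>"
  shows "decays p (dirichlet_correction \<psi>)"
  unfolding dirichlet_correction_def
  by (intro decays_diff decays_add decays_cmult decays_inner_mult decays_reflect decays_laplacian
      decays_pderiv e\<^sub>y_Basis; rule decays_weaken[OF assms]) auto

lemma dirichlet_correction_boundary:
  assumes \<psi>: "smooth \<psi>"
  shows "dirichlet_correction \<psi> (x, 0) = 0" "pderiv_dir e\<^sub>y (dirichlet_correction \<psi>) (x, 0) = 0"
proof -
  have r: "reflect (x, 0) = (x, 0)" by (simp add: reflect_def)
  show "dirichlet_correction \<psi> (x, 0) = 0" by (simp add: dirichlet_correction_def r)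
  have "pderiv_dir e\<^sub>y (dirichlet_correction \<psi>) = (\<lambda>X. pderiv_dir e\<^sub>y \<psi> X - (- pderiv_dir e\<^sub>y \<psi> (reflect X)
     + (2 * (pderiv_dir e\<^sub>y \<psi> (reflect X) + (X \<bullet> e\<^sub>y) * - pderiv_dir e\<^sub>y (pderiv_dir e\<^sub>y \<psi>) (reflect X))
     + ((X \<bullet> e\<^sub>y) * laplacian \<psi> (reflect X) + (X \<bullet> e\<^sub>y) * (laplacian \<psi> (reflect X) + (X \<bullet> e\<^sub>y) * - pderiv_dir e\<^sub>y (laplacian \<psi>) (reflect X))))))"
    unfolding dirichlet_correction_def
    apply (subst pderiv_dir_diff, (intro smooth_intros \<psi>)+)
    apply (subst pderiv_dir_add, (intro smooth_imp_differentiable smooth_intros \<psi>)+)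
    apply (subst pderiv_dir_add, (intro smooth_imp_differentiable smooth_intros \<psi>)+)
    apply (subst pderiv_dir_cmult, (intro smooth_intros \<psi>)+)
    apply (simp only: pderiv_dir_inner_mult[OF _ e\<^sub>y_Basis] pderiv_dir_reflect smooth_intros \<psi>)
    done
  then show "pderiv_dir e\<^sub>y (dirichlet_correction \<psi>) (x, 0) = 0" by (simp add: r)
qed

lemma bilaplacian_dirichlet_correction:
  assumes \<psi>: "smooth \<psi>" and bih: "\<And>X. snd X < 0 \<Longrightarrow> laplacian (laplacian \<psi>) X = 0" and X: "X \<in> half_space"
  shows "laplacian (laplacian (dirichlet_correction \<psi>)) X = laplacian (laplacian \<psi>) X"
proof -
  let ?y = "\<lambda>X::R4. X \<bullet> e\<^sub>y"
  let ?D = "pderiv_dir e\<^sub>y"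
  define \<rho> where "\<rho> X = \<psi> (reflect X)" for X
  define g where "g X = ?D \<psi> (reflect X)" for X
  define k where "k X = laplacian \<psi> (reflect X)" for X
  have sm: "smooth \<rho>" "smooth g" "smooth k" unfolding \<rho>_def g_def k_def by (intro smooth_intros \<psi>)+
  note [smooth_intros] = sm
  have zero: "f X = 0" "?D f X = 0" "laplacian f X = 0" if "\<And>Z. snd Z > 0 \<Longrightarrow> f Z = 0" for f
  proof -
    have *: "open {Z::R4. snd Z > 0}" using open_half_space by (simp add: half_space_def)
    have XX: "X \<in> {Z::R4. snd Z > 0}" using X by (simp add: half_space_def)
    show "f X = 0" using that XX by simp
    show "?D f X = 0" using pderiv_dir_cong_open[OF * XX, of f "\<lambda>_. 0" e\<^sub>y] that by simp
    show "laplacian f X = 0" using laplacian_cong_open[OF * XX, of f "\<lambda>_. 0"] that by (simp add: laplacian_def)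
  qed
  have lk: "laplacian k Z = 0" if "snd Z > 0" for Z
  proof -
    have "snd (reflect Z) < 0" using that by (simp add: reflect_def)
    from bih[OF this] show ?thesis
      unfolding k_def by (simp add: laplacian_reflect smooth_laplacian \<psi>)
  qed
  have l\<rho>: "laplacian \<rho> = k" unfolding \<rho>_def k_def by (rule laplacian_reflect[OF \<psi>])
  have Dk: "?D k = (\<lambda>Z. - ?D (laplacian \<psi>) (reflect Z))" unfolding k_def by (intro pderiv_dir_reflect smooth_intros \<psi>)
  have lg: "laplacian g = (\<lambda>Z. - ?D k Z)"
    unfolding Dk g_def by (simp add: laplacian_reflect smooth_pderiv \<psi> laplacian_pderiv_commute)
  have llg: "laplacian (laplacian g) X = 0"
  proof -
    have "laplacian (laplacian g) = (\<lambda>Z. - 1 * ?D (laplacian k) Z)"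
      using laplacian_cmult[of "?D k" "- 1"] by (simp add: lg laplacian_pderiv_commute smooth_intros)
    then show ?thesis using zero(2)[of "laplacian k"] lk by simp
  qed
  have Dlg: "?D (laplacian g) X = - ?D (?D k) X"
    using pderiv_dir_cmult[of "?D k" e\<^sub>y "- 1"] by (simp add: lg smooth_intros)
  have 1: "laplacian (laplacian \<rho>) X = 0" using lk X by (simp add: l\<rho> half_space_def)
  have lyg: "laplacian (\<lambda>X. ?y X * g X) = (\<lambda>X. ?y X * laplacian g X + 2 * ?D g X)"
    by (rule laplacian_inner_mult[OF sm(2) e\<^sub>y_Basis])
  have 2: "laplacian (laplacian (\<lambda>X. ?y X * g X)) X = - 4 * ?D (?D k) X"
    unfolding lyg
    by (subst laplacian_add, (intro smooth_intros)+, subst laplacian_cmult, (intro smooth_intros)+)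
       (simp add: laplacian_inner_mult[OF _ e\<^sub>y_Basis] smooth_intros laplacian_pderiv_commute llg Dlg)
  have lyk: "laplacian (\<lambda>X. ?y X * (?y X * k X)) = (\<lambda>X. ?y X * (?y X * laplacian k X) + (4 * (?y X * ?D k X) + 2 * k X))"
  proof -
    have sk: "smooth (\<lambda>X. ?y X * k X)" by (intro smooth_intros)
    show ?thesis
      unfolding laplacian_inner_mult[OF sk e\<^sub>y_Basis] laplacian_inner_mult[OF sm(3) e\<^sub>y_Basis]
        pderiv_dir_inner_mult[OF sm(3) e\<^sub>y_Basis]
      by (simp add: algebra_simps)
  qed
  have 3: "laplacian (laplacian (\<lambda>X. ?y X * (?y X * k X))) X = 8 * ?D (?D k) X"
  proof -
    have "laplacian (laplacian (\<lambda>X. ?y X * (?y X * k X))) X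
       = laplacian (\<lambda>X. ?y X * (?y X * laplacian k X)) X + (4 * laplacian (\<lambda>X. ?y X * ?D k X) X + 2 * laplacian k X)"
    proof -
      have s: "smooth (\<lambda>X. ?y X * (?y X * laplacian k X))" "smooth (\<lambda>X. ?y X * ?D k X)"
        by (intro smooth_intros)+
      have s': "smooth (\<lambda>X. 4 * (?y X * ?D k X))" "smooth (\<lambda>X. 2 * k X)"
        "smooth (\<lambda>X. 4 * (?y X * ?D k X) + 2 * k X)"
        by (intro smooth_intros)+
      show ?thesis
        by (simp only: lyk laplacian_add[OF s(1) s'(3)] laplacian_add[OF s'(1,2)] laplacian_cmult[OF s(2)] laplacian_cmult[OF sm(3)])
    qed
    also have "laplacian (\<lambda>X. ?y X * (?y X * laplacian k X)) X = 0"
      by (rule zero(3)) (simp add: lk)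
    also have "laplacian k X = 0" using lk X by (simp add: half_space_def)
    also have "laplacian (\<lambda>X. ?y X * ?D k X) X = 2 * ?D (?D k) X"
      using zero(2)[of "laplacian k"] lk
      by (simp add: laplacian_inner_mult[OF _ e\<^sub>y_Basis] smooth_intros laplacian_pderiv_commute)
    finally show ?thesis by simp
  qed
  define R1 where "R1 X = ?y X * g X" for X
  define R2 where "R2 X = ?y X * (?y X * k X)" for X
  define R where "R X = 2 * R1 X + R2 X" for X
  have sR: "smooth R1" "smooth R2" unfolding R1_def R2_def by (intro smooth_intros)+
  have sR': "smooth (\<lambda>X. 2 * f X)" if "smooth f" for f :: "R4 \<Rightarrow> real" by (intro smooth_intros that)
  have R: "smooth R" unfolding R_def by (intro smooth_add sR' sR)
  have "laplacian R = (\<lambda>X. 2 * laplacian R1 X + laplacian R2 X)"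
    unfolding R_def by (simp only: laplacian_add[OF sR'[OF sR(1)] sR(2)] laplacian_cmult[OF sR(1)])
  then have "laplacian (laplacian R) X = 2 * laplacian (laplacian R1) X + laplacian (laplacian R2) X"
    by (simp only: laplacian_add[OF sR'[OF smooth_laplacian[OF sR(1)]] smooth_laplacian[OF sR(2)]]
        laplacian_cmult[OF smooth_laplacian[OF sR(1)]])
  then have lR: "laplacian (laplacian R) X = 0"
    using 2 3 unfolding R1_def R2_def by simp
  have "dirichlet_correction \<psi> = (\<lambda>X. \<psi> X - (\<rho> X + R X))"
    by (rule ext) (simp add: dirichlet_correction_def \<rho>_def g_def k_def R_def R1_def R2_def)
  then have "laplacian (laplacian (dirichlet_correction \<psi>)) X
      = laplacian (laplacian \<psi>) X - (laplacian (laplacian \<rho>) X + laplacian (laplacian R) X)"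
    using sm R \<psi> by (simp only: laplacian_diff laplacian_add smooth_add smooth_laplacian)
  then show ?thesis by (simp add: 1 lR)
qed

section \<open>A regularised fundamental solution\<close>

definition log_reg :: "R4 \<Rightarrow> real" where
  "log_reg X = ln (pos_reg ((norm X)\<^sup>2))"

text \<open>In dimension four \<open>log |X|\<close> is biharmonic away from the origin, so \<open>bump\<close> lives on the unit ball.\<close>

definition bump :: "R4 \<Rightarrow> real" where
  "bump = laplacian (laplacian log_reg)"

lemma smooth_log_pos_reg: "smooth (\<lambda>s. ln (pos_reg s))"
  by (intro smooth_intros pos_reg_pos)

lemma smooth_log_reg [smooth_intros]: "smooth log_reg"
  unfolding log_reg_def using smooth_radial[OF smooth_log_pos_reg] by simp

lemma smooth_bump [smooth_intros]: "smooth bump"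
  unfolding bump_def by (intro smooth_intros)

lemma pderiv_log_pos_reg: "s > 1 \<Longrightarrow> pderiv_dir 1 (\<lambda>s. ln (pos_reg s)) s = 1 / s ^ 1"
proof -
  assume s: "s > 1"
  have "(ln has_real_derivative 1 / s) (at s)" using s by (auto intro!: derivative_eq_intros)
  then have "((\<lambda>s. ln (pos_reg s)) has_real_derivative 1 / s) (at s)"
    by (rule has_field_derivative_transform_within_open[of _ _ _ "{1<..}"]) (use s in \<open>auto simp: pos_reg_eq\<close>)
  then show ?thesis by (simp add: pderiv_dir_real_eq)
qed

lemma bump_outside:
  assumes X: "norm X > 1"
  shows "bump X = 0"
proof -
  define \<theta>0 where "\<theta>0 s = ln (pos_reg s)" for s
  define \<theta>1 where "\<theta>1 = pderiv_dir 1 \<theta>0"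
  define \<theta>2 where "\<theta>2 = pderiv_dir 1 \<theta>1"
  define w where "w s = 4 * s * \<theta>2 s + 8 * \<theta>1 s" for s
  define w1 where "w1 = pderiv_dir 1 w"
  define w2 where "w2 = pderiv_dir 1 w1"
  have sm0: "smooth \<theta>0" unfolding \<theta>0_def by (rule smooth_log_pos_reg)
  have sm: "smooth \<theta>1" "smooth \<theta>2" "smooth w" "smooth w1"
    unfolding w1_def w_def \<theta>2_def \<theta>1_def by (intro smooth_intros sm0)+
  have t1: "\<theta>1 s = 1 / s ^ 1" if "s > 1" for s
    unfolding \<theta>1_def \<theta>0_def by (rule pderiv_log_pos_reg[OF that])
  have t2: "\<theta>2 s = (- 1) / s\<^sup>2" if "s > 1" for s
    using pderiv_dir_inverse_power_tail[of 1 \<theta>1 1 1, OF t1 _ that] by (simp add: \<theta>2_def power2_eq_square)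
  have w: "w s = 4 / s ^ 1" if "s > 1" for s
    using that by (simp add: w_def t1 t2 field_simps power2_eq_square)
  have w1: "w1 s = (- 4) / s\<^sup>2" if "s > 1" for s
    using pderiv_dir_inverse_power_tail[of 1 w 4 1, OF w _ that] by (simp add: w1_def power2_eq_square)
  have w2: "w2 s = 8 / s ^ 3" if "s > 1" for s
    using pderiv_dir_inverse_power_tail[of 1 w1 "- 4" 2, OF w1 _ that] by (simp add: w2_def power_numeral_reduce)
  have l1: "laplacian log_reg = (\<lambda>X. w ((norm X)\<^sup>2))"
    unfolding log_reg_def \<theta>0_def[symmetric] w_def
    using laplacian_radial[of \<theta>0 \<theta>1 \<theta>2, where 'a = R4] smooth_has_real_derivative[OF sm0] smooth_has_real_derivative[OF sm(1)]
    by (simp add: \<theta>1_def \<theta>2_def)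
  have "bump = (\<lambda>X. 4 * (norm X)\<^sup>2 * w2 ((norm X)\<^sup>2) + 8 * w1 ((norm X)\<^sup>2))"
    unfolding bump_def l1
    using laplacian_radial[of w w1 w2, where 'a = R4] smooth_has_real_derivative[OF sm(3)] smooth_has_real_derivative[OF sm(4)]
    by (simp add: w1_def w2_def)
  then have "bump X = 4 * (norm X)\<^sup>2 * w2 ((norm X)\<^sup>2) + 8 * w1 ((norm X)\<^sup>2)" by (rule fun_cong)
  also have "\<dots> = 0"
  proof -
    define q where "q = (norm X)\<^sup>2"
    have "q > 1" using X by (simp add: q_def one_less_power)
    then show ?thesis unfolding q_def[symmetric] by (simp add: w1 w2 field_simps power_numeral_reduce)
  qed
  finally show ?thesis .
qed

lemma decays_log_reg_derivative:
  assumes "m \<ge> 1"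
  shows "decays m ((pderiv_dir e\<^sub>y ^^ m) log_reg)"
proof (rule radial_symbol_decays)
  have "radial_symbol (2 * 1) (\<lambda>X::R4. pderiv_dir 1 (\<lambda>s. ln (pos_reg s)) ((norm X)\<^sup>2))"
    by (rule radial_symbol.radial[OF _ pderiv_log_pos_reg]) (intro smooth_pderiv smooth_log_pos_reg)
  then have "radial_symbol (Suc 0) (\<lambda>X::R4. 2 * ((X \<bullet> e\<^sub>y) * pderiv_dir 1 (\<lambda>s. ln (pos_reg s)) ((norm X)\<^sup>2)))"
    by (intro radial_symbol.scale radial_symbol.coord e\<^sub>y_Basis) (simp add: numeral_2_eq_2)
  then have 1: "radial_symbol (Suc 0) (pderiv_dir e\<^sub>y log_reg)"
    unfolding log_reg_def pderiv_dir_radial[OF smooth_log_pos_reg] by (simp add: mult.assoc)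
  have "radial_symbol (Suc j) ((pderiv_dir e\<^sub>y ^^ Suc j) log_reg)" for j
    by (induction j) (use 1 in \<open>auto intro: radial_symbol_pderiv[OF _ e\<^sub>y_Basis]\<close>)
  with assms show "radial_symbol m ((pderiv_dir e\<^sub>y ^^ m) log_reg)" by (cases m) auto
qed

lemma laplacian_log_1_plus:
  "laplacian (laplacian (\<lambda>X::R4. ln (1 + (norm X)\<^sup>2))) = (\<lambda>X. - 96 * inverse ((1 + (norm X)\<^sup>2) ^ 4))"
proof -
  define w where "w s = 4 * inverse (1 + s) + 4 * (inverse (1 + s))\<^sup>2" for s :: real
  define w1 where "w1 s = - 4 * (inverse (1 + s))\<^sup>2 - 8 * inverse (1 + s) ^ 3" for s :: real
  define w2 where "w2 s = 8 * inverse (1 + s) ^ 3 + 24 * inverse (1 + s) ^ 4" for s :: real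
  have "laplacian (\<lambda>X::R4. ln (1 + (norm X)\<^sup>2)) = (\<lambda>X. 4 * (norm X)\<^sup>2 * (- ((inverse (1 + (norm X)\<^sup>2))\<^sup>2)) + 2 * DIM(R4) * inverse (1 + (norm X)\<^sup>2))"
    by (rule laplacian_radial[of "\<lambda>s. ln (1 + s)" "\<lambda>s. inverse (1 + s)" "\<lambda>s. - ((inverse (1 + s))\<^sup>2)"])
       (auto intro!: derivative_eq_intros simp: power2_eq_square divide_inverse)
  also have "\<dots> = (\<lambda>X. w ((norm X)\<^sup>2))"
  proof
    fix X :: R4
    define i where "i = inverse (1 + (norm X)\<^sup>2)"
    have p: "1 + (norm X)\<^sup>2 \<noteq> 0" by (smt (verit) zero_le_power2)
    have q: "(norm X)\<^sup>2 * i = 1 - i" using p by (simp add: i_def field_simps)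
    have "4 * (norm X)\<^sup>2 * (- (i\<^sup>2)) + 2 * DIM(R4) * i = - 4 * ((norm X)\<^sup>2 * i) * i + 8 * i"
      by (simp add: power2_eq_square)
    also have "\<dots> = 4 * i + 4 * i\<^sup>2" unfolding q by (simp add: power2_eq_square algebra_simps)
    finally show "4 * (norm X)\<^sup>2 * (- ((inverse (1 + (norm X)\<^sup>2))\<^sup>2)) + 2 * DIM(R4) * inverse (1 + (norm X)\<^sup>2) = w ((norm X)\<^sup>2)"
      by (simp add: w_def i_def)
  qed
  finally have l: "laplacian (\<lambda>X::R4. ln (1 + (norm X)\<^sup>2)) = (\<lambda>X. w ((norm X)\<^sup>2))" .
  have "laplacian (\<lambda>X::R4. w ((norm X)\<^sup>2)) = (\<lambda>X. 4 * (norm X)\<^sup>2 * w2 ((norm X)\<^sup>2) + 2 * DIM(R4) * w1 ((norm X)\<^sup>2))"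
  proof (rule laplacian_radial)
    fix s :: real assume "s \<ge> 0"
    then have d: "((\<lambda>s. inverse (1 + s)) has_real_derivative - ((inverse (1 + s))\<^sup>2)) (at s)"
      by (auto intro!: derivative_eq_intros simp: power2_eq_square)
    have p: "((\<lambda>s. inverse (1 + s) ^ n) has_real_derivative - (real n * inverse (1 + s) ^ Suc n)) (at s)" for n
      using DERIV_power[OF d, of n] by (cases n) (simp_all add: power2_eq_square mult_ac)
    show "(w has_real_derivative w1 s) (at s)"
      using DERIV_add[OF DERIV_cmult[OF p[of 1], of 4] DERIV_cmult[OF p[of 2], of 4]]
      by (simp add: w_def[abs_def] w1_def power_numeral_reduce)
    show "(w1 has_real_derivative w2 s) (at s)"
      using DERIV_diff[OF DERIV_cmult[OF p[of 2], of "- 4"] DERIV_cmult[OF p[of 3], of 8]]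
      by (simp add: w1_def[abs_def] w2_def power_numeral_reduce)
  qed
  also have "\<dots> = (\<lambda>X. - 96 * inverse ((1 + (norm X)\<^sup>2) ^ 4))"
  proof
    fix X :: R4
    define i where "i = inverse (1 + (norm X)\<^sup>2)"
    have p: "1 + (norm X)\<^sup>2 \<noteq> 0" by (smt (verit) zero_le_power2)
    have q: "(norm X)\<^sup>2 * i = 1 - i" using p by (simp add: i_def field_simps)
    have "4 * (norm X)\<^sup>2 * (8 * i ^ 3 + 24 * i ^ 4) + 2 * DIM(R4) * (- 4 * i\<^sup>2 - 8 * i ^ 3)
       = 4 * ((norm X)\<^sup>2 * i) * (8 * i\<^sup>2 + 24 * i ^ 3) + 8 * (- 4 * i\<^sup>2 - 8 * i ^ 3)"
      by (simp add: algebra_simps power_numeral_reduce)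
    also have "\<dots> = - 96 * i ^ 4" unfolding q by (simp add: algebra_simps power_numeral_reduce)
    finally show "4 * (norm X)\<^sup>2 * w2 ((norm X)\<^sup>2) + 2 * DIM(R4) * w1 ((norm X)\<^sup>2) = - 96 * inverse ((1 + (norm X)\<^sup>2) ^ 4)"
      by (simp add: w1_def w2_def i_def power_inverse)
  qed
  finally show ?thesis by (simp add: l)
qed

lemma smooth_log_1_plus: "smooth (\<lambda>X::R4. ln (1 + (norm X)\<^sup>2))"
  by (rule smooth_ln[OF smooth_add[OF smooth_const smooth_norm_square]]) (simp add: add_pos_nonneg)

lemma log_reg_minus_log_bound:
  assumes "norm X \<ge> 1"
  shows "\<bar>log_reg X - ln (1 + (norm X)\<^sup>2)\<bar> \<le> inverse ((norm X)\<^sup>2)"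
proof -
  define q where "q = (norm X)\<^sup>2"
  have q: "q \<ge> 1" using assms by (simp add: q_def one_le_power)
  have "ln (1 + q) = ln q + ln (1 + inverse q)"
  proof -
    have "1 + q = q * (1 + inverse q)" using q by (simp add: field_simps)
    moreover have "1 + inverse q > 0" using q by (simp add: add_pos_pos)
    ultimately show ?thesis using q by (simp only: ln_mult_pos)
  qed
  moreover have "0 \<le> ln (1 + inverse q)" "ln (1 + inverse q) \<le> inverse q"
    using q by (auto intro: ln_add_one_self_le_self)
  ultimately show ?thesis using q by (simp add: log_reg_def q_def[symmetric] pos_reg_eq)
qed

text \<open>The integral is the same for every regularisation of the logarithm, because two of them differ by a
  function vanishing at infinity; for \<open>ln (1 + |X|^2)\<close> the bilaplacian has a sign.\<close>

lemma integral_bump_nonzero: "(LINT X|lborel. bump X) \<noteq> 0"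
proof -
  define P :: "R4 \<Rightarrow> real" where "P X = ln (1 + (norm X)\<^sup>2)" for X
  define w :: "R4 \<Rightarrow> real" where "w X = inverse ((1 + (norm X)\<^sup>2) ^ 4)" for X
  have P: "smooth P" unfolding P_def by (rule smooth_log_1_plus)
  have lP: "laplacian (laplacian P) = (\<lambda>X. - 96 * w X)"
    unfolding P_def w_def by (rule laplacian_log_1_plus)
  define F where "F X = log_reg X - P X" for X
  have F: "smooth F" unfolding F_def by (intro smooth_intros P)
  have lF: "laplacian (laplacian F) X = bump X + 96 * w X" for X
    unfolding F_def bump_def using lP P by (simp add: laplacian_diff smooth_intros)
  have [measurable]: "F \<in> borel_measurable borel" "bump \<in> borel_measurable borel"
    by (intro smooth_imp_measurable smooth_intros F)+
  have [measurable]: "w \<in> borel_measurable borel" unfolding w_def by measurable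
  have w0: "w X > 0" for X
    unfolding w_def by (intro positive_imp_inverse_positive zero_less_power add_pos_nonneg) auto
  have w: "integrable lborel w"
  proof (rule Bochner_Integration.integrable_bound[OF integrable_mult_right[OF integrable_norm_power, of 16]])
    show "AE X in lborel. norm (w X) \<le> norm (16 * inverse ((1 + norm X) ^ (2 * DIM(R4))))"
    proof (rule AE_I2)
      fix X :: R4
      have "0 \<le> (norm X - 1)\<^sup>2" by simp
      then have "(1 + norm X)\<^sup>2 \<le> 2 * (1 + (norm X)\<^sup>2)" by (simp add: power2_diff power2_sum)
      then have "((1 + norm X)\<^sup>2) ^ 4 \<le> (2 * (1 + (norm X)\<^sup>2)) ^ 4" by (intro power_mono) auto
      then have "(1 + norm X) ^ 8 \<le> 16 * (1 + (norm X)\<^sup>2) ^ 4"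
        unfolding power_mult_distrib by (simp add: power_mult[symmetric])
      moreover have "0 < (1 + norm X) ^ 8" "0 < (1 + (norm X)\<^sup>2) ^ 4"
        by (intro zero_less_power add_pos_nonneg; simp)+
      ultimately have "inverse ((1 + (norm X)\<^sup>2) ^ 4) \<le> 16 * inverse ((1 + norm X) ^ 8)"
        by (simp add: field_simps)
      then show "norm (w X) \<le> norm (16 * inverse ((1 + norm X) ^ (2 * DIM(R4))))"
        using w0[of X] by (simp add: w_def)
    qed
  qed simp
  have b: "integrable lborel bump"
    by (rule integrable_lborel_compact_support(2)[of _ 1]) (auto intro: smooth_intros bump_outside)
  define g :: "R4 \<Rightarrow> real" where "g = laplacian (laplacian cutoff)"
  have g: "smooth g" unfolding g_def by (intro smooth_intros)
  have [measurable]: "g \<in> borel_measurable borel" by (rule smooth_imp_measurable[OF g])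
  have [measurable]: "(cutoff :: R4 \<Rightarrow> real) \<in> borel_measurable borel" by (intro smooth_imp_measurable smooth_intros)
  have g0: "g X = 0" if "norm X > 2" for X
    unfolding g_def using that cutoff_0 by (auto intro!: laplacian_outside[of 2])
  have gi: "integrable lborel g"
    by (rule integrable_lborel_compact_support(2)[OF g g0]) auto
  obtain C where C: "\<And>X. \<bar>F X\<bar> \<le> C"
  proof -
    have "compact (F ` cball 0 1)"
      by (intro compact_continuous_image continuous_on_subset[OF smooth_imp_continuous[OF F]]) auto
    then obtain C0 where C0: "\<forall>z\<in>F ` cball 0 1. norm z \<le> C0"
      using compact_imp_bounded bounded_iff by blast
    have "\<bar>F X\<bar> \<le> max C0 1" for X
    proof (cases "norm X \<le> 1")
      case True
      then have "F X \<in> F ` cball 0 1" by (intro imageI) simp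
      then have "norm (F X) \<le> C0" using C0 by blast
      then show ?thesis by simp
    next
      case False
      then have "inverse ((norm X)\<^sup>2) \<le> 1" by (simp add: inverse_le_1_iff one_le_power)
      then show ?thesis using log_reg_minus_log_bound[of X] False by (simp add: F_def P_def)
    qed
    then show ?thesis using that by blast
  qed
  define s where "s k = real (Suc k)" for k
  have s: "s k > 0" "s k \<ge> 1" for k by (auto simp: s_def)
  define \<phi> :: "nat \<Rightarrow> R4 \<Rightarrow> real" where "\<phi> k X = cutoff (inverse (s k) *\<^sub>R X)" for k X
  have \<phi>: "smooth (\<phi> k)" for k unfolding \<phi>_def by (intro smooth_scale smooth_intros)
  have \<phi>0: "\<phi> k X = 0" if "norm X > 2 * s k" for k X
    unfolding \<phi>_def using that s[of k] by (intro cutoff_0) (simp add: field_simps)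
  have l\<phi>: "laplacian (laplacian (\<phi> k)) X = inverse (s k) ^ 4 * g (inverse (s k) *\<^sub>R X)" for k X
  proof -
    have L: "bounded_linear (\<lambda>X::R4. inverse (s k) *\<^sub>R X)" by (rule bounded_linear_scaleR_right)
    have *: "laplacian (\<lambda>X::R4. f (inverse (s k) *\<^sub>R X)) = (\<lambda>X. (inverse (s k))\<^sup>2 * laplacian f (inverse (s k) *\<^sub>R X))"
      if "smooth f" for f
      using laplacian_affine_scale[OF L, of "\<lambda>_. inverse (s k)" "(inverse (s k))\<^sup>2" f 0] that by simp
    have "laplacian (laplacian (\<phi> k)) = (\<lambda>X. (inverse (s k))\<^sup>2 * ((inverse (s k))\<^sup>2 * g (inverse (s k) *\<^sub>R X)))"
      unfolding \<phi>_def *[OF smooth_cutoff] laplacian_cmult[OF smooth_scale[OF smooth_laplacian[OF smooth_cutoff]]]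
        *[OF smooth_laplacian[OF smooth_cutoff]] g_def ..
    then show ?thesis by (simp add: power_numeral_reduce)
  qed
  have "(LINT X|lborel. \<phi> k X * (bump X + 96 * w X)) = (LINT Z|lborel. F (s k *\<^sub>R Z) * g Z)" for k
  proof -
    have "(LINT X|lborel. \<phi> k X * (bump X + 96 * w X)) = (LINT X|lborel. F X * (inverse (s k) ^ 4 * g (inverse (s k) *\<^sub>R X)))"
      using green_whole_space[OF F \<phi>[of k], of "2 * s k"] \<phi>0[where k = k] by (simp add: lF l\<phi>)
    also have "\<dots> = s k ^ 4 * (LINT Z|lborel. F (0 + s k *\<^sub>R Z) * (inverse (s k) ^ 4 * g (inverse (s k) *\<^sub>R (0 + s k *\<^sub>R Z))))"
      using lborel_integral_affine(1)[of "\<lambda>X. F X * (inverse (s k) ^ 4 * g (inverse (s k) *\<^sub>R X))" "s k" 0] s[of k] by simp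
    also have "\<dots> = (LINT Z|lborel. F (s k *\<^sub>R Z) * g Z)"
    proof -
      have "s k ^ 4 * (F (s k *\<^sub>R Z) * (inverse (s k) ^ 4 * g Z)) = F (s k *\<^sub>R Z) * g Z" for Z
        using s(1)[of k] by (simp add: field_simps)
      moreover have "inverse (s k) *\<^sub>R (0 + s k *\<^sub>R Z) = Z" "0 + s k *\<^sub>R Z = s k *\<^sub>R Z" for Z :: R4
        using s(1)[of k] by simp_all
      ultimately show ?thesis by (simp only: integral_mult_right_zero[symmetric])
    qed
    finally show ?thesis .
  qed
  moreover have "(\<lambda>k. LINT Z|lborel. F (s k *\<^sub>R Z) * g Z) \<longlonglongrightarrow> (LINT Z|(lborel :: R4 measure). 0)"
  proof (rule integral_dominated_convergence[where w = "\<lambda>Z. C * \<bar>g Z\<bar>"])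
    show "integrable lborel (\<lambda>Z. C * \<bar>g Z\<bar>)" using gi by simp
    show "AE Z in lborel. (\<lambda>k. F (s k *\<^sub>R Z) * g Z) \<longlonglongrightarrow> 0"
      using AE_lborel_singleton[of 0]
    proof eventually_elim
      fix Z :: R4 assume Z: "Z \<noteq> 0"
      have st: "filterlim s at_top sequentially" unfolding s_def
        by (rule filterlim_compose[OF filterlim_real_sequentially filterlim_Suc])
      have nt: "filterlim (\<lambda>k. norm (s k *\<^sub>R Z)) at_top sequentially"
        using filterlim_at_top_mult_tendsto_pos[OF tendsto_const[of "norm Z"] _ st] Z s
        by (simp add: abs_of_pos)
      have "(\<lambda>k. inverse ((norm (s k *\<^sub>R Z))\<^sup>2)) \<longlonglongrightarrow> 0"
        by (rule tendsto_inverse_0_at_top, rule filterlim_pow_at_top[OF _ nt]) simp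
      moreover have "\<forall>\<^sub>F k in sequentially. norm (F (s k *\<^sub>R Z)) \<le> inverse ((norm (s k *\<^sub>R Z))\<^sup>2)"
      proof -
        have "\<forall>\<^sub>F k in sequentially. 1 \<le> norm (s k *\<^sub>R Z)" using nt unfolding filterlim_at_top by blast
        then show ?thesis
          by eventually_elim (simp only: F_def P_def real_norm_def log_reg_minus_log_bound)
      qed
      ultimately have "(\<lambda>k. F (s k *\<^sub>R Z)) \<longlonglongrightarrow> 0" by (rule Lim_null_comparison[rotated])
      then show "(\<lambda>k. F (s k *\<^sub>R Z) * g Z) \<longlonglongrightarrow> 0" by (rule tendsto_mult_left_zero)
    qed
    show "AE Z in lborel. norm (F (s k *\<^sub>R Z) * g Z) \<le> C * \<bar>g Z\<bar>" for k
      using C by (intro AE_I2) (simp add: abs_mult mult_right_mono)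
  qed measurable
  moreover have "(\<lambda>k. LINT X|lborel. \<phi> k X * (bump X + 96 * w X)) \<longlonglongrightarrow> (LINT X|lborel. bump X + 96 * w X)"
  proof (rule integral_dominated_convergence[where w = "\<lambda>X. \<bar>bump X + 96 * w X\<bar>"])
    show "integrable lborel (\<lambda>X. \<bar>bump X + 96 * w X\<bar>)" using b w by auto
    show "AE X in lborel. (\<lambda>k. \<phi> k X * (bump X + 96 * w X)) \<longlonglongrightarrow> bump X + 96 * w X"
    proof (rule AE_I2)
      fix X :: R4
      obtain m :: nat where m: "norm X \<le> m" using real_arch_simple by blast
      have "\<phi> k X = 1" if "k \<ge> m" for k
        unfolding \<phi>_def using that m s[of k] by (intro cutoff_1) (simp add: field_simps s_def)
      then have "\<forall>\<^sub>F k in sequentially. \<phi> k X * (bump X + 96 * w X) = bump X + 96 * w X"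
        by (intro eventually_sequentiallyI[of m]) simp
      then show "(\<lambda>k. \<phi> k X * (bump X + 96 * w X)) \<longlonglongrightarrow> bump X + 96 * w X" by (rule tendsto_eventually)
    qed
    show "AE X in lborel. norm (\<phi> k X * (bump X + 96 * w X)) \<le> \<bar>bump X + 96 * w X\<bar>" for k
      using smooth_step_bounds by (intro AE_I2) (auto simp: abs_mult \<phi>_def cutoff_def intro!: mult_left_le_one_le)
  next
    have [measurable]: "\<phi> k \<in> borel_measurable borel" for k by (rule smooth_imp_measurable[OF \<phi>])
    show "(\<lambda>X. \<phi> k X * (bump X + 96 * w X)) \<in> borel_measurable lborel" for k by simp
  qed simp
  ultimately have "(LINT X|lborel. bump X + 96 * w X) = 0" using LIMSEQ_unique by fastforce
  then have "(LINT X|lborel. bump X) = - 96 * (LINT X|lborel. w X)" using b w by simp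
  moreover have "(LINT X|lborel. w X) \<noteq> 0"
  proof
    assume "(LINT X|lborel. w X) = 0"
    then have "AE X in lborel. w X = 0"
      using integral_nonneg_eq_0_iff_AE[OF w] w0 by (simp add: less_imp_le)
    then have "AE X in (lborel :: R4 measure). False" by eventually_elim (use w0 in \<open>simp add: less_imp_neq[symmetric]\<close>)
    then show False by (simp add: eventually_False ae_filter_eq_bot_iff)
  qed
  ultimately show ?thesis by simp
qed

section \<open>Mollification\<close>

lemma AE_zero_if_mollification_zero:
  fixes E :: "R4 \<Rightarrow> real"
  assumes E: "loc_integrable E"
    and zero: "\<And>\<epsilon> Y. \<epsilon> > 0 \<Longrightarrow> snd Y > \<epsilon> \<Longrightarrow> (LINT X|lborel. E X * bump (inverse \<epsilon> *\<^sub>R (X - Y))) = 0"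
  shows "AE X in lborel. snd X > 0 \<longrightarrow> E X = 0"
proof -
  have [measurable]: "E \<in> borel_measurable borel" using E by (rule loc_integrable_measurable)
  have [measurable]: "bump \<in> borel_measurable borel" by (intro smooth_imp_measurable smooth_intros)
  obtain M where M: "\<And>X. \<bar>bump X\<bar> \<le> M"
    using continuous_compact_support_bound[of bump 1 0] bump_outside smooth_imp_continuous[OF smooth_bump] by auto
  have M0: "M \<ge> 0" using M[of 0] by simp
  have bi: "integrable lborel bump"
    by (rule integrable_lborel_compact_support(2)[of _ 1]) (auto intro: smooth_intros bump_outside)
  define c where "c = (LINT X|lborel. bump X)"
  have c: "c \<noteq> 0" unfolding c_def by (rule integral_bump_nonzero)
  have box0: "(LINT X|lborel. E X * indicator (box p q) X) = 0" if p: "snd p > 0" for p q :: R4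
  proof -
    let ?S = "box p q"
    have Spos: "snd X > snd p" if "X \<in> ?S" for X
      using that e\<^sub>y_Basis unfolding box_def by (auto simp: inner_e\<^sub>y)
    obtain R where R: "R \<ge> 0" "\<And>X. X \<in> ?S \<Longrightarrow> norm X \<le> R"
      using bounded_box[of p q] unfolding bounded_iff by (meson abs_ge_self abs_ge_zero order_trans)
    define \<epsilon> where "\<epsilon> k = min (1 / real (Suc k)) (snd p)" for k
    have \<epsilon>: "\<epsilon> k > 0" "\<epsilon> k \<le> 1" "\<epsilon> k \<le> snd p" for k using p by (auto simp: \<epsilon>_def min_le_iff_disj)
    have \<epsilon>0: "\<epsilon> \<longlonglongrightarrow> 0"
    proof (rule tendsto_sandwich[OF always_eventually always_eventually tendsto_const])
      show "\<forall>k. 0 \<le> \<epsilon> k" using \<epsilon>(1) less_imp_le by blast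
      show "\<forall>k. \<epsilon> k \<le> inverse (real (Suc k))" by (simp add: \<epsilon>_def inverse_eq_divide)
    qed (rule LIMSEQ_inverse_real_of_nat)
    define g where "g k X = (LINT Z|lborel. indicator ?S (X - \<epsilon> k *\<^sub>R Z) * bump Z)" for k X
    have eq: "(LINT X|lborel. E X * g k X) = 0" for k
    proof -
      have gk: "(LINT Y|lborel. indicator ?S Y * bump (inverse (\<epsilon> k) *\<^sub>R (X - Y))) = \<epsilon> k ^ 4 * g k X" for X
      proof -
        have "indicator ?S (X + (- \<epsilon> k) *\<^sub>R Z) * bump (inverse (\<epsilon> k) *\<^sub>R (X - (X + (- \<epsilon> k) *\<^sub>R Z)))
           = indicator ?S (X - \<epsilon> k *\<^sub>R Z) * bump Z" for Z
          using \<epsilon>(1)[of k] by simp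
        then have "g k X = (LINT Y|lborel. indicator ?S Y * bump (inverse (\<epsilon> k) *\<^sub>R (X - Y))) / \<bar>- \<epsilon> k\<bar> ^ DIM(R4)"
          using lborel_integral_affine(1)[of "\<lambda>Y. indicator ?S Y * bump (inverse (\<epsilon> k) *\<^sub>R (X - Y))" "- \<epsilon> k" X] \<epsilon>(1)[of k]
          by (simp only: g_def) simp
        then show ?thesis using \<epsilon>(1)[of k] by simp
      qed
      define G where "G Y X = indicator ?S Y * (E X * bump (inverse (\<epsilon> k) *\<^sub>R (X - Y)))" for Y X
      have Gm: "(\<lambda>(Y, X). G Y X) \<in> borel_measurable (lborel \<Otimes>\<^sub>M lborel)"
        unfolding G_def by measurable
      have EI: "(\<integral>\<^sup>+ X. ennreal (norm (indicator (cball 0 (R + 1)) X * E X)) \<partial>lborel) < \<infinity>"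
        using E unfolding loc_integrable_def integrable_iff_bounded by blast
      have Gb: "norm (G Y X) \<le> indicator ?S Y * (M * norm (indicator (cball 0 (R + 1)) X * E X))" for X Y
      proof (cases "Y \<in> ?S \<and> norm (X - Y) \<le> \<epsilon> k")
        case True
        have "norm X \<le> norm (X - Y) + norm Y" using norm_triangle_ineq[of "X - Y" Y] by simp
        then have "norm X \<le> R + 1" using True R(2)[of Y] \<epsilon>(2)[of k] by linarith
        then show ?thesis using True M[of "inverse (\<epsilon> k) *\<^sub>R (X - Y)"]
          by (simp add: G_def abs_mult mult.commute[of M] mult_left_mono)
      next
        case False
        have "G Y X = 0"
        proof (cases "Y \<in> ?S")
          case True
          with False have "norm (X - Y) > \<epsilon> k" by simp
          then have "norm (inverse (\<epsilon> k) *\<^sub>R (X - Y)) > 1"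
            unfolding norm_scaleR using \<epsilon>(1)[of k] by (simp add: less_divide_eq divide_inverse[symmetric] mult.commute[of "inverse _"])
          then show ?thesis by (simp add: G_def bump_outside)
        qed (simp add: G_def)
        then show ?thesis using M0 by simp
      qed
      have "(\<integral>\<^sup>+ Y. (\<integral>\<^sup>+ X. ennreal (norm (G Y X)) \<partial>lborel) \<partial>lborel)
         \<le> (\<integral>\<^sup>+ Y. indicator ?S Y * (ennreal M * (\<integral>\<^sup>+ X. ennreal (norm (indicator (cball 0 (R + 1)) X * E X)) \<partial>lborel)) \<partial>lborel)"
      proof (rule nn_integral_mono)
        fix Y :: R4
        have "(\<integral>\<^sup>+ X. ennreal (norm (G Y X)) \<partial>lborel)
            \<le> (\<integral>\<^sup>+ X. indicator ?S Y * ennreal M * ennreal (norm (indicator (cball 0 (R + 1)) X * E X)) \<partial>lborel)"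
        proof (rule nn_integral_mono)
          fix X :: R4
          have "ennreal (norm (G Y X)) \<le> ennreal (indicator ?S Y * (M * norm (indicator (cball 0 (R + 1)) X * E X)))"
            by (rule ennreal_leI[OF Gb])
          also have "\<dots> = indicator ?S Y * ennreal M * ennreal (norm (indicator (cball 0 (R + 1)) X * E X))"
            using M0 by (cases "Y \<in> ?S") (simp_all add: ennreal_mult)
          finally show "ennreal (norm (G Y X)) \<le> indicator ?S Y * ennreal M * ennreal (norm (indicator (cball 0 (R + 1)) X * E X))" .
        qed
        also have "\<dots> = indicator ?S Y * (ennreal M * (\<integral>\<^sup>+ X. ennreal (norm (indicator (cball 0 (R + 1)) X * E X)) \<partial>lborel))"
          by (subst nn_integral_cmult) (measurable, simp add: mult.assoc)
        finally show "(\<integral>\<^sup>+ X. ennreal (norm (G Y X)) \<partial>lborel) \<le> \<dots>" .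
      qed
      also have "\<dots> = emeasure lborel ?S * (ennreal M * (\<integral>\<^sup>+ X. ennreal (norm (indicator (cball 0 (R + 1)) X * E X)) \<partial>lborel))"
        by (subst nn_integral_multc) auto
      also have "\<dots> < \<infinity>"
        using EI emeasure_lborel_box_finite[of p q] by (simp add: ennreal_mult_less_top)
      finally have fin: "(\<integral>\<^sup>+ Y. (\<integral>\<^sup>+ X. ennreal (norm (G Y X)) \<partial>lborel) \<partial>lborel) < \<infinity>" .
      have int: "integrable (lborel \<Otimes>\<^sub>M lborel) (\<lambda>(Y, X). G Y X)"
      proof (rule integrableI_bounded[OF Gm])
        have "(\<integral>\<^sup>+ z. ennreal (norm (case z of (Y, X) \<Rightarrow> G Y X)) \<partial>(lborel \<Otimes>\<^sub>M lborel))
           = (\<integral>\<^sup>+ Y. (\<integral>\<^sup>+ X. ennreal (norm (G Y X)) \<partial>lborel) \<partial>lborel)"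
          using Gm by (subst lborel.nn_integral_fst[symmetric]) (auto simp: case_prod_beta)
        with fin show "(\<integral>\<^sup>+ z. ennreal (norm (case z of (Y, X) \<Rightarrow> G Y X)) \<partial>(lborel \<Otimes>\<^sub>M lborel)) < \<infinity>" by simp
      qed
      have "(LINT X|lborel. G Y X) = 0" for Y
      proof (cases "Y \<in> ?S")
        case True
        then have "snd Y > \<epsilon> k" using Spos[OF True] \<epsilon>(3)[of k] by linarith
        from zero[OF \<epsilon>(1) this] True show ?thesis by (simp add: G_def)
      qed (simp add: G_def)
      then have "(LINT X|lborel. LINT Y|lborel. G Y X) = 0"
        using lborel_pair.integral_snd[OF int] lborel_pair.integral_fst[OF int] by simp
      moreover have "(LINT Y|lborel. G Y X) = \<epsilon> k ^ 4 * (E X * g k X)" for X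
      proof -
        have "(LINT Y|lborel. G Y X) = (LINT Y|lborel. E X * (indicator ?S Y * bump (inverse (\<epsilon> k) *\<^sub>R (X - Y))))"
          unfolding G_def by (simp add: mult_ac)
        then show ?thesis using gk[of X] by simp
      qed
      ultimately show ?thesis using \<epsilon>(1)[of k] by simp
    qed
    have "(\<lambda>k. LINT X|lborel. E X * g k X) \<longlonglongrightarrow> (LINT X|lborel. E X * (indicator ?S X * c))"
    proof (rule integral_dominated_convergence[where w = "\<lambda>X. \<bar>E X * (indicator (cball 0 (R + 1)) X * (LINT Z|lborel. \<bar>bump Z\<bar>))\<bar>"])
      show "integrable lborel (\<lambda>X. \<bar>E X * (indicator (cball 0 (R + 1)) X * (LINT Z|lborel. \<bar>bump Z\<bar>))\<bar>)"
        by (rule integrable_abs, rule integrable_loc_bounded[OF E, of _ "LINT Z|lborel. \<bar>bump Z\<bar>" "R + 1"])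
           (auto simp: indicator_def)
      show "(\<lambda>X. E X * g k X) \<in> borel_measurable lborel" for k
        unfolding g_def by measurable
      show "AE X in lborel. norm (E X * g k X) \<le> \<bar>E X * (indicator (cball 0 (R + 1)) X * (LINT Z|lborel. \<bar>bump Z\<bar>))\<bar>" for k
      proof (rule AE_I2)
        fix X :: R4
        have b0: "0 \<le> (LINT Z|lborel. \<bar>bump Z\<bar>)" by simp
        have "\<bar>g k X\<bar> \<le> indicator (cball 0 (R + 1)) X * (LINT Z|lborel. \<bar>bump Z\<bar>)"
        proof (cases "norm X \<le> R + 1")
          case True
          have "\<bar>g k X\<bar> \<le> (LINT Z|lborel. \<bar>indicator ?S (X - \<epsilon> k *\<^sub>R Z) * bump Z\<bar>)"
            unfolding g_def by (rule integral_abs_bound)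
          also have "\<dots> \<le> (LINT Z|lborel. \<bar>bump Z\<bar>)"
            using bi by (intro integral_mono' integrable_abs) (auto simp: indicator_def)
          finally show ?thesis using True by simp
        next
          case False
          have "indicator ?S (X - \<epsilon> k *\<^sub>R Z) * bump Z = 0" for Z
          proof (cases "norm Z \<le> 1")
            case True
            have "norm X \<le> norm (X - \<epsilon> k *\<^sub>R Z) + norm (\<epsilon> k *\<^sub>R Z)"
              using norm_triangle_ineq[of "X - \<epsilon> k *\<^sub>R Z" "\<epsilon> k *\<^sub>R Z"] by simp
            also have "norm (\<epsilon> k *\<^sub>R Z) \<le> 1" using True \<epsilon>(1,2)[of k] by (simp add: mult_le_one)
            finally have "norm (X - \<epsilon> k *\<^sub>R Z) > R" using False by linarith
            then have "X - \<epsilon> k *\<^sub>R Z \<notin> ?S"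
              using R(2)[of "X - \<epsilon> k *\<^sub>R Z"] by (intro notI) simp
            then show ?thesis by simp
          qed (simp add: bump_outside)
          then have "g k X = 0" unfolding g_def by (simp only:) simp
          then show ?thesis using b0 by simp
        qed
        then show "norm (E X * g k X) \<le> \<bar>E X * (indicator (cball 0 (R + 1)) X * (LINT Z|lborel. \<bar>bump Z\<bar>))\<bar>"
          using b0 by (simp add: abs_mult mult_left_mono)
      qed
      show "AE X in lborel. (\<lambda>k. E X * g k X) \<longlonglongrightarrow> E X * (indicator ?S X * c)"
      proof (rule AE_mp[OF AE_not_in[OF null_sets_cbox_Diff_box[of p q]]], rule AE_I2, rule impI)
        fix X assume X: "X \<notin> cbox p q - ?S"
        have near: "\<forall>\<^sub>F k in sequentially. \<forall>Z. norm Z \<le> 1 \<longrightarrow> X - \<epsilon> k *\<^sub>R Z \<in> T" if T: "open T" "X \<in> T" for T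
        proof -
          obtain e where e: "e > 0" "ball X e \<subseteq> T" using T open_contains_ball by blast
          have "\<forall>\<^sub>F k in sequentially. \<epsilon> k < e" using order_tendstoD(2)[OF \<epsilon>0 e(1)] .
          then show ?thesis
          proof eventually_elim
            fix k assume k: "\<epsilon> k < e"
            show "\<forall>Z. norm Z \<le> 1 \<longrightarrow> X - \<epsilon> k *\<^sub>R Z \<in> T"
            proof (intro allI impI)
              fix Z :: R4 assume "norm Z \<le> 1"
              then have "norm (\<epsilon> k *\<^sub>R Z) \<le> \<epsilon> k" using \<epsilon>(1)[of k] by (simp add: mult_left_le)
              then have "dist X (X - \<epsilon> k *\<^sub>R Z) < e" using k by (simp add: dist_norm)
              then show "X - \<epsilon> k *\<^sub>R Z \<in> T" using e(2) by auto
            qed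
          qed
        qed
        have "\<forall>\<^sub>F k in sequentially. g k X = indicator ?S X * c"
        proof (cases "X \<in> ?S")
          case True
          show ?thesis using near[OF open_box True]
          proof eventually_elim
            fix k assume k: "\<forall>Z. norm Z \<le> 1 \<longrightarrow> X - \<epsilon> k *\<^sub>R Z \<in> ?S"
            have "indicator ?S (X - \<epsilon> k *\<^sub>R Z) * bump Z = bump Z" for Z
              using k[rule_format, of Z] bump_outside[of Z] by (cases "norm Z \<le> 1") simp_all
            then have "g k X = c" unfolding g_def c_def by (simp only:)
            then show "g k X = indicator ?S X * c" using True by simp
          qed
        next
          case False
          with X have "X \<in> - cbox p q" by auto
          from near[OF _ this] have "\<forall>\<^sub>F k in sequentially. \<forall>Z. norm Z \<le> 1 \<longrightarrow> X - \<epsilon> k *\<^sub>R Z \<in> - cbox p q"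
            by (simp add: open_Compl closed_cbox)
          then show ?thesis
          proof eventually_elim
            fix k assume k: "\<forall>Z. norm Z \<le> 1 \<longrightarrow> X - \<epsilon> k *\<^sub>R Z \<in> - cbox p q"
            have "indicator ?S (X - \<epsilon> k *\<^sub>R Z) * bump Z = 0" for Z
            proof (cases "norm Z \<le> 1")
              case True
              then have "X - \<epsilon> k *\<^sub>R Z \<notin> ?S"
                using k[rule_format, OF True] box_subset_cbox[of p q] by blast
              then show ?thesis by simp
            qed (simp add: bump_outside)
            then have "g k X = 0" unfolding g_def by (simp only:) simp
            then show "g k X = indicator ?S X * c" using False by simp
          qed
        qed
        then show "(\<lambda>k. E X * g k X) \<longlonglongrightarrow> E X * (indicator ?S X * c)"
          by (intro tendsto_mult tendsto_const tendsto_eventually)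
      qed
    qed simp
    then have "(LINT X|lborel. E X * (indicator ?S X * c)) = 0"
      unfolding eq using LIMSEQ_unique tendsto_const by blast
    then have "(LINT X|lborel. E X * indicator ?S X) * c = 0"
      by (simp add: mult.assoc[symmetric])
    then show ?thesis using c by simp
  qed
  have "AE X in lborel. snd X > \<delta> \<longrightarrow> E X = 0" if \<delta>: "\<delta> > 0" for \<delta>
  proof -
    define E' where "E' X = E X * indicator {X. snd X > \<delta>} X" for X
    have o: "open {X::R4. snd X > \<delta>}" by (intro open_Collect_less continuous_intros)
    then have [measurable]: "{X::R4. snd X > \<delta>} \<in> sets borel" by (rule borel_open)
    have "loc_integrable E'"
      unfolding loc_integrable_def
    proof (intro conjI allI)
      show "E' \<in> borel_measurable borel" unfolding E'_def by measurable
      fix R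
      have "integrable lborel (\<lambda>X. E X * (indicator {X. snd X > \<delta>} X * indicator (cball 0 R) X))"
        by (rule integrable_loc_bounded[OF E, of _ 1 R]) (auto simp: indicator_def)
      then show "integrable lborel (\<lambda>X. indicator (cball 0 R) X * E' X)" by (simp add: E'_def mult_ac)
    qed
    then have "AE X in lborel. E' X = 0"
    proof (rule AE_zero_if_box_integrals_zero)
      fix a b :: R4
      define p where "p = (fst a, max (snd a) \<delta>)"
      have "indicator {X. snd X > \<delta>} X * indicator (box a b) X = (indicator (box p b) X :: real)" for X :: R4
      proof -
        have "X \<in> box u v \<longleftrightarrow> fst X \<in> box (fst u) (fst v) \<and> snd u < snd X \<and> snd X < snd v" for u v :: R4
          by (cases X; cases u; cases v) (auto simp: box_def Basis_prod_def)
        then show ?thesis by (auto simp: indicator_def p_def)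
      qed
      then have "(LINT X|lborel. E' X * indicator (box a b) X) = (LINT X|lborel. E X * indicator (box p b) X)"
        unfolding E'_def by (simp only: mult.assoc)
      also have "\<dots> = 0" by (rule box0) (use \<delta> in \<open>simp add: p_def\<close>)
      finally show "(LINT X|lborel. E' X * indicator (box a b) X) = 0" .
    qed
    then show ?thesis by eventually_elim (auto simp: E'_def)
  qed
  then have "AE X in lborel. \<forall>n. snd X > inverse (real (Suc n)) \<longrightarrow> E X = 0"
    by (subst AE_all_countable) simp
  then show ?thesis
  proof eventually_elim
    fix X :: R4 assume "\<forall>n. snd X > inverse (real (Suc n)) \<longrightarrow> E X = 0"
    then show "snd X > 0 \<longrightarrow> E X = 0" using reals_Archimedean by blast
  qed
qed

section \<open>Finite differences\<close>

primrec seq_diff :: "nat \<Rightarrow> (nat \<Rightarrow> real) \<Rightarrow> nat \<Rightarrow> real" where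
  "seq_diff 0 s = s"
| "seq_diff (Suc m) s = seq_diff m (\<lambda>k. s (Suc k) - s k)"

lemma seq_diff_Suc: "seq_diff (Suc m) s k = seq_diff m s (Suc k) - seq_diff m s k"
proof (induction m arbitrary: s)
  case (Suc m)
  show ?case
    unfolding seq_diff.simps(2)[of "Suc m" s] seq_diff.simps(2)[of m s] by (rule Suc.IH)
qed simp

lemma seq_diff_uminus: "seq_diff m (\<lambda>k. - s k) k = - seq_diff m s k"
proof (induction m arbitrary: s)
  case (Suc m)
  have "(\<lambda>k. - s (Suc k) - - s k) = (\<lambda>k. - (s (Suc k) - s k))" by auto
  then show ?case using Suc[of "\<lambda>k. s (Suc k) - s k"] by simp
qed auto

lemma linear_growth_from_difference:
  fixes s :: "nat \<Rightarrow> real"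
  assumes d: "d > 0" and s: "\<And>k. k \<ge> K \<Longrightarrow> s (Suc k) - s k \<ge> d"
  shows "\<exists>K'. \<forall>k\<ge>K'. s k \<ge> d / 2 * real k"
proof -
  have ge: "s k \<ge> s K + d * (real k - real K)" if "k \<ge> K" for k
    using that
  proof (induction k rule: dec_induct)
    case (step k)
    then show ?case using s[of k] by (simp add: algebra_simps)
  qed simp
  obtain N :: nat where N: "2 * (d * K - s K) / d \<le> N" using real_arch_simple by blast
  have "s k \<ge> d / 2 * real k" if k: "k \<ge> max K N" for k
  proof -
    have "2 * (d * K - s K) / d \<le> real k" using N k by simp
    then have "2 * (d * K - s K) \<le> d * real k" using d by (simp add: divide_le_eq mult.commute)
    then show ?thesis using ge[of k] k by (simp add: algebra_simps)
  qed
  then show ?thesis by blast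
qed

lemma quadratic_growth_from_difference:
  fixes s :: "nat \<Rightarrow> real"
  assumes d: "d > 0" and s: "\<And>k. k \<ge> K \<Longrightarrow> s (Suc k) - s k \<ge> d * (2 * real k + 1)"
  shows "\<exists>K'. \<forall>k\<ge>K'. s k \<ge> d / 2 * (real k)\<^sup>2"
proof -
  have ge: "s k \<ge> s K + d * ((real k)\<^sup>2 - (real K)\<^sup>2)" if "k \<ge> K" for k
    using that
  proof (induction k rule: dec_induct)
    case (step k)
    then show ?case using s[of k] by (simp add: algebra_simps power2_eq_square)
  qed simp
  obtain N :: nat where N: "2 * (d * (real K)\<^sup>2 - s K) / d \<le> N" using real_arch_simple by blast
  have "s k \<ge> d / 2 * (real k)\<^sup>2" if k: "k \<ge> max (max K N) 1" for k
  proof -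
    have "2 * (d * (real K)\<^sup>2 - s K) / d \<le> real k" using N k by simp
    also have "real k \<le> (real k)\<^sup>2" using k by (simp add: power2_eq_square)
    finally have "2 * (d * (real K)\<^sup>2 - s K) \<le> d * (real k)\<^sup>2" using d by (simp add: divide_le_eq mult.commute)
    then show ?thesis using ge[of k] k by (simp add: algebra_simps)
  qed
  then show ?thesis by blast
qed

lemma quadratic_growth_from_seq_diff:
  assumes "r \<ge> 2" "d > 0" "\<And>k. k \<ge> K \<Longrightarrow> seq_diff r s k \<ge> d"
  shows "\<exists>e>0. \<exists>K. \<forall>k\<ge>K. s k \<ge> e * (real k)\<^sup>2"
  using assms
proof (induction r arbitrary: s d K rule: nat_induct_at_least)
  case base
  have "s (Suc (Suc k)) - s (Suc k) - (s (Suc k) - s k) \<ge> d" if "k \<ge> K" for k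
    using base(2)[OF that] by (simp add: numeral_2_eq_2)
  from linear_growth_from_difference[OF base(1), of K "\<lambda>k. s (Suc k) - s k", OF this]
  obtain K' where K': "\<And>k. k \<ge> K' \<Longrightarrow> s (Suc k) - s k \<ge> d / 2 * real k" by auto
  have "s (Suc k) - s k \<ge> d / 6 * (2 * real k + 1)" if "k \<ge> max K' 1" for k
  proof -
    have "d * 1 \<le> d * real k" using that base(1) by (intro mult_left_mono) auto
    then have "d / 6 * (2 * real k + 1) \<le> d / 2 * real k" by (simp add: field_simps)
    then show ?thesis using K'[of k] that by simp
  qed
  from quadratic_growth_from_difference[of "d / 6" "max K' 1" s, OF _ this] base(1)
  obtain K2 where "\<forall>k\<ge>K2. s k \<ge> d / 6 / 2 * (real k)\<^sup>2" by auto
  then show ?case using base(1) by (intro exI[of _ "d / 6 / 2"]) auto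
next
  case (Suc r)
  obtain e K' where e: "e > 0" "\<And>k. k \<ge> K' \<Longrightarrow> s (Suc k) - s k \<ge> e * (real k)\<^sup>2"
    using Suc.IH[of d K "\<lambda>k. s (Suc k) - s k"] Suc.prems by auto
  have "s (Suc k) - s k \<ge> e / 3 * (2 * real k + 1)" if k: "k \<ge> max K' 1" for k
  proof -
    have "2 * real k + 1 \<le> 3 * (real k)\<^sup>2"
    proof -
      have "real k \<ge> 1" using k by simp
      then have "real k * 1 \<le> real k * real k" by (intro mult_left_mono) auto
      then have "real k \<le> (real k)\<^sup>2" by (simp add: power2_eq_square)
      then show ?thesis using \<open>real k \<ge> 1\<close> by linarith
    qed
    then have "e / 3 * (2 * real k + 1) \<le> e / 3 * (3 * (real k)\<^sup>2)" using e(1) by (intro mult_left_mono) auto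
    then show ?thesis using e(2)[of k] k by simp
  qed
  from quadratic_growth_from_difference[of "e / 3" "max K' 1" s, OF _ this] e(1)
  obtain K2 where "\<forall>k\<ge>K2. s k \<ge> e / 3 / 2 * (real k)\<^sup>2" by auto
  then show ?case using e(1) by (intro exI[of _ "e / 3 / 2"]) auto
qed

lemma not_quadratic_growth:
  assumes lim: "(\<lambda>k. s k / (real k)\<^sup>2) \<longlonglongrightarrow> 0" and e: "e > 0" and s: "\<forall>k\<ge>K. s k \<ge> e * (real k)\<^sup>2"
  shows False
proof -
  have "\<forall>\<^sub>F k in sequentially. s k / (real k)\<^sup>2 < e" using order_tendstoD(2)[OF lim e] .
  then obtain N where N: "\<And>k. k \<ge> N \<Longrightarrow> s k / (real k)\<^sup>2 < e" by (auto simp: eventually_sequentially)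
  define k where "k = max (max K N) 1"
  have "s k / (real k)\<^sup>2 < e" using N[of k] by (simp add: k_def)
  moreover have "(real k)\<^sup>2 > 0" by (simp add: k_def)
  ultimately have "s k < e * (real k)\<^sup>2" by (simp add: divide_less_eq)
  moreover have "s k \<ge> e * (real k)\<^sup>2" using s by (simp add: k_def)
  ultimately show False by simp
qed

lemma second_difference_zero:
  assumes "\<And>k. seq_diff m s k = 0" and lim: "(\<lambda>k. s k / (real k)\<^sup>2) \<longlonglongrightarrow> 0"
  shows "s (Suc (Suc 0)) - 2 * s (Suc 0) + s 0 = 0"
  using assms(1)
proof (induction m)
  case 0
  then show ?case by simp
next
  case (Suc m)
  show ?case
  proof (cases "m \<ge> 2")
    case False
    then have "m = 0 \<or> m = 1" by auto
    then show ?thesis using Suc.prems[of 0] Suc.prems[of 1] by auto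
  next
    case True
    have const: "seq_diff m s k = seq_diff m s 0" for k
      by (induction k) (use Suc.prems seq_diff_Suc[of m s] in auto)
    have "seq_diff m s 0 = 0"
    proof (rule ccontr)
      assume "seq_diff m s 0 \<noteq> 0"
      then consider "seq_diff m s 0 > 0" | "seq_diff m (\<lambda>k. - s k) 0 > 0"
        by (auto simp: seq_diff_uminus neq_iff)
      then show False
      proof cases
        case 1
        have "seq_diff m s k \<ge> seq_diff m s 0" if "k \<ge> 0" for k using const[of k] by linarith
        from quadratic_growth_from_seq_diff[OF True 1 this]
        obtain e K where "e > 0" "\<forall>k\<ge>K. s k \<ge> e * (real k)\<^sup>2" by blast
        then show False using not_quadratic_growth[OF lim] by blast
      next
        case 2
        have "seq_diff m (\<lambda>k. - s k) k \<ge> seq_diff m (\<lambda>k. - s k) 0" if "k \<ge> 0" for k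
          unfolding seq_diff_uminus using const[of k] by linarith
        from quadratic_growth_from_seq_diff[OF True 2 this]
        obtain e K where "e > 0" "\<forall>k\<ge>K. - s k \<ge> e * (real k)\<^sup>2" by blast
        moreover have "(\<lambda>k. - s k / (real k)\<^sup>2) \<longlonglongrightarrow> 0" using tendsto_minus[OF lim] by simp
        ultimately show False using not_quadratic_growth[of "\<lambda>k. - s k"] by blast
      qed
    qed
    then have "seq_diff m s k = 0" for k using const by simp
    then show ?thesis by (rule Suc.IH)
  qed
qed

primrec fdiff :: "nat \<Rightarrow> real \<Rightarrow> (R4 \<Rightarrow> real) \<Rightarrow> R4 \<Rightarrow> real" where
  "fdiff 0 t f = f"
| "fdiff (Suc m) t f = fdiff m t (\<lambda>X. f (X + (0, t)) - f X)"

lemma fdiff_seq_diff: "fdiff m t f (X + (0, real k * t)) = seq_diff m (\<lambda>k. f (X + (0, real k * t))) k"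
proof (induction m arbitrary: f)
  case (Suc m)
  have eq: "X + (0, real k * t) + (0, t) = X + (0, real (Suc k) * t)" for k
    by (simp add: algebra_simps)
  show ?case unfolding fdiff.simps seq_diff.simps Suc[of "\<lambda>X. f (X + (0, t)) - f X"] eq ..
qed simp

lemma loc_integrable_fdiff: "loc_integrable f \<Longrightarrow> loc_integrable (fdiff m t f)"
  by (induction m arbitrary: f) (auto intro: loc_integrable_diff loc_integrable_translate)

lemma integral_fdiff_mollified:
  assumes f: "loc_integrable f" and [measurable]: "g \<in> borel_measurable borel"
    and g: "\<And>X. \<bar>g X\<bar> \<le> M" "\<And>X. norm X > R \<Longrightarrow> g X = 0"
  shows "(LINT X|lborel. fdiff m t f X * g (X - Y)) = fdiff m t (\<lambda>Y. LINT X|lborel. f X * g (X - Y)) Y"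
  using f
proof (induction m arbitrary: f Y)
  case (Suc m)
  have int: "integrable lborel (\<lambda>X. h X * g (X - Y))" if "loc_integrable h" for h Y
  proof (rule integrable_loc_bounded[OF that, of _ M "R + norm Y"])
    show "g (X - Y) = 0" if "norm X > R + norm Y" for X
      using that norm_triangle_sub[of X Y] by (intro g(2)) simp
  qed (use g(1) in auto)
  have [measurable]: "f \<in> borel_measurable borel" using Suc.prems by (rule loc_integrable_measurable)
  have t: "loc_integrable (\<lambda>X. f (X + (0, t)))" by (rule loc_integrable_translate[OF Suc.prems])
  have "(LINT X|lborel. (f (X + (0, t)) - f X) * g (X - Y))
     = (LINT X|lborel. f X * g (X - (Y + (0, t)))) - (LINT X|lborel. f X * g (X - Y))" for Y
  proof -
    have "(LINT X|lborel. (f (X + (0, t)) - f X) * g (X - Y))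
        = (LINT X|lborel. f (X + (0, t)) * g (X - Y) - f X * g (X - Y))"
      by (simp add: left_diff_distrib)
    also have "\<dots> = (LINT X|lborel. f (X + (0, t)) * g (X - Y)) - (LINT X|lborel. f X * g (X - Y))"
      by (rule Bochner_Integration.integral_diff[OF int[OF t] int[OF Suc.prems]])
    also have "(LINT X|lborel. f (X + (0, t)) * g (X - Y)) = (LINT X|lborel. f X * g (X - (Y + (0, t))))"
      using lborel_integral_translate(1)[of "\<lambda>X. f X * g (X - (Y + (0, t)))" "(0, t)"] by simp
    finally show ?thesis .
  qed
  then show ?case using Suc.IH[OF loc_integrable_diff[OF t Suc.prems]] by simp
qed simp

lemma fdiff_zero_if_derivative_zero:
  assumes der: "\<And>j Y. ((\<lambda>s. F j (Y + (0, s))) has_real_derivative c * F (Suc j) Y) (at 0)"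
    and zero: "\<And>Y. snd Y > \<epsilon> \<Longrightarrow> F m Y = 0" and t: "t > 0" and Y: "snd Y > \<epsilon>"
  shows "fdiff m t (F 0) Y = 0"
  using der zero Y
proof (induction m arbitrary: F Y)
  case (Suc m)
  define G where "G j Y = F j (Y + (0, t)) - F j Y" for j Y
  have dG: "((\<lambda>s. G j (Y + (0, s))) has_real_derivative c * G (Suc j) Y) (at 0)" for j Y
  proof -
    have "(\<lambda>s. G j (Y + (0, s))) = (\<lambda>s. F j ((Y + (0, t)) + (0, s)) - F j (Y + (0, s)))"
      by (simp add: G_def add_ac)
    then show ?thesis
      using DERIV_diff[OF Suc.prems(1)[of j "Y + (0, t)"] Suc.prems(1)[of j Y]]
      by (simp add: G_def right_diff_distrib)
  qed
  have "G m Y = 0" if Y: "snd Y > \<epsilon>" for Y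
  proof -
    have d: "((\<lambda>s. F m (Y + (0, s))) has_real_derivative c * F (Suc m) (Y + (0, z))) (at z)" for z
    proof -
      have "(\<lambda>s. F m ((Y + (0, z)) + (0, s))) = (\<lambda>s. F m (Y + (0, s + z)))" by (simp add: add_ac)
      then have "((\<lambda>s. F m (Y + (0, s + z))) has_real_derivative c * F (Suc m) (Y + (0, z))) (at 0)"
        using Suc.prems(1)[of m "Y + (0, z)"] by simp
      then show ?thesis using DERIV_shift[of "\<lambda>s. F m (Y + (0, s))" _ 0 z] by simp
    qed
    obtain z where z: "z > 0" "F m (Y + (0, t)) - F m (Y + (0, 0)) = (t - 0) * (c * F (Suc m) (Y + (0, z)))"
      using MVT2[OF t, of "\<lambda>s. F m (Y + (0, s))", OF d] by auto
    have "F (Suc m) (Y + (0, z)) = 0" by (rule Suc.prems(2)) (use z Y in simp)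
    with z show ?thesis by (simp add: G_def zero_prod_def[symmetric])
  qed
  from Suc.IH[of G, OF dG this Suc.prems(3)] show ?case by (simp add: G_def[abs_def])
qed simp

lemma second_difference_tendsto:
  assumes f: "\<And>v. (f has_real_derivative f1 v) (at v)" and f1: "(f1 has_real_derivative d) (at y)"
    and h: "\<And>k. h k > 0" "h \<longlonglongrightarrow> 0"
  shows "(\<lambda>k. (f y - 2 * f (y - h k) + f (y - 2 * h k)) / (h k)\<^sup>2) \<longlonglongrightarrow> d"
proof -
  obtain g where g: "\<And>z. f1 z - f1 y = g z * (z - y)" "isCont g y" "g y = d"
    using f1 unfolding CARAT_DERIV by auto
  have "\<exists>\<xi>. y - h k < \<xi> \<and> \<xi> < y \<and> f y - 2 * f (y - h k) + f (y - 2 * h k) = h k * (f1 \<xi> - f1 (\<xi> - h k))" for k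
  proof -
    have d: "((\<lambda>v. f v - f (v - h k)) has_real_derivative f1 v - f1 (v - h k)) (at v)" for v
    proof -
      have "((\<lambda>v. f (v + - h k)) has_real_derivative f1 (v + - h k)) (at v)"
        using f[of "v + - h k"] DERIV_shift by blast
      then show ?thesis using DERIV_diff[OF f[of v]] by simp
    qed
    have "y - h k < y" using h(1) by simp
    from MVT2[OF this, of "\<lambda>v. f v - f (v - h k)", OF d]
    obtain z where z: "y - h k < z" "z < y"
      "f y - f (y - h k) - (f (y - h k) - f (y - h k - h k)) = (y - (y - h k)) * (f1 z - f1 (z - h k))" by auto
    have "y - h k - h k = y - 2 * h k" by simp
    with z show ?thesis by (intro exI[of _ z]) (simp add: algebra_simps)
  qed
  then obtain \<xi> where \<xi>: "\<And>k. y - h k < \<xi> k" "\<And>k. \<xi> k < y"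
    "\<And>k. f y - 2 * f (y - h k) + f (y - 2 * h k) = h k * (f1 (\<xi> k) - f1 (\<xi> k - h k))"
    by metis
  have yh: "(\<lambda>k. y - h k) \<longlonglongrightarrow> y" using tendsto_diff[OF tendsto_const[of y] h(2)] by simp
  have \<xi>y: "\<xi> \<longlonglongrightarrow> y"
    by (rule tendsto_sandwich[OF always_eventually always_eventually yh tendsto_const])
       (use \<xi> less_imp_le in blast)+
  then have \<xi>h: "(\<lambda>k. \<xi> k - h k) \<longlonglongrightarrow> y" using tendsto_diff[OF _ h(2)] by fastforce
  have g1: "(\<lambda>k. g (\<xi> k) - d) \<longlonglongrightarrow> 0" "(\<lambda>k. g (\<xi> k - h k) - d) \<longlonglongrightarrow> 0"
    using isCont_tendsto_compose[OF g(2) \<xi>y] isCont_tendsto_compose[OF g(2) \<xi>h] g(3)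
    by (auto intro: LIM_zero)
  have "(\<lambda>k. (f y - 2 * f (y - h k) + f (y - 2 * h k)) / (h k)\<^sup>2 - d) \<longlonglongrightarrow> 0"
  proof (rule Lim_null_comparison[OF always_eventually, rule_format])
    show "(\<lambda>k. \<bar>g (\<xi> k) - d\<bar> + 2 * \<bar>g (\<xi> k - h k) - d\<bar>) \<longlonglongrightarrow> 0"
      using tendsto_add[OF tendsto_rabs_zero[OF g1(1)] tendsto_mult[OF tendsto_const[of 2] tendsto_rabs_zero[OF g1(2)]]] by simp
    fix k
    have hk: "h k > 0" by (rule h)
    have "f1 (\<xi> k) - f1 (\<xi> k - h k) = g (\<xi> k) * (\<xi> k - y) - g (\<xi> k - h k) * (\<xi> k - h k - y)"
      using g(1)[of "\<xi> k"] g(1)[of "\<xi> k - h k"] by linarith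
    also have "\<dots> = (g (\<xi> k) - d) * (\<xi> k - y) - (g (\<xi> k - h k) - d) * (\<xi> k - h k - y) + d * h k"
      by (simp add: algebra_simps)
    finally have "(f y - 2 * f (y - h k) + f (y - 2 * h k)) / (h k)\<^sup>2 - d
       = ((g (\<xi> k) - d) * (\<xi> k - y) - (g (\<xi> k - h k) - d) * (\<xi> k - h k - y)) / h k"
    proof -
      assume A: "f1 (\<xi> k) - f1 (\<xi> k - h k) = (g (\<xi> k) - d) * (\<xi> k - y) - (g (\<xi> k - h k) - d) * (\<xi> k - h k - y) + d * h k"
      show ?thesis unfolding \<xi>(3) A using hk by (simp add: add_divide_distrib power2_eq_square)
    qed
    also have "\<bar>\<dots>\<bar> \<le> (\<bar>g (\<xi> k) - d\<bar> * h k + \<bar>g (\<xi> k - h k) - d\<bar> * (2 * h k)) / h k"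
    proof -
      have a: "\<bar>\<xi> k - y\<bar> \<le> h k" "\<bar>\<xi> k - h k - y\<bar> \<le> 2 * h k" using \<xi>(1,2)[of k] by auto
      have "\<bar>(g (\<xi> k) - d) * (\<xi> k - y) - (g (\<xi> k - h k) - d) * (\<xi> k - h k - y)\<bar>
          \<le> \<bar>g (\<xi> k) - d\<bar> * \<bar>\<xi> k - y\<bar> + \<bar>g (\<xi> k - h k) - d\<bar> * \<bar>\<xi> k - h k - y\<bar>"
        unfolding abs_mult[symmetric] by (rule abs_triangle_ineq4)
      also have "\<dots> \<le> \<bar>g (\<xi> k) - d\<bar> * h k + \<bar>g (\<xi> k - h k) - d\<bar> * (2 * h k)"
        using a by (intro add_mono mult_left_mono) auto
      finally show ?thesis using hk by (simp add: divide_right_mono)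
    qed
    also have "\<dots> = \<bar>g (\<xi> k) - d\<bar> + 2 * \<bar>g (\<xi> k - h k) - d\<bar>"
      using hk by (simp add: add_divide_distrib)
    finally show "norm ((f y - 2 * f (y - h k) + f (y - 2 * h k)) / (h k)\<^sup>2 - d) \<le> \<bar>g (\<xi> k) - d\<bar> + 2 * \<bar>g (\<xi> k - h k) - d\<bar>"
      by simp
  qed
  then show ?thesis by (rule LIM_zero_cancel)
qed

text \<open>Cutting \<open>f\<close> off at \<open>0\<close> keeps it of class \<open>C\<^sup>1\<^sup>,\<^sup>1\<close>, whence the uniform bound.\<close>

lemma truncated_second_difference_bound:
  assumes f: "\<And>v. (f has_real_derivative f1 v) (at v)" and L: "\<And>u v. \<bar>f1 u - f1 v\<bar> \<le> L * \<bar>u - v\<bar>"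
    and f0: "f 0 = 0" "f1 0 = 0" and h: "h > 0"
  defines "\<sigma> \<equiv> \<lambda>y::real. if y > 0 then f y else (0::real)"
  shows "\<bar>\<sigma> y\<bar> \<le> L * y\<^sup>2" "\<bar>\<sigma> y - 2 * \<sigma> (y - h) + \<sigma> (y - 2 * h)\<bar> \<le> 16 * L * h\<^sup>2"
proof -
  have L0: "L \<ge> 0" using L[of 1 0] by simp
  show q: "\<bar>\<sigma> y\<bar> \<le> L * y\<^sup>2" for y
  proof (cases "y > 0")
    case True
    obtain z where z: "0 < z" "z < y" "f y - f 0 = (y - 0) * f1 z" using MVT2[OF True, of f f1] f by auto
    have "\<bar>f1 z\<bar> \<le> L * z" using L[of z 0] z f0 by simp
    also have "\<dots> \<le> L * y" using z L0 by (intro mult_left_mono) auto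
    finally have "y * \<bar>f1 z\<bar> \<le> y * (L * y)" using True by (intro mult_left_mono) auto
    then show ?thesis using True z f0 by (simp add: \<sigma>_def abs_mult power2_eq_square mult_ac)
  qed (use L0 in \<open>simp add: \<sigma>_def\<close>)
  show "\<bar>\<sigma> y - 2 * \<sigma> (y - h) + \<sigma> (y - 2 * h)\<bar> \<le> 16 * L * h\<^sup>2"
  proof (cases "y > 2 * h")
    case True
    have d: "((\<lambda>v. f v - f (v - h)) has_real_derivative f1 v - f1 (v - h)) (at v)" for v
    proof -
      have "((\<lambda>v. f (v + - h)) has_real_derivative f1 (v + - h)) (at v)"
        using f[of "v + - h"] DERIV_shift by blast
      then show ?thesis using DERIV_diff[OF f[of v]] by simp
    qed
    have "y - h < y" using h by simp
    from MVT2[OF this, of "\<lambda>v. f v - f (v - h)", OF d]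
    obtain z where z: "f y - f (y - h) - (f (y - h) - f (y - h - h)) = (y - (y - h)) * (f1 z - f1 (z - h))" by auto
    have "\<bar>h * (f1 z - f1 (z - h))\<bar> \<le> h * (L * h)"
      unfolding abs_mult using L[of z "z - h"] h by (intro mult_mono) auto
    moreover have "y - h - h = y - 2 * h" by simp
    moreover have "\<sigma> y - 2 * \<sigma> (y - h) + \<sigma> (y - 2 * h) = f y - 2 * f (y - h) + f (y - 2 * h)"
      using True h by (simp add: \<sigma>_def)
    ultimately have "\<bar>\<sigma> y - 2 * \<sigma> (y - h) + \<sigma> (y - 2 * h)\<bar> \<le> L * h\<^sup>2"
      using z by (simp add: power2_eq_square algebra_simps)
    also have "\<dots> \<le> 16 * L * h\<^sup>2" using L0 by simp
    finally show ?thesis .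
  next
    case False
    have b: "\<bar>\<sigma> v\<bar> \<le> L * (4 * h\<^sup>2)" if "v \<le> 2 * h" for v
    proof (cases "v > 0")
      case True
      have "v\<^sup>2 \<le> (2 * h)\<^sup>2" using True that by (intro power_mono) auto
      then have "L * v\<^sup>2 \<le> L * (4 * h\<^sup>2)" using L0 by (intro mult_left_mono) (auto simp: power_mult_distrib)
      then show ?thesis using q[of v] by linarith
    qed (use L0 in \<open>simp add: \<sigma>_def\<close>)
    show ?thesis using b[of y] b[of "y - h"] b[of "y - 2 * h"] False h by (auto simp: abs_le_iff)
  qed
qed

section \<open>Uniqueness\<close>

lemma Cc_infinityI:
  assumes "smooth f" "\<And>X. norm X > R \<Longrightarrow> f X = 0"
  shows "f \<in> Cc_infinity UNIV"
proof -
  have "bounded {X. f X \<noteq> 0}"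
    unfolding bounded_iff using assms(2) by (intro exI[of _ R]) (force simp: not_less[symmetric])
  then show ?thesis using assms(1) by (simp add: Cc_infinity_def compact_closure)
qed

lemma laplacian_product_coordinates:
  fixes \<zeta> :: "real^3 \<Rightarrow> real" and \<kappa> :: "real \<Rightarrow> real"
  assumes \<zeta>: "smooth \<zeta>" and \<kappa>: "smooth \<kappa>"
  shows "smooth (\<lambda>X::R4. \<zeta> (fst X) * \<kappa> (snd X))"
    and "laplacian (\<lambda>X::R4. \<zeta> (fst X) * \<kappa> (snd X))
       = (\<lambda>X. laplacian \<zeta> (fst X) * \<kappa> (snd X) + \<zeta> (fst X) * pderiv_dir 1 (pderiv_dir 1 \<kappa>) (snd X))"
    and "pderiv_dir e\<^sub>y (\<lambda>X::R4. \<zeta> (fst X) * \<kappa> (snd X)) = (\<lambda>X. \<zeta> (fst X) * pderiv_dir 1 \<kappa> (snd X))"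
proof -
  have F: "pderiv_dir b (\<lambda>X::R4. f (fst X)) = (\<lambda>X. pderiv_dir (fst b) f (fst X))" if "smooth f" for b and f :: "real^3 \<Rightarrow> real"
    using pderiv_dir_affine[OF bounded_linear_fst smooth_imp_differentiable[OF that], of b 0] by simp
  have S: "pderiv_dir b (\<lambda>X::R4. f (snd X)) = (\<lambda>X. pderiv_dir (snd b) f (snd X))" if "smooth f" for b and f :: "real \<Rightarrow> real"
    using pderiv_dir_affine[OF bounded_linear_snd smooth_imp_differentiable[OF that], of b 0] by simp
  have lin0: "pderiv_dir 0 f x = 0" if "smooth f" for f :: "'z::euclidean_space \<Rightarrow> real" and x
    using smooth_has_derivative[OF that] has_derivative_bounded_linear bounded_linear.linear linear_0 by blast
  have sF: "smooth (\<lambda>X::R4. f (fst X))" if "smooth f" for f :: "real^3 \<Rightarrow> real"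
    by (rule smooth_linear[OF that bounded_linear_fst])
  have sS: "smooth (\<lambda>X::R4. f (snd X))" if "smooth f" for f :: "real \<Rightarrow> real"
    by (rule smooth_linear[OF that bounded_linear_snd])
  show "smooth (\<lambda>X::R4. \<zeta> (fst X) * \<kappa> (snd X))" by (rule smooth_mult[OF sF[OF \<zeta>] sS[OF \<kappa>]])
  have l\<zeta>: "laplacian (\<lambda>X::R4. \<zeta> (fst X)) = (\<lambda>X. laplacian \<zeta> (fst X))"
    by (rule ext) (simp add: laplacian_def sum_Basis_R4 F \<zeta> smooth_pderiv lin0)
  have l\<kappa>: "laplacian (\<lambda>X::R4. \<kappa> (snd X)) = (\<lambda>X. pderiv_dir 1 (pderiv_dir 1 \<kappa>) (snd X))"
    by (rule ext) (simp add: laplacian_def sum_Basis_R4 S \<kappa> smooth_pderiv lin0)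
  show "laplacian (\<lambda>X::R4. \<zeta> (fst X) * \<kappa> (snd X))
       = (\<lambda>X. laplacian \<zeta> (fst X) * \<kappa> (snd X) + \<zeta> (fst X) * pderiv_dir 1 (pderiv_dir 1 \<kappa>) (snd X))"
    unfolding laplacian_mult[OF sF[OF \<zeta>] sS[OF \<kappa>]] l\<zeta> l\<kappa>
    by (rule ext) (simp add: sum_Basis_R4 F S \<zeta> \<kappa> lin0)
  show "pderiv_dir e\<^sub>y (\<lambda>X::R4. \<zeta> (fst X) * \<kappa> (snd X)) = (\<lambda>X. \<zeta> (fst X) * pderiv_dir 1 \<kappa> (snd X))"
    unfolding pderiv_dir_mult[OF smooth_imp_differentiable[OF sF[OF \<zeta>]] smooth_imp_differentiable[OF sS[OF \<kappa>]]]
    by (rule ext) (simp add: F S \<zeta> \<kappa> lin0)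
qed

definition cut_power :: "nat \<Rightarrow> nat \<Rightarrow> real \<Rightarrow> real" where
  "cut_power k j = (pderiv_dir 1 ^^ j) (\<lambda>y. y ^ k / fact k * cutoff y)"

lemma smooth_cut_power: "smooth (cut_power k j)"
  unfolding cut_power_def
proof (induction j)
  case 0
  show ?case by (auto intro!: smooth_intros)
qed (auto intro: smooth_pderiv)

lemma cut_power_Suc: "cut_power k (Suc j) = pderiv_dir 1 (cut_power k j)"
  by (simp add: cut_power_def)

lemma cut_power_has_real_derivative: "(cut_power k j has_real_derivative cut_power k (Suc j) y) (at y)"
  unfolding cut_power_Suc by (rule smooth_has_real_derivative[OF smooth_cut_power])

lemma cut_power_outside: "\<bar>y\<bar> > 2 \<Longrightarrow> cut_power k j y = 0"
proof (induction j arbitrary: y)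
  case 0
  then show ?case by (simp add: cut_power_def cutoff_0)
next
  case (Suc j)
  show ?case unfolding cut_power_Suc by (rule pderiv_dir_outside[of 2]) (use Suc in auto)
qed

lemma cut_power_near_0: "\<bar>y\<bar> < 1 \<Longrightarrow> cut_power k j y = (if j \<le> k then y ^ (k - j) / fact (k - j) else 0)"
proof (induction j arbitrary: y)
  case 0
  then show ?case by (simp add: cut_power_def cutoff_1)
next
  case (Suc j)
  have "((\<lambda>y. if j \<le> k then y ^ (k - j) / fact (k - j) else 0) has_real_derivative
     (if Suc j \<le> k then y ^ (k - Suc j) / fact (k - Suc j) else 0)) (at y)"
  proof (cases "Suc j \<le> k")
    case True
    then obtain i where i: "k - j = Suc i" "k - Suc j = i" by (metis Suc_diff_Suc Suc_le_lessD)
    have "((\<lambda>y. y ^ Suc i / fact (Suc i)) has_real_derivative real (Suc i) * y ^ i / fact (Suc i)) (at y)"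
      using DERIV_cdivide[OF DERIV_pow[of "Suc i" y]] by (simp only: diff_Suc_Suc diff_zero)
    also have "real (Suc i) * y ^ i / fact (Suc i) = y ^ i / fact i"
      by (simp only: fact_Suc of_nat_mult mult_divide_mult_cancel_left of_nat_eq_0_iff nat.simps not_False_eq_True)
    finally show ?thesis using True by (simp only: i if_True Suc_leD)
  qed (cases "j \<le> k"; auto)
  then have "(cut_power k j has_real_derivative (if Suc j \<le> k then y ^ (k - Suc j) / fact (k - Suc j) else 0)) (at y)"
    by (rule has_field_derivative_transform_within_open[of _ _ _ "{- 1<..<1}"]) (use Suc in auto)
  then show ?case unfolding cut_power_Suc by (rule pderiv_dir_real_eq)
qed

lemma cut_power_Lipschitz: "\<exists>L. \<forall>u v. \<bar>cut_power k j u - cut_power k j v\<bar> \<le> L * \<bar>u - v\<bar>"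
proof -
  obtain L where L: "\<And>y. \<bar>pderiv_dir 1 (cut_power k j) y\<bar> \<le> L"
  proof -
    have "pderiv_dir 1 (cut_power k j) y = 0" if "norm y > 2" for y
      using cut_power_outside[of y k "Suc j"] that by (simp add: cut_power_Suc)
    from continuous_compact_support_bound[OF smooth_imp_continuous[OF smooth_pderiv[OF smooth_cut_power]] this, where p = 0]
    show ?thesis using that by auto
  qed
  have "\<bar>cut_power k j u - cut_power k j v\<bar> \<le> L * \<bar>u - v\<bar>" for u v
    using smooth_difference_bound[OF smooth_cut_power L, of v "u - v"] by simp
  then show ?thesis by blast
qed

definition pos_square :: "real \<Rightarrow> real \<Rightarrow> real" where
  "pos_square c y = (max 0 (c - y))\<^sup>2 / 2"

lemma pos_square_has_real_derivative: "(pos_square c has_real_derivative - max 0 (c - y)) (at y)"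
proof -
  consider "y < c" | "y > c" | "y = c" by linarith
  then show ?thesis
  proof cases
    case 1
    have "((\<lambda>y. (c - y)\<^sup>2 / 2) has_real_derivative - max 0 (c - y)) (at y)"
      using 1 by (auto intro!: derivative_eq_intros)
    then show ?thesis
      by (rule has_field_derivative_transform_within_open[of _ _ _ "{..<c}"]) (use 1 in \<open>auto simp: pos_square_def\<close>)
  next
    case 2
    have "((\<lambda>y. 0) has_real_derivative - max 0 (c - y)) (at y)" using 2 by simp
    then show ?thesis
      by (rule has_field_derivative_transform_within_open[of _ _ _ "{c<..}"]) (use 2 in \<open>auto simp: pos_square_def\<close>)
  next
    case 3
    have "((\<lambda>h. (pos_square c (c + h) - pos_square c c) / h) \<longlongrightarrow> 0) (at 0)"
    proof (rule Lim_null_comparison[OF always_eventually, rule_format])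
      show "((\<lambda>h::real. \<bar>h\<bar>) \<longlongrightarrow> 0) (at 0)" by (rule tendsto_rabs_zero) simp
      show "norm ((pos_square c (c + h) - pos_square c c) / h) \<le> \<bar>h\<bar>" for h
        by (auto simp: pos_square_def max_def power2_eq_square)
    qed
    then show ?thesis by (simp add: DERIV_def 3)
  qed
qed

lemma AE_lborel_translates:
  fixes a :: "nat \<Rightarrow> 'a::euclidean_space"
  assumes "AE X in lborel. P X"
  shows "AE X in lborel. \<forall>k. P (X + a k)"
proof -
  obtain N where N: "N \<in> null_sets lborel" "{X. \<not> P X} \<subseteq> N"
    using assms unfolding eventually_ae_filter by auto
  have [measurable]: "N \<in> sets borel" using N(1) by (auto simp: null_sets_def)
  have "AE X in lborel. a k + X \<notin> N" for k
    by (rule AE_lborel_translate[OF _ AE_not_in[OF N(1)]]) measurable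
  then have "AE X in lborel. \<forall>k. a k + X \<notin> N" by (subst AE_all_countable) blast
  then show ?thesis by eventually_elim (use N(2) in \<open>auto simp: add.commute\<close>)
qed

locale null_solution =
  fixes D :: "R4 \<Rightarrow> real" and C :: real and n :: nat
  assumes D_measurable [measurable]: "D \<in> borel_measurable borel"
    and D_bound: "\<bar>D X\<bar> \<le> C * (1 + norm X) ^ n"
    and D_zero: "snd X \<le> 0 \<Longrightarrow> D X = 0"
    and D_weak: "\<phi> \<in> boundary_test_functions \<Longrightarrow> (LINT X|lborel. D X * laplacian (laplacian \<phi>) X) = 0"
    and D_limit: "t > 0 \<Longrightarrow> AE X in lborel. snd X > 0 \<longrightarrow> (\<lambda>k. D (X + (0, real k * t)) / (real k)\<^sup>2) \<longlonglongrightarrow> 0"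
begin

lemma D_loc_integrable: "loc_integrable D"
  by (rule loc_integrable_bounded[OF D_measurable D_bound])

lemma weak_decaying:
  assumes \<phi>: "decays (n + 8) \<phi>" and bc: "\<And>x. \<phi> (x, 0) = 0" "\<And>x. pderiv_dir e\<^sub>y \<phi> (x, 0) = 0"
  shows "(LINT X|lborel. D X * laplacian (laplacian \<phi>) X) = 0"
proof -
  let ?four = "Suc (Suc (Suc (Suc 0)))"
  have sm: "smooth \<phi>" by (rule decays_smooth[OF \<phi>])
  obtain C1 where C1: "deriv_bound ?four 0 C1 (cutoff :: R4 \<Rightarrow> real)"
    using decays_compact_support[OF smooth_cutoff, of 2 0] cutoff_0 unfolding decays_def by blast
  obtain C2 where C2: "deriv_bound ?four (n + 8) C2 \<phi>" using \<phi> unfolding decays_def by blast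
  define s where "s k = inverse (real (Suc k))" for k
  have s: "s k > 0" "\<bar>s k\<bar> \<le> 1" for k by (auto simp: s_def inverse_le_1_iff)
  define \<eta> :: "nat \<Rightarrow> R4 \<Rightarrow> real" where "\<eta> k X = cutoff (s k *\<^sub>R X)" for k X
  have \<eta>: "smooth (\<eta> k)" for k unfolding \<eta>_def by (intro smooth_scale smooth_cutoff)
  have \<eta>0: "\<eta> k X = 0" if "norm X > 2 * real (Suc k)" for k X
    unfolding \<eta>_def using that by (intro cutoff_0) (simp add: s_def field_simps)
  have \<eta>1: "\<eta> k X = 1" if "norm X \<le> real (Suc k)" for k X
    unfolding \<eta>_def using that by (intro cutoff_1) (simp add: s_def field_simps)
  define B where "B = 4 * (4 * (2 ^ ?four * (C1 * C2)))"
  have bound: "\<bar>laplacian (laplacian (\<lambda>X. \<eta> k X * \<phi> X)) X\<bar> * (1 + norm X) ^ (n + 2 * DIM(R4)) \<le> B" for k X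
  proof -
    have "deriv_bound ?four 0 C1 (\<eta> k)" unfolding \<eta>_def by (rule deriv_bound_scale[OF s(2) C1])
    from deriv_bound_bound[OF deriv_bound_laplacian[OF deriv_bound_laplacian[OF deriv_bound_mult[OF this C2]]], of X]
    show ?thesis by (simp add: B_def)
  qed
  have test: "(\<lambda>X. \<eta> k X * \<phi> X) \<in> boundary_test_functions" for k
    unfolding boundary_test_functions_def
  proof (intro CollectI conjI allI)
    show "(\<lambda>X. \<eta> k X * \<phi> X) \<in> Cc_infinity UNIV"
      by (rule Cc_infinityI[OF smooth_mult[OF \<eta> sm], of "2 * real (Suc k)"]) (simp only: \<eta>0 mult_zero_left)
    show "\<eta> k (x, 0) * \<phi> (x, 0) = 0" for x by (simp add: bc)
    show "pderiv_dir e\<^sub>y (\<lambda>X. \<eta> k X * \<phi> X) (x, 0) = 0" for x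
      by (simp add: pderiv_dir_mult[OF smooth_imp_differentiable[OF \<eta>] smooth_imp_differentiable[OF sm]] bc)
  qed
  have meas: "laplacian (laplacian f) \<in> borel_measurable borel" if "smooth f" for f :: "R4 \<Rightarrow> real"
    by (rule smooth_imp_measurable[OF smooth_laplacian[OF smooth_laplacian[OF that]]])
  have "(\<lambda>k. LINT X|lborel. D X * laplacian (laplacian (\<lambda>X. \<eta> k X * \<phi> X)) X) \<longlonglongrightarrow> (LINT X|lborel. D X * laplacian (laplacian \<phi>) X)"
  proof (rule integral_dominated_convergence[where w = "\<lambda>X. C * B * inverse ((1 + norm X) ^ (2 * DIM(R4)))"])
    show "integrable lborel (\<lambda>X::R4. C * B * inverse ((1 + norm X) ^ (2 * DIM(R4))))"
      by (intro integrable_mult_right integrable_norm_power)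
    show "AE X in lborel. norm (D X * laplacian (laplacian (\<lambda>X. \<eta> k X * \<phi> X)) X) \<le> C * B * inverse ((1 + norm X) ^ (2 * DIM(R4)))" for k
      unfolding real_norm_def
      by (rule AE_I2, rule integrable_growth_mult_decay(2)[OF D_measurable meas D_bound bound])
        (rule smooth_mult[OF \<eta> sm])
    show "AE X in lborel. (\<lambda>k. D X * laplacian (laplacian (\<lambda>X. \<eta> k X * \<phi> X)) X) \<longlonglongrightarrow> D X * laplacian (laplacian \<phi>) X"
    proof (rule AE_I2)
      fix X :: R4
      obtain m :: nat where m: "norm X < m" using reals_Archimedean2 by blast
      have "laplacian (laplacian (\<lambda>X. \<eta> k X * \<phi> X)) X = laplacian (laplacian \<phi>) X" if k: "k \<ge> m" for k
      proof (rule laplacian_cong_open[OF open_ball, of _ 0 "real m"])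
        show "X \<in> ball 0 (real m)" using m by simp
        fix Y :: R4 assume Y: "Y \<in> ball 0 (real m)"
        show "laplacian (\<lambda>X. \<eta> k X * \<phi> X) Y = laplacian \<phi> Y"
          by (rule laplacian_cong_open[OF open_ball Y]) (use k in \<open>auto simp: \<eta>1\<close>)
      qed
      then have "\<forall>\<^sub>F k in sequentially. D X * laplacian (laplacian (\<lambda>X. \<eta> k X * \<phi> X)) X = D X * laplacian (laplacian \<phi>) X"
        by (intro eventually_sequentiallyI[of m]) simp
      then show "(\<lambda>k. D X * laplacian (laplacian (\<lambda>X. \<eta> k X * \<phi> X)) X) \<longlonglongrightarrow> D X * laplacian (laplacian \<phi>) X"
        by (rule tendsto_eventually)
    qed
  qed (use meas[OF sm] meas[OF smooth_mult[OF \<eta> sm]] in simp_all)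
  then show ?thesis unfolding D_weak[OF test] using LIMSEQ_unique tendsto_const by blast
qed

lemma weak_reflected:
  assumes \<psi>: "decays (n + 10) \<psi>" and bih: "\<And>X. snd X < 0 \<Longrightarrow> laplacian (laplacian \<psi>) X = 0"
  shows "(LINT X|lborel. D X * laplacian (laplacian \<psi>) X) = 0"
proof -
  have sm: "smooth \<psi>" by (rule decays_smooth[OF \<psi>])
  have "(LINT X|lborel. D X * laplacian (laplacian (dirichlet_correction \<psi>)) X) = 0"
  proof (rule weak_decaying[OF decays_dirichlet_correction dirichlet_correction_boundary[OF sm]])
    have "Suc (Suc (n + 8)) = n + 10" by simp
    with \<psi> show "decays (Suc (Suc (n + 8))) \<psi>" by (simp only:)
  qed
  moreover have "D X * laplacian (laplacian (dirichlet_correction \<psi>)) X = D X * laplacian (laplacian \<psi>) X" for X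
    using D_zero[of X] bilaplacian_dirichlet_correction[OF sm bih, of X] by (cases "snd X > 0") (auto simp: half_space_def)
  ultimately show ?thesis by simp
qed

definition bump_dy :: "nat \<Rightarrow> R4 \<Rightarrow> real" where
  "bump_dy j = (pderiv_dir e\<^sub>y ^^ j) bump"

lemma smooth_bump_dy: "smooth (bump_dy j)"
  unfolding bump_dy_def by (induction j) (auto intro: smooth_bump smooth_pderiv)

lemma bump_dy_outside: "norm X > 1 \<Longrightarrow> bump_dy j X = 0"
  unfolding bump_dy_def by (induction j arbitrary: X) (auto intro: bump_outside pderiv_dir_outside[of 1])

lemma mollified_derivative_zero:
  assumes \<epsilon>: "\<epsilon> > 0" and Y: "snd Y > \<epsilon>"
  shows "(LINT X|lborel. D X * bump_dy (n + 10) (inverse \<epsilon> *\<^sub>R (X - Y))) = 0"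
proof -
  define m where "m = n + 10"
  define G where "G j = (pderiv_dir e\<^sub>y ^^ j) log_reg" for j
  have G: "smooth (G j)" for j
    unfolding G_def by (induction j) (auto intro: smooth_log_reg smooth_pderiv)
  have lG: "laplacian (laplacian (G j)) = bump_dy j" for j
  proof (induction j)
    case (Suc j)
    have "laplacian (laplacian (G (Suc j))) = laplacian (pderiv_dir e\<^sub>y (laplacian (G j)))"
      using laplacian_pderiv_commute[OF G[of j]] by (simp add: G_def)
    also have "\<dots> = pderiv_dir e\<^sub>y (laplacian (laplacian (G j)))"
      by (rule laplacian_pderiv_commute[OF smooth_laplacian[OF G]])
    finally show ?case by (simp add: Suc bump_dy_def)
  qed (simp add: G_def bump_dy_def bump_def)
  have Gd: "decays m (G m)" unfolding G_def by (rule decays_log_reg_derivative) (simp add: m_def)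
  define i where "i = inverse \<epsilon>"
  have i: "i > 0" "i * \<epsilon> = 1" using \<epsilon> by (auto simp: i_def)
  define a where "a = - (i *\<^sub>R Y)"
  have aff: "a + i *\<^sub>R X = i *\<^sub>R (X - Y)" for X by (simp add: a_def scaleR_diff_right)
  have L: "bounded_linear (\<lambda>X::R4. i *\<^sub>R X)" by (rule bounded_linear_scaleR_right)
  define \<psi> where "\<psi> X = G m (a + i *\<^sub>R X)" for X
  have lsc: "laplacian (\<lambda>X. f (a + i *\<^sub>R X)) = (\<lambda>X. i\<^sup>2 * laplacian f (a + i *\<^sub>R X))" if "smooth f" for f
    using laplacian_affine_scale[OF L, of "\<lambda>_. i" "i\<^sup>2" f a] that by simp
  have l\<psi>: "laplacian (laplacian \<psi>) X = i ^ 4 * bump_dy m (i *\<^sub>R (X - Y))" for X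
  proof -
    have "laplacian (laplacian \<psi>) = (\<lambda>X. i\<^sup>2 * (i\<^sup>2 * laplacian (laplacian (G m)) (a + i *\<^sub>R X)))"
      unfolding \<psi>_def lsc[OF G] laplacian_cmult[OF smooth_affine[OF smooth_laplacian[OF G] L]] lsc[OF smooth_laplacian[OF G]] ..
    then show ?thesis by (simp add: lG aff power_numeral_reduce)
  qed
  have "decays m \<psi>"
    unfolding \<psi>_def
  proof (rule decays_affine[OF L _ Gd, where K = "1 + \<epsilon> + norm Y"])
    fix X :: R4
    have "X = \<epsilon> *\<^sub>R (i *\<^sub>R (X - Y)) + Y" using i by (simp add: mult.commute)
    then have "norm X \<le> \<epsilon> * norm (i *\<^sub>R (X - Y)) + norm Y"
      using norm_triangle_ineq[of "\<epsilon> *\<^sub>R (i *\<^sub>R (X - Y))" Y] \<epsilon> by (metis abs_of_pos norm_scaleR)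
    then show "1 + norm X \<le> (1 + \<epsilon> + norm Y) * (1 + norm (a + i *\<^sub>R X))"
    proof -
      define q where "q = norm (i *\<^sub>R (X - Y))"
      assume "norm X \<le> \<epsilon> * norm (i *\<^sub>R (X - Y)) + norm Y"
      then have "norm X \<le> \<epsilon> * q + norm Y" by (simp only: q_def)
      moreover have "q \<ge> 0" "norm Y * q \<ge> 0" by (simp_all add: q_def)
      ultimately have "1 + norm X \<le> (1 + \<epsilon> + norm Y) * (1 + q)"
        using \<epsilon> unfolding distrib_left distrib_right mult_1_left mult_1_right by linarith
      then show ?thesis unfolding aff q_def .
    qed
  qed
  moreover have "laplacian (laplacian \<psi>) X = 0" if X: "snd X < 0" for X
  proof -
    have "\<epsilon> < \<bar>snd (X - Y)\<bar>" using X Y by simp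
    also have "\<dots> \<le> norm (X - Y)" using norm_snd_le[of "snd (X - Y)" "fst (X - Y)"] unfolding prod.collapse real_norm_def .
    finally have "norm (i *\<^sub>R (X - Y)) > 1" using i \<epsilon> unfolding norm_scaleR by (simp add: i_def field_simps)
    then show ?thesis unfolding l\<psi> by (simp add: bump_dy_outside)
  qed
  ultimately have "(LINT X|lborel. D X * laplacian (laplacian \<psi>) X) = 0"
    unfolding m_def by (rule weak_reflected)
  then have "i ^ 4 * (LINT X|lborel. D X * bump_dy m (i *\<^sub>R (X - Y))) = 0"
    unfolding l\<psi> by (subst integral_mult_right_zero[symmetric]) (simp add: mult_ac)
  then show ?thesis using i by (simp add: m_def i_def)
qed

lemma fdiff_zero:
  assumes t: "t > 0"
  shows "AE X in lborel. snd X > 0 \<longrightarrow> fdiff (n + 10) t D X = 0"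
proof (rule AE_zero_if_mollification_zero[OF loc_integrable_fdiff[OF D_loc_integrable]])
  fix \<epsilon> :: real and Y :: R4
  assume \<epsilon>: "\<epsilon> > 0" and Y: "snd Y > \<epsilon>"
  define i where "i = inverse \<epsilon>"
  have i: "i > 0" using \<epsilon> by (simp add: i_def)
  define F where "F j Y = (LINT X|lborel. D X * bump_dy j (i *\<^sub>R (X - Y)))" for j Y
  have F: "((\<lambda>s. F j (Y + (0, s))) has_real_derivative (- i) * F (Suc j) Y) (at 0)" for j Y
  proof -
    define a where "a = - (i *\<^sub>R Y)"
    have aff: "a + i *\<^sub>R X = i *\<^sub>R (X - Y)" for X by (simp add: a_def scaleR_diff_right)
    have L: "bounded_linear (\<lambda>X::R4. i *\<^sub>R X)" by (rule bounded_linear_scaleR_right)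
    define f where "f X = bump_dy j (a + i *\<^sub>R X)" for X
    have f: "smooth f" unfolding f_def by (rule smooth_affine[OF smooth_bump_dy L])
    have f0: "f X = 0" if "norm X > norm Y + \<epsilon>" for X
    proof -
      have "norm (X - Y) > \<epsilon>" using that norm_triangle_sub[of X Y] by linarith
      then have "norm (i *\<^sub>R (X - Y)) > 1" using \<epsilon> unfolding norm_scaleR by (simp add: i_def field_simps)
      then show ?thesis by (simp add: f_def aff bump_dy_outside)
    qed
    have lin: "linear (\<lambda>v. pderiv_dir v (bump_dy j) Z)" for Z
      using smooth_has_derivative[OF smooth_bump_dy] has_derivative_bounded_linear bounded_linear.linear by blast
    have df: "pderiv_dir (- e\<^sub>y) f X = - i * bump_dy (Suc j) (i *\<^sub>R (X - Y))" for X
    proof -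
      have "pderiv_dir (- e\<^sub>y) f X = pderiv_dir ((- i) *\<^sub>R e\<^sub>y) (bump_dy j) (a + i *\<^sub>R X)"
        unfolding f_def pderiv_dir_affine[OF L smooth_imp_differentiable[OF smooth_bump_dy]] by simp
      also have "\<dots> = (- i) * pderiv_dir e\<^sub>y (bump_dy j) (a + i *\<^sub>R X)"
        unfolding linear_scale[OF lin] by simp
      finally show ?thesis by (simp add: aff bump_dy_def)
    qed
    have "((\<lambda>s. LINT X|lborel. D X * f (X + s *\<^sub>R (- e\<^sub>y))) has_real_derivative
           (LINT X|lborel. D X * pderiv_dir (- e\<^sub>y) f X)) (at 0)"
      by (rule has_real_derivative_integral_translate[OF D_loc_integrable f f0])
    moreover have "(LINT X|lborel. D X * pderiv_dir (- e\<^sub>y) f X) = (- i) * F (Suc j) Y"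
      unfolding F_def df by (subst integral_mult_right_zero[symmetric]) (simp add: mult_ac)
    moreover have "f (X + s *\<^sub>R (- e\<^sub>y)) = bump_dy j (i *\<^sub>R (X - (Y + (0, s))))" for X s
    proof -
      have "X + s *\<^sub>R (- e\<^sub>y) - Y = X - (Y + (0, s))" by (simp add: prod_eq_iff)
      then show ?thesis by (simp only: f_def aff)
    qed
    ultimately show ?thesis by (simp only: F_def)
  qed
  have Fm: "F (n + 10) Y = 0" if "snd Y > \<epsilon>" for Y
    unfolding F_def i_def by (rule mollified_derivative_zero[OF \<epsilon> that])
  obtain M where M: "\<And>X. \<bar>bump X\<bar> \<le> M"
    using continuous_compact_support_bound[of bump 1 0] bump_outside smooth_imp_continuous[OF smooth_bump] by auto
  have "(LINT X|lborel. fdiff (n + 10) t D X * bump (i *\<^sub>R (X - Y))) = fdiff (n + 10) t (\<lambda>Y. LINT X|lborel. D X * bump (i *\<^sub>R (X - Y))) Y"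
  proof (rule integral_fdiff_mollified[OF D_loc_integrable])
    show "(\<lambda>X. bump (i *\<^sub>R X)) \<in> borel_measurable borel"
      by (intro smooth_imp_measurable smooth_scale smooth_bump)
    show "\<bar>bump (i *\<^sub>R X)\<bar> \<le> M" for X by (rule M)
    show "bump (i *\<^sub>R X) = 0" if "norm X > \<epsilon>" for X
      using that \<epsilon> by (intro bump_outside) (simp add: i_def field_simps)
  qed
  also have "(\<lambda>Y. LINT X|lborel. D X * bump (i *\<^sub>R (X - Y))) = F 0"
    by (simp add: F_def bump_dy_def fun_eq_iff)
  also have "fdiff (n + 10) t (F 0) Y = 0"
    by (rule fdiff_zero_if_derivative_zero[OF F Fm t Y])
  finally show "(LINT X|lborel. fdiff (n + 10) t D X * bump (inverse \<epsilon> *\<^sub>R (X - Y))) = 0" by (simp add: i_def)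
qed

lemma second_fdiff_zero:
  assumes t: "t > 0"
  shows "AE X in lborel. snd X > 0 \<longrightarrow> D (X + (0, 2 * t)) - 2 * D (X + (0, t)) + D X = 0"
proof -
  have "AE X in lborel. \<forall>k. snd (X + (0, real k * t)) > 0 \<longrightarrow> fdiff (n + 10) t D (X + (0, real k * t)) = 0"
    by (rule AE_lborel_translates[OF fdiff_zero[OF t]])
  with D_limit[OF t] show ?thesis
  proof eventually_elim
    fix X :: R4
    assume lim: "snd X > 0 \<longrightarrow> (\<lambda>k. D (X + (0, real k * t)) / (real k)\<^sup>2) \<longlonglongrightarrow> 0" and X: "\<forall>k. snd (X + (0, real k * t)) > 0 \<longrightarrow> fdiff (n + 10) t D (X + (0, real k * t)) = 0"
    show "snd X > 0 \<longrightarrow> D (X + (0, 2 * t)) - 2 * D (X + (0, t)) + D X = 0"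
    proof
      assume pos: "snd X > 0"
      have "seq_diff (n + 10) (\<lambda>k. D (X + (0, real k * t))) k = 0" for k
      proof -
        have "snd (X + (0, real k * t)) > 0" using pos t by (simp add: add_pos_nonneg)
        then have "fdiff (n + 10) t D (X + (0, real k * t)) = 0" using X by blast
        then show ?thesis unfolding fdiff_seq_diff .
      qed
      from second_difference_zero[OF this] lim pos
      show "D (X + (0, 2 * t)) - 2 * D (X + (0, t)) + D X = 0" by (simp add: zero_prod_def[symmetric])
    qed
  qed
qed

end

lemma smooth_compact_support_bounded:
  assumes "smooth f" "\<And>x. norm x > R \<Longrightarrow> f x = 0"
  shows "\<exists>M. \<forall>x. \<bar>f x\<bar> \<le> M"
  using continuous_compact_support_bound[of f R 0] assms smooth_imp_continuous by auto

lemma AE_snd_notin_finite: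
  assumes "finite S"
  shows "AE X::R4 in lborel. snd X \<notin> S"
proof -
  have "AE X::R4 in lborel. snd X \<noteq> s" for s
  proof -
    have "negligible {X::R4. X \<bullet> e\<^sub>y = s}" by (rule negligible_standard_hyperplane[OF e\<^sub>y_Basis])
    then have "AE X::R4 in lebesgue. snd X \<noteq> s"
      unfolding negligible_iff_null_sets inner_e\<^sub>y using AE_not_in by fastforce
    then show ?thesis by (subst (asm) AE_completion_iff) auto
  qed
  then have "AE X::R4 in lborel. \<forall>s\<in>S. snd X \<noteq> s" unfolding AE_finite_all[OF assms] by (intro ballI)
  then show ?thesis by eventually_elim auto
qed

context null_solution
begin

lemma D_cball_integrable: "integrable lborel (\<lambda>X. indicator (cball 0 R) X * D X)"
  using D_loc_integrable by (simp add: loc_integrable_def)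

lemma second_derivative_test_zero:
  assumes [measurable]: "\<zeta> \<in> borel_measurable borel" and \<zeta>: "\<And>x. \<bar>\<zeta> x\<bar> \<le> M" "\<And>x. norm x > R \<Longrightarrow> \<zeta> x = 0"
    and f: "\<And>v. (f has_real_derivative f1 v) (at v)" and L: "\<And>u v. \<bar>f1 u - f1 v\<bar> \<le> L * \<bar>u - v\<bar>"
    and f0: "f 0 = 0" "f1 0 = 0" and fB: "\<And>y. y > B \<Longrightarrow> f y = 0"
    and S: "finite S" and f2: "\<And>y. y > 0 \<Longrightarrow> y \<notin> S \<Longrightarrow> (f1 has_real_derivative f2 y) (at y)"
    and [measurable]: "f2 \<in> borel_measurable borel"
  shows "(LINT X|lborel. D X * (\<zeta> (fst X) * f2 (snd X))) = 0"
proof -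
  have L0: "L \<ge> 0" using L[of 1 0] by simp
  have M0: "M \<ge> 0" using \<zeta>(1)[of 0] by simp
  have [measurable]: "f \<in> borel_measurable borel"
    using f by (intro borel_measurable_continuous_onI DERIV_continuous_on) (blast intro: has_field_derivative_at_within)
  define \<sigma> where "\<sigma> y = (if y > 0 then f y else 0)" for y
  note \<sigma>_bound = truncated_second_difference_bound[OF f L f0, folded \<sigma>_def]
  have [measurable]: "\<sigma> \<in> borel_measurable borel" unfolding \<sigma>_def by measurable
  define G where "G X = \<zeta> (fst X) * \<sigma> (snd X)" for X :: R4
  have [measurable]: "G \<in> borel_measurable borel" unfolding G_def by measurable
  have G_bound: "\<bar>G X\<bar> \<le> M * (L * B\<^sup>2)" for X
  proof -
    have "\<bar>\<sigma> y\<bar> \<le> L * B\<^sup>2" for y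
    proof (cases "0 < y \<and> y \<le> B")
      case True
      then have "L * y\<^sup>2 \<le> L * B\<^sup>2" using L0 by (intro mult_left_mono power_mono) auto
      then show ?thesis using \<sigma>_bound(1)[of 1 y] by simp
    qed (use L0 fB in \<open>auto simp: \<sigma>_def\<close>)
    then show ?thesis unfolding G_def abs_mult using \<zeta>(1) M0 by (intro mult_mono) auto
  qed
  have G_outside: "G X = 0" if "norm X > \<bar>R\<bar> + \<bar>B\<bar>" for X
  proof (rule ccontr)
    assume "G X \<noteq> 0"
    then have "\<not> norm (fst X) > R" "\<not> snd X > B" "snd X > 0"
      using \<zeta>(2)[of "fst X"] fB[of "snd X"] by (auto simp: G_def \<sigma>_def split: if_splits)
    then show False using that norm_Pair_le[of "fst X" "snd X"] by simp
  qed
  have G_outside_h: "G (X - (0, c)) = 0" if "norm X > \<bar>R\<bar> + \<bar>B\<bar> + \<bar>c\<bar>" for X c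
  proof (rule G_outside)
    have "norm ((0, c) :: R4) = \<bar>c\<bar>" by (simp add: norm_Pair)
    then show "norm (X - (0, c)) > \<bar>R\<bar> + \<bar>B\<bar>" using that norm_triangle_ineq2[of X "(0, c)"] by linarith
  qed
  have int: "integrable lborel (\<lambda>X. D X * G (X - (0, c)))" for c
  proof (rule integrable_loc_bounded[OF D_loc_integrable])
    show "(\<lambda>X. G (X - (0, c))) \<in> borel_measurable borel" by measurable
    show "\<bar>G (X - (0, c))\<bar> \<le> M * (L * B\<^sup>2)" for X by (rule G_bound)
    show "G (X - (0, c)) = 0" if "norm X > \<bar>R\<bar> + \<bar>B\<bar> + \<bar>c\<bar>" for X by (rule G_outside_h[OF that])
  qed
  have shift: "(LINT X|lborel. D X * G (X - (0, c))) = (LINT X|lborel. D (X + (0, c)) * G X)"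
    "integrable lborel (\<lambda>X. D (X + (0, c)) * G X)" for c
    using lborel_integral_translate[of "\<lambda>X. D X * G (X - (0, c))" "(0, c)"] int[of c] by simp_all
  define P where "P h X = G X - 2 * G (X - (0, h)) + G (X - (0, 2 * h))" for h X
  have [measurable]: "P h \<in> borel_measurable borel" for h unfolding P_def by measurable
  have P_zero: "(LINT X|lborel. D X * P h X) = 0" if h: "h > 0" for h
  proof -
    have int0: "integrable lborel (\<lambda>X. D X * G X)" using int[of 0] by (simp add: zero_prod_def[symmetric])
    have "(LINT X|lborel. D X * P h X)
        = (LINT X|lborel. D X * G X - 2 * (D X * G (X - (0, h))) + D X * G (X - (0, 2 * h)))"
      by (simp add: P_def algebra_simps)
    also have "\<dots> = (LINT X|lborel. D X * G X) - 2 * (LINT X|lborel. D X * G (X - (0, h))) + (LINT X|lborel. D X * G (X - (0, 2 * h)))"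
      using int0 int by simp
    also have "\<dots> = (LINT X|lborel. D X * G X - 2 * (D (X + (0, h)) * G X) + D (X + (0, 2 * h)) * G X)"
      unfolding shift(1) using int0 shift(2) by simp
    also have "\<dots> = 0"
    proof (rule integral_eq_zero_AE)
      show "AE X in lborel. D X * G X - 2 * (D (X + (0, h)) * G X) + D (X + (0, 2 * h)) * G X = 0"
        using second_fdiff_zero[OF h]
      proof eventually_elim
        fix X assume X: "snd X > 0 \<longrightarrow> D (X + (0, 2 * h)) - 2 * D (X + (0, h)) + D X = 0"
        have "D X * G X - 2 * (D (X + (0, h)) * G X) + D (X + (0, 2 * h)) * G X
            = (D (X + (0, 2 * h)) - 2 * D (X + (0, h)) + D X) * G X" by (simp add: algebra_simps)
        then show "D X * G X - 2 * (D (X + (0, h)) * G X) + D (X + (0, 2 * h)) * G X = 0"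
          using X by (cases "snd X > 0") (auto simp: G_def \<sigma>_def)
      qed
    qed
    finally show ?thesis .
  qed
  define h where "h k = inverse (real (Suc k))" for k
  have h: "h k > 0" "h k \<le> 1" for k by (auto simp: h_def inverse_le_1_iff)
  have h_lim: "h \<longlonglongrightarrow> 0" unfolding h_def[abs_def] by (rule LIMSEQ_inverse_real_of_nat)
  define Q where "Q = \<bar>R\<bar> + \<bar>B\<bar> + 2"
  have "(\<lambda>k. LINT X|lborel. D X * (P (h k) X / (h k)\<^sup>2)) \<longlonglongrightarrow> (LINT X|lborel. D X * (\<zeta> (fst X) * f2 (snd X)))"
  proof (rule integral_dominated_convergence[where w = "\<lambda>X. \<bar>indicator (cball 0 Q) X * D X\<bar> * (M * (16 * L))"])
    show "integrable lborel (\<lambda>X. \<bar>indicator (cball 0 Q) X * D X\<bar> * (M * (16 * L)))"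
      by (intro integrable_mult_left integrable_abs D_cball_integrable)
    show "AE X in lborel. norm (D X * (P (h k) X / (h k)\<^sup>2)) \<le> \<bar>indicator (cball 0 Q) X * D X\<bar> * (M * (16 * L))" for k
    proof (rule AE_I2)
      fix X :: R4
      have P_eq: "P (h k) X = \<zeta> (fst X) * (\<sigma> (snd X) - 2 * \<sigma> (snd X - h k) + \<sigma> (snd X - 2 * h k))"
        by (simp add: P_def G_def algebra_simps)
      have "\<bar>P (h k) X\<bar> \<le> M * (16 * L * (h k)\<^sup>2)"
        unfolding P_eq abs_mult using \<zeta>(1) M0 \<sigma>_bound(2)[OF h(1)] by (intro mult_mono) auto
      then have P_bound: "\<bar>P (h k) X / (h k)\<^sup>2\<bar> \<le> M * (16 * L)"
        using h(1)[of k] by (simp add: field_simps)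
      show "norm (D X * (P (h k) X / (h k)\<^sup>2)) \<le> \<bar>indicator (cball 0 Q) X * D X\<bar> * (M * (16 * L))"
      proof (cases "norm X \<le> Q")
        case True
        then show ?thesis using mult_left_mono[OF P_bound, of "\<bar>D X\<bar>"] by (simp add: abs_mult)
      next
        case False
        have "G X = 0" by (rule G_outside) (use False in \<open>simp add: Q_def\<close>)
        moreover have "G (X - (0, h k)) = 0" "G (X - (0, 2 * h k)) = 0"
          using False h[of k] by (intro G_outside_h; simp add: Q_def)+
        ultimately show ?thesis using False by (simp add: P_def)
      qed
    qed
    show "AE X in lborel. (\<lambda>k. D X * (P (h k) X / (h k)\<^sup>2)) \<longlonglongrightarrow> D X * (\<zeta> (fst X) * f2 (snd X))"
      using AE_snd_notin_finite[OF S]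
    proof eventually_elim
      fix X :: R4 assume X: "snd X \<notin> S"
      show "(\<lambda>k. D X * (P (h k) X / (h k)\<^sup>2)) \<longlonglongrightarrow> D X * (\<zeta> (fst X) * f2 (snd X))"
      proof (cases "snd X > 0")
        case True
        define y where "y = snd X"
        have "(\<lambda>k. (f y - 2 * f (y - h k) + f (y - 2 * h k)) / (h k)\<^sup>2) \<longlonglongrightarrow> f2 y"
          by (rule second_difference_tendsto[OF f f2 h(1) h_lim]) (use True X in \<open>simp_all add: y_def\<close>)
        then have "(\<lambda>k. D X * (\<zeta> (fst X) * ((f y - 2 * f (y - h k) + f (y - 2 * h k)) / (h k)\<^sup>2))) \<longlonglongrightarrow> D X * (\<zeta> (fst X) * f2 y)"
          by (intro tendsto_mult_left)
        moreover have "\<forall>\<^sub>F k in sequentially. D X * (\<zeta> (fst X) * ((f y - 2 * f (y - h k) + f (y - 2 * h k)) / (h k)\<^sup>2)) = D X * (P (h k) X / (h k)\<^sup>2)"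
        proof (rule eventually_mono)
          show "\<forall>\<^sub>F k in sequentially. h k < y / 2"
            using order_tendstoD(2)[OF h_lim, of "y / 2"] True by (simp add: y_def)
          fix k assume "h k < y / 2"
          then have "\<sigma> y = f y" "\<sigma> (y - h k) = f (y - h k)" "\<sigma> (y - 2 * h k) = f (y - 2 * h k)"
            using True h(1)[of k] by (auto simp: \<sigma>_def y_def)
          then have "P (h k) X = \<zeta> (fst X) * (f y - 2 * f (y - h k) + f (y - 2 * h k))"
            by (simp add: P_def G_def y_def algebra_simps)
          then show "D X * (\<zeta> (fst X) * ((f y - 2 * f (y - h k) + f (y - 2 * h k)) / (h k)\<^sup>2)) = D X * (P (h k) X / (h k)\<^sup>2)"
            by simp
        qed
        ultimately show ?thesis unfolding y_def by (rule Lim_transform_eventually)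
      qed (simp add: D_zero)
    qed
  qed measurable
  moreover have "(LINT X|lborel. D X * (P (h k) X / (h k)\<^sup>2)) = 0" for k
    using P_zero[OF h(1)[of k]] by simp
  ultimately have "(\<lambda>k::nat. 0) \<longlonglongrightarrow> (LINT X|lborel. D X * (\<zeta> (fst X) * f2 (snd X)))" by (simp only:)
  then show ?thesis by (rule LIMSEQ_unique[OF _ tendsto_const])
qed

lemma product_integrable:
  assumes \<zeta>: "smooth \<zeta>" "\<And>x. norm x > R \<Longrightarrow> \<zeta> x = 0"
    and [measurable]: "g \<in> borel_measurable borel" and g: "\<And>y. \<bar>g y\<bar> \<le> K" "\<And>y. \<bar>y\<bar> > B \<Longrightarrow> g y = 0"
  shows "integrable lborel (\<lambda>X. D X * (\<zeta> (fst X) * g (snd X)))"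
proof -
  have [measurable]: "\<zeta> \<in> borel_measurable borel" by (rule smooth_imp_measurable[OF \<zeta>(1)])
  obtain M where M: "\<And>x. \<bar>\<zeta> x\<bar> \<le> M"
    using smooth_compact_support_bounded[OF \<zeta>(1), of R] \<zeta>(2) by blast
  show ?thesis
  proof (rule integrable_loc_bounded[OF D_loc_integrable])
    show "(\<lambda>X. \<zeta> (fst X) * g (snd X)) \<in> borel_measurable borel" by measurable
    show "\<bar>\<zeta> (fst X) * g (snd X)\<bar> \<le> M * K" for X
      unfolding abs_mult using M[of 0] by (intro mult_mono M g(1)) auto
    show "\<zeta> (fst X) * g (snd X) = 0" if X: "norm X > \<bar>R\<bar> + \<bar>B\<bar>" for X
    proof (rule ccontr)
      assume "\<zeta> (fst X) * g (snd X) \<noteq> 0"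
      then have "\<not> norm (fst X) > R" "\<not> \<bar>snd X\<bar> > B" using \<zeta>(2) g(2) by auto
      then show False using X norm_Pair_le[of "fst X" "snd X"] by simp
    qed
  qed
qed

lemma cut_power_bound: "\<exists>K. \<forall>y. \<bar>cut_power k j y\<bar> \<le> K"
  using smooth_compact_support_bounded[OF smooth_cut_power, of 2] cut_power_outside by auto

lemma product_cut_power_integrable:
  assumes "smooth \<zeta>" "\<And>x. norm x > R \<Longrightarrow> \<zeta> x = 0"
  shows "integrable lborel (\<lambda>X. D X * (\<zeta> (fst X) * cut_power k j (snd X)))"
proof -
  obtain K where "\<And>y. \<bar>cut_power k j y\<bar> \<le> K" using cut_power_bound by blast
  from product_integrable[OF assms smooth_imp_measurable[OF smooth_cut_power] this cut_power_outside]
  show ?thesis .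
qed

lemma product_cut_power_zero:
  assumes \<zeta>: "smooth \<zeta>" "\<And>x. norm x > R \<Longrightarrow> \<zeta> x = 0" and k: "k \<ge> 4"
  shows "(LINT X|lborel. D X * (\<zeta> (fst X) * cut_power k 6 (snd X))) = 0"
proof -
  have cp0: "cut_power k j 0 = 0" if "j < 4" for j using cut_power_near_0[of 0 k j] k that by simp
  have A: "(LINT X|lborel. D X * (\<xi> (fst X) * cut_power k (Suc (Suc j)) (snd X))) = 0"
    if \<xi>: "smooth \<xi>" "\<And>x. norm x > R \<Longrightarrow> \<xi> x = 0" and j: "j < 3" for \<xi> j
  proof -
    obtain M where M: "\<And>x. \<bar>\<xi> x\<bar> \<le> M"
      using smooth_compact_support_bounded[OF \<xi>(1), of R] \<xi>(2) by blast
    obtain L where L: "\<And>u v. \<bar>cut_power k (Suc j) u - cut_power k (Suc j) v\<bar> \<le> L * \<bar>u - v\<bar>"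
      using cut_power_Lipschitz by blast
    show ?thesis
    proof (rule second_derivative_test_zero[where R = R and B = 2 and S = "{}" and f = "cut_power k j" and ?f1.0 = "cut_power k (Suc j)" and L = L and M = M])
      show "\<xi> \<in> borel_measurable borel" by (rule smooth_imp_measurable[OF \<xi>(1)])
      show "cut_power k (Suc (Suc j)) \<in> borel_measurable borel" by (rule smooth_imp_measurable[OF smooth_cut_power])
    qed (use j in \<open>auto simp: cp0 \<xi>(2) cut_power_outside intro: M L cut_power_has_real_derivative\<close>)
  qed
  let ?\<phi> = "\<lambda>X::R4. \<zeta> (fst X) * cut_power k 2 (snd X)"
  note pc = laplacian_product_coordinates
  have dd: "pderiv_dir 1 (pderiv_dir 1 (cut_power k j)) = cut_power k (Suc (Suc j))" for j
    by (simp add: cut_power_Suc)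
  have num: "Suc (Suc 2) = (4::nat)" "Suc (Suc 4) = (6::nat)" "Suc (Suc 0) = (2::nat)" by simp_all
  have l\<zeta>: "laplacian \<zeta> x = 0" if "norm x > R" for x by (rule laplacian_outside[OF \<zeta>(2) that])
  have ll\<zeta>: "laplacian (laplacian \<zeta>) x = 0" if "norm x > R" for x by (rule laplacian_outside[OF l\<zeta> that])
  have test: "?\<phi> \<in> boundary_test_functions"
    unfolding boundary_test_functions_def
  proof (intro CollectI conjI allI)
    show "?\<phi> \<in> Cc_infinity UNIV"
    proof (rule Cc_infinityI[OF pc(1)[OF \<zeta>(1) smooth_cut_power]])
      fix X :: R4 assume X: "norm X > R + 2"
      show "\<zeta> (fst X) * cut_power k 2 (snd X) = 0"
      proof (rule ccontr)
        assume "\<zeta> (fst X) * cut_power k 2 (snd X) \<noteq> 0"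
        then have "\<not> norm (fst X) > R" "\<not> \<bar>snd X\<bar> > 2" using \<zeta>(2) cut_power_outside by auto
        then show False using X norm_Pair_le[of "fst X" "snd X"] by simp
      qed
    qed
    show "?\<phi> (x, 0) = 0" for x using cp0[of 2] by simp
    show "pderiv_dir e\<^sub>y ?\<phi> (x, 0) = 0" for x
      using cp0[of "Suc 2"] unfolding pc(3)[OF \<zeta>(1) smooth_cut_power] cut_power_Suc by simp
  qed
  have lap: "laplacian ?\<phi> = (\<lambda>X. laplacian \<zeta> (fst X) * cut_power k 2 (snd X) + \<zeta> (fst X) * cut_power k 4 (snd X))"
    unfolding pc(2)[OF \<zeta>(1) smooth_cut_power] dd num ..
  have "laplacian (laplacian ?\<phi>) = (\<lambda>X. laplacian (laplacian \<zeta>) (fst X) * cut_power k 2 (snd X)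
      + laplacian \<zeta> (fst X) * cut_power k 4 (snd X) + (laplacian \<zeta> (fst X) * cut_power k 4 (snd X) + \<zeta> (fst X) * cut_power k 6 (snd X)))"
    unfolding lap laplacian_add[OF pc(1)[OF smooth_laplacian[OF \<zeta>(1)] smooth_cut_power] pc(1)[OF \<zeta>(1) smooth_cut_power]]
      pc(2)[OF \<zeta>(1) smooth_cut_power] pc(2)[OF smooth_laplacian[OF \<zeta>(1)] smooth_cut_power] dd num ..
  then have "0 = (LINT X|lborel. D X * (laplacian (laplacian \<zeta>) (fst X) * cut_power k 2 (snd X))
      + 2 * (D X * (laplacian \<zeta> (fst X) * cut_power k 4 (snd X))) + D X * (\<zeta> (fst X) * cut_power k 6 (snd X)))"
    using D_weak[OF test] by (simp add: algebra_simps)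
  also have "\<dots> = (LINT X|lborel. D X * (laplacian (laplacian \<zeta>) (fst X) * cut_power k 2 (snd X)))
      + 2 * (LINT X|lborel. D X * (laplacian \<zeta> (fst X) * cut_power k 4 (snd X))) + (LINT X|lborel. D X * (\<zeta> (fst X) * cut_power k 6 (snd X)))"
    using product_cut_power_integrable[OF \<zeta>] product_cut_power_integrable[OF smooth_laplacian[OF \<zeta>(1)] l\<zeta>]
      product_cut_power_integrable[OF smooth_laplacian[OF smooth_laplacian[OF \<zeta>(1)]] ll\<zeta>] by simp
  finally show ?thesis
    using A[OF smooth_laplacian[OF smooth_laplacian[OF \<zeta>(1)]] ll\<zeta>, of 0] A[OF smooth_laplacian[OF \<zeta>(1)] l\<zeta>, of 2] by (simp add: num)
qed

text \<open>The difference of the two half-squares has the indicator as second derivative; cut-off powers of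
  degree four and five correct its Cauchy data at \<open>0\<close> without contributing to the integral.\<close>

lemma slab_test_zero:
  assumes \<zeta>: "smooth \<zeta>" "\<And>x. norm x > R \<Longrightarrow> \<zeta> x = 0" and ab: "0 \<le> a" "a < b"
  shows "(LINT X|lborel. D X * (\<zeta> (fst X) * indicator {a<..<b} (snd X))) = 0"
proof -
  define q0 where "q0 = pos_square b 0 - pos_square a 0"
  define q1 where "q1 = max 0 (a - 0) - max 0 (b - 0)"
  define f where "f y = pos_square b y - pos_square a y - q0 * cut_power 4 4 y - q1 * cut_power 5 4 y" for y
  define f1 where "f1 y = max 0 (a - y) - max 0 (b - y) - q0 * cut_power 4 5 y - q1 * cut_power 5 5 y" for y
  define f2 where "f2 y = indicator {a<..<b} y - q0 * cut_power 4 6 y - q1 * cut_power 5 6 y" for y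
  obtain M where M: "\<And>x. \<bar>\<zeta> x\<bar> \<le> M"
    using smooth_compact_support_bounded[OF \<zeta>(1), of R] \<zeta>(2) by blast
  obtain L4 where L4: "\<And>u v. \<bar>cut_power 4 5 u - cut_power 4 5 v\<bar> \<le> L4 * \<bar>u - v\<bar>" using cut_power_Lipschitz by blast
  obtain L5 where L5: "\<And>u v. \<bar>cut_power 5 5 u - cut_power 5 5 v\<bar> \<le> L5 * \<bar>u - v\<bar>" using cut_power_Lipschitz by blast
  have cp_der: "(cut_power k 4 has_real_derivative cut_power k 5 y) (at y)" "(cut_power k 5 has_real_derivative cut_power k 6 y) (at y)" for k y
    using cut_power_has_real_derivative[of k 4 y] cut_power_has_real_derivative[of k 5 y] by simp_all
  have [measurable]: "cut_power k j \<in> borel_measurable borel" for k j by (rule smooth_imp_measurable[OF smooth_cut_power])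
  have "(LINT X|lborel. D X * (\<zeta> (fst X) * f2 (snd X))) = 0"
  proof (rule second_derivative_test_zero[OF smooth_imp_measurable[OF \<zeta>(1)] M \<zeta>(2), where S = "{a, b}" and B = "max b 2"])
    show "(f has_real_derivative f1 v) (at v)" for v
    proof -
      have "((\<lambda>y. pos_square b y - pos_square a y - q0 * cut_power 4 4 y - q1 * cut_power 5 4 y) has_real_derivative
          - max 0 (b - v) - - max 0 (a - v) - q0 * cut_power 4 5 v - q1 * cut_power 5 5 v) (at v)"
        by (intro DERIV_diff DERIV_cmult pos_square_has_real_derivative cp_der)
      then show ?thesis unfolding f_def[abs_def] f1_def by (simp add: algebra_simps)
    qed
    show "\<bar>f1 u - f1 v\<bar> \<le> (2 + \<bar>q0\<bar> * L4 + \<bar>q1\<bar> * L5) * \<bar>u - v\<bar>" for u v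
    proof -
      have "\<bar>q0 * cut_power 4 5 u - q0 * cut_power 4 5 v\<bar> \<le> \<bar>q0\<bar> * (L4 * \<bar>u - v\<bar>)"
        unfolding right_diff_distrib[symmetric] abs_mult by (intro mult_left_mono L4) simp
      moreover have "\<bar>q1 * cut_power 5 5 u - q1 * cut_power 5 5 v\<bar> \<le> \<bar>q1\<bar> * (L5 * \<bar>u - v\<bar>)"
        unfolding right_diff_distrib[symmetric] abs_mult by (intro mult_left_mono L5) simp
      moreover have hinge: "\<bar>max 0 (c - u) - max 0 (c - v)\<bar> \<le> \<bar>u - v\<bar>" for c :: real by linarith
      moreover have "f1 u - f1 v = (max 0 (a - u) - max 0 (a - v)) - (max 0 (b - u) - max 0 (b - v))
          - (q0 * cut_power 4 5 u - q0 * cut_power 4 5 v) - (q1 * cut_power 5 5 u - q1 * cut_power 5 5 v)"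
        by (simp add: f1_def)
      moreover have "\<bar>w - x - y - z\<bar> \<le> \<bar>w\<bar> + \<bar>x\<bar> + \<bar>y\<bar> + \<bar>z\<bar>" for w x y z :: real by linarith
      ultimately have "\<bar>f1 u - f1 v\<bar> \<le> \<bar>u - v\<bar> + \<bar>u - v\<bar> + \<bar>q0\<bar> * (L4 * \<bar>u - v\<bar>) + \<bar>q1\<bar> * (L5 * \<bar>u - v\<bar>)"
        by (smt (verit, best))
      then show ?thesis by (simp add: algebra_simps)
    qed
    show "f 0 = 0" by (simp add: f_def q0_def cut_power_near_0)
    show "f1 0 = 0" by (simp add: f1_def q1_def cut_power_near_0)
    show "f y = 0" if "y > max b 2" for y
      using that ab by (simp add: f_def pos_square_def cut_power_outside max_absorb1)
    show "(f1 has_real_derivative f2 y) (at y)" if y: "y \<notin> {a, b}" for y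
    proof -
      have hinge: "((\<lambda>y. max 0 (c - y)) has_real_derivative (if y < c then - 1 else 0)) (at y)" if "y \<noteq> c" for c
      proof (cases "y < c")
        case True
        have "((\<lambda>y. c - y) has_real_derivative - 1) (at y)" by (auto intro!: derivative_eq_intros)
        then have "((\<lambda>y. max 0 (c - y)) has_real_derivative - 1) (at y)"
          by (rule has_field_derivative_transform_within_open[of _ _ _ "{..<c}"]) (use True in auto)
        then show ?thesis using True by simp
      next
        case False
        have "((\<lambda>y. 0) has_real_derivative 0) (at y)" by simp
        then have "((\<lambda>y. max 0 (c - y)) has_real_derivative 0) (at y)"
          by (rule has_field_derivative_transform_within_open[of _ _ _ "{c<..}"]) (use False that in auto)
        then show ?thesis using False by simp
      qed
      have "((\<lambda>y. max 0 (a - y) - max 0 (b - y) - q0 * cut_power 4 5 y - q1 * cut_power 5 5 y) has_real_derivative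
          (if y < a then - 1 else 0) - (if y < b then - 1 else 0) - q0 * cut_power 4 6 y - q1 * cut_power 5 6 y) (at y)"
        by (intro DERIV_diff DERIV_cmult hinge cp_der) (use y in auto)
      moreover have "(if y < a then - 1 else 0) - (if y < b then - 1 else 0) = (indicator {a<..<b} y :: real)"
        using y ab by (auto simp: indicator_def)
      ultimately show ?thesis unfolding f1_def[abs_def] f2_def by simp
    qed
    show "f2 \<in> borel_measurable borel" unfolding f2_def[abs_def] by measurable
    show "finite {a, b}" by (intro finite.intros)
  qed
  moreover have "integrable lborel (\<lambda>X. D X * (\<zeta> (fst X) * indicator {a<..<b} (snd X)))"
    by (rule product_integrable[OF \<zeta>, where K = 1 and B = b]) (use ab in \<open>auto simp: indicator_def\<close>)
  ultimately have "0 = (LINT X|lborel. D X * (\<zeta> (fst X) * indicator {a<..<b} (snd X)))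
      - q0 * (LINT X|lborel. D X * (\<zeta> (fst X) * cut_power 4 6 (snd X))) - q1 * (LINT X|lborel. D X * (\<zeta> (fst X) * cut_power 5 6 (snd X)))"
  proof -
    assume int: "integrable lborel (\<lambda>X. D X * (\<zeta> (fst X) * indicator {a<..<b} (snd X)))"
      and zero: "(LINT X|lborel. D X * (\<zeta> (fst X) * f2 (snd X))) = 0"
    have "D X * (\<zeta> (fst X) * f2 (snd X)) = D X * (\<zeta> (fst X) * indicator {a<..<b} (snd X))
        - q0 * (D X * (\<zeta> (fst X) * cut_power 4 6 (snd X))) - q1 * (D X * (\<zeta> (fst X) * cut_power 5 6 (snd X)))" for X
      by (simp add: f2_def algebra_simps)
    then show ?thesis using zero int product_cut_power_integrable[OF \<zeta>] by simp
  qed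
  then show ?thesis by (simp add: product_cut_power_zero[OF \<zeta>])
qed

lemma box_integral_zero: "(LINT X|lborel. D X * indicator (box a b) X) = 0"
proof -
  define c where "c = max 0 (snd a)"
  define S where "S = box (fst a) (fst b)"
  have split: "D X * indicator (box a b) X = D X * (indicator S (fst X) * indicator {c<..<snd b} (snd X))" for X
  proof (cases "snd X > 0")
    case True
    have "X \<in> box a b \<longleftrightarrow> fst X \<in> S \<and> snd X \<in> {snd a<..<snd b}"
      by (auto simp: S_def mem_box Basis_R4 inner_prod_def)
    then show ?thesis using True by (auto simp: c_def indicator_def)
  qed (simp add: D_zero)
  show ?thesis
  proof (cases "c < snd b")
    case False
    then show ?thesis unfolding split by simp
  next
    case True
    define \<theta> where "\<theta> n x i = smooth_step (real n * (x \<bullet> i - fst a \<bullet> i)) * smooth_step (real n * (fst b \<bullet> i - x \<bullet> i))" for n and x i :: "real^3"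
    define \<zeta> where "\<zeta> n x = (\<Prod>i\<in>Basis. \<theta> n x i)" for n x
    have \<zeta>: "smooth (\<zeta> n)" for n
    proof -
      have "smooth (\<lambda>x. \<theta> n x i)" for i
        unfolding \<theta>_def by (rule smooth_mult; rule smooth_comp_real[OF smooth_smooth_step]; intro smooth_intros)
      then show ?thesis unfolding \<zeta>_def[abs_def] by (intro smooth_prod) auto
    qed
    have [measurable]: "\<zeta> n \<in> borel_measurable borel" for n by (rule smooth_imp_measurable[OF \<zeta>])
    have \<theta>_bounds: "0 \<le> \<theta> n x i" "\<theta> n x i \<le> 1" for n x i
      unfolding \<theta>_def using smooth_step_bounds by (auto intro: mult_le_one)
    have \<zeta>1: "\<bar>\<zeta> n x\<bar> \<le> 1" for n x
      unfolding \<zeta>_def using \<theta>_bounds by (simp add: abs_of_nonneg prod_nonneg prod_le_1)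
    have \<zeta>0: "\<zeta> n x = 0" if "x \<notin> S" for n x
    proof -
      obtain i where i: "i \<in> Basis" "x \<bullet> i \<le> fst a \<bullet> i \<or> fst b \<bullet> i \<le> x \<bullet> i"
        using \<open>x \<notin> S\<close> by (auto simp: S_def mem_box not_less)
      then have "real n * (x \<bullet> i - fst a \<bullet> i) \<le> 0 \<or> real n * (fst b \<bullet> i - x \<bullet> i) \<le> 0"
        by (auto simp: mult_nonneg_nonpos)
      then have "\<theta> n x i = 0" by (auto simp: \<theta>_def smooth_step_0)
      then show ?thesis unfolding \<zeta>_def using i(1) by (intro prod_zero) auto
    qed
    have \<zeta>_lim: "(\<lambda>n. \<zeta> n x) \<longlonglongrightarrow> indicator S x" for x
    proof (cases "x \<in> S")
      case True
      have "\<forall>\<^sub>F n in sequentially. smooth_step (real n * d) = 1" if d: "d > 0" for d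
      proof -
        obtain m :: nat where m: "inverse d \<le> real m" using real_arch_simple by blast
        have "smooth_step (real n * d) = 1" if "n \<ge> m" for n
        proof (rule smooth_step_1)
          have "inverse d \<le> real n" using m that by linarith
          then show "1 \<le> real n * d" using d by (simp add: field_simps)
        qed
        then show ?thesis by (auto simp: eventually_sequentially)
      qed
      then have "\<forall>\<^sub>F n in sequentially. \<theta> n x i = 1" if i: "i \<in> Basis" for i
      proof -
        assume ev: "\<And>d. d > 0 \<Longrightarrow> \<forall>\<^sub>F n in sequentially. smooth_step (real n * d) = 1"
        have "x \<bullet> i - fst a \<bullet> i > 0" "fst b \<bullet> i - x \<bullet> i > 0" using True i by (auto simp: S_def mem_box)
        from ev[OF this(1)] ev[OF this(2)] show ?thesis unfolding \<theta>_def by eventually_elim simp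
      qed
      then have "\<forall>\<^sub>F n in sequentially. \<forall>i\<in>Basis. \<theta> n x i = 1" by (intro eventually_ball_finite) auto
      then have "\<forall>\<^sub>F n in sequentially. \<zeta> n x = indicator S x"
        by eventually_elim (use True in \<open>simp add: \<zeta>_def\<close>)
      then show ?thesis by (rule tendsto_eventually)
    qed (simp add: \<zeta>0)
    obtain R where R: "\<And>x. x \<in> S \<Longrightarrow> norm x \<le> R"
      using bounded_box[of "fst a" "fst b"] unfolding S_def bounded_iff by blast
    have [measurable]: "S \<in> sets borel" by (simp add: S_def)
    have "(\<lambda>n. LINT X|lborel. D X * (\<zeta> n (fst X) * indicator {c<..<snd b} (snd X)))
        \<longlonglongrightarrow> (LINT X|lborel. D X * (indicator S (fst X) * indicator {c<..<snd b} (snd X)))"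
    proof (rule integral_dominated_convergence[where w = "\<lambda>X. \<bar>indicator (cball 0 (R + \<bar>snd b\<bar>)) X * D X\<bar>"])
      show "integrable lborel (\<lambda>X. \<bar>indicator (cball 0 (R + \<bar>snd b\<bar>)) X * D X\<bar>)"
        by (intro integrable_mult_left integrable_abs D_cball_integrable)
      show "AE X in lborel. norm (D X * (\<zeta> n (fst X) * indicator {c<..<snd b} (snd X))) \<le> \<bar>indicator (cball 0 (R + \<bar>snd b\<bar>)) X * D X\<bar>" for n
      proof (rule AE_I2)
        fix X :: R4
        show "norm (D X * (\<zeta> n (fst X) * indicator {c<..<snd b} (snd X))) \<le> \<bar>indicator (cball 0 (R + \<bar>snd b\<bar>)) X * D X\<bar>"
        proof (cases "fst X \<in> S \<and> snd X \<in> {c<..<snd b}")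
          case True
          then have "norm X \<le> R + \<bar>snd b\<bar>"
            using norm_Pair_le[of "fst X" "snd X"] R[of "fst X"] by (simp add: c_def)
          then show ?thesis using mult_left_mono[OF \<zeta>1[of n "fst X"], of "\<bar>D X\<bar>"] True by (simp add: abs_mult)
        qed (auto simp: \<zeta>0)
      qed
      show "AE X in lborel. (\<lambda>n. D X * (\<zeta> n (fst X) * indicator {c<..<snd b} (snd X)))
          \<longlonglongrightarrow> D X * (indicator S (fst X) * indicator {c<..<snd b} (snd X))"
        by (intro AE_I2 tendsto_mult_left tendsto_mult_right \<zeta>_lim)
    qed measurable
    moreover have "(LINT X|lborel. D X * (\<zeta> n (fst X) * indicator {c<..<snd b} (snd X))) = 0" for n
    proof (rule slab_test_zero[OF \<zeta>, of R])
      show "\<zeta> n x = 0" if "norm x > R" for x using R[of x] that by (intro \<zeta>0) auto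
    qed (use True in \<open>auto simp: c_def\<close>)
    ultimately have "(\<lambda>n::nat. 0) \<longlonglongrightarrow> (LINT X|lborel. D X * (indicator S (fst X) * indicator {c<..<snd b} (snd X)))"
      by (simp only:)
    then show ?thesis unfolding split by (rule LIMSEQ_unique[OF _ tendsto_const])
  qed
qed

lemma null_solution_zero: "AE X in lborel. D X = 0"
  by (rule AE_zero_if_box_integrals_zero[OF D_loc_integrable box_integral_zero])

end

lemma growth_class_bound:
  assumes "V \<in> growth_class"
  shows "\<exists>C\<ge>0. \<exists>n. AE X in lborel. snd X > 0 \<longrightarrow> \<bar>V X\<bar> \<le> C * (1 + norm X) ^ n"
proof -
  obtain N C Uy LU where ae: "AE X in lebesgue. X \<in> half_space \<longrightarrow>
      \<bar>V X\<bar> + snd X * \<bar>Uy X\<bar> + (snd X)\<^sup>2 * \<bar>LU X\<bar> \<le> C * (1 + norm X powr N)"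
    and N: "N \<ge> (1::real)"
    using assms unfolding growth_class_def by blast
  define n where "n = nat \<lceil>N\<rceil>"
  have n: "N \<le> real n" unfolding n_def by (rule real_nat_ceiling_ge)
  have pw: "1 + r powr N \<le> 2 * (1 + r) ^ n" if r: "r \<ge> 0" for r :: real
  proof -
    have "r powr N \<le> (1 + r) powr N" using r N by (intro powr_mono2) auto
    also have "\<dots> \<le> (1 + r) powr real n" using r n by (intro powr_mono) auto
    also have "\<dots> = (1 + r) ^ n" using r by (simp add: powr_realpow)
    finally have "r powr N \<le> (1 + r) ^ n" .
    moreover have "1 \<le> (1 + r) ^ n" using r by (intro one_le_power) simp
    ultimately show ?thesis by linarith
  qed
  have "AE X in lebesgue. snd X > 0 \<longrightarrow> \<bar>V X\<bar> \<le> 2 * \<bar>C\<bar> * (1 + norm X) ^ n"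
    using ae
  proof eventually_elim
    case (elim X)
    show ?case
    proof
      assume X: "snd X > 0"
      then have "\<bar>V X\<bar> \<le> \<bar>V X\<bar> + snd X * \<bar>Uy X\<bar> + (snd X)\<^sup>2 * \<bar>LU X\<bar>" by simp
      also have "\<dots> \<le> C * (1 + norm X powr N)" using elim X by (simp add: half_space_def)
      also have "\<dots> \<le> \<bar>C\<bar> * (1 + norm X powr N)" by (intro mult_right_mono) auto
      also have "\<dots> \<le> \<bar>C\<bar> * (2 * (1 + norm X) ^ n)" by (intro mult_left_mono pw) auto
      finally show "\<bar>V X\<bar> \<le> 2 * \<bar>C\<bar> * (1 + norm X) ^ n" by simp
    qed
  qed
  then show ?thesis unfolding AE_completion_iff by (intro exI[of _ "2 * \<bar>C\<bar>"] conjI exI[of _ n]) simp_all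
qed

lemma weak_solution_integrable:
  assumes V: "V \<in> L1_loc closed_half_space" and g: "continuous_on UNIV g" "\<And>X. norm X > R \<Longrightarrow> g X = 0"
  shows "integrable lebesgue (\<lambda>X. indicator half_space X * (V X * g X))"
proof -
  have [measurable]: "g \<in> borel_measurable borel" by (rule borel_measurable_continuous_onI[OF g(1)])
  obtain M where M: "\<And>X. \<bar>g X\<bar> \<le> M"
    using continuous_compact_support_bound[of g R 0] g by auto
  define K where "K = closed_half_space \<inter> cball 0 R"
  have cl: "closed closed_half_space"
    unfolding closed_half_space_def by (intro closed_Collect_le continuous_intros)
  then have K: "compact K" "K \<subseteq> closed_half_space" unfolding K_def by (auto intro: closed_Int_compact)
  then have int: "integrable lebesgue (\<lambda>X. indicator K X * V X)"
    using V unfolding L1_loc_def set_integrable_def by auto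
  define h where "h X = indicator half_space X * g X" for X
  have [measurable]: "h \<in> borel_measurable borel" unfolding h_def by measurable
  have eq: "indicator half_space X * (V X * g X) = indicator K X * V X * h X" for X
    using g(2)[of X] by (auto simp: K_def h_def half_space_def closed_half_space_def indicator_def)
  have hl: "h \<in> borel_measurable lebesgue" by (rule measurable_completion) simp
  have "integrable lebesgue (\<lambda>X. indicator K X * V X * h X)"
  proof (rule Bochner_Integration.integrable_bound)
    show "integrable lebesgue (\<lambda>X. M * (indicator K X * V X))" using int by simp
    show "(\<lambda>X. indicator K X * V X * h X) \<in> borel_measurable lebesgue"
      by (rule borel_measurable_times[OF borel_measurable_integrable[OF int] hl])
    have "\<bar>h X\<bar> \<le> \<bar>M\<bar>" for X using M[of X] by (auto simp: h_def indicator_def)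
    then show "AE X in lebesgue. norm (indicator K X * V X * h X) \<le> norm (M * (indicator K X * V X))"
      by (intro AE_I2) (simp add: abs_mult mult.commute mult_right_mono)
  qed
  then show ?thesis unfolding eq .
qed

lemma growth_class_weak_solution_unique:
  assumes V: "V \<in> growth_class" "weak_solution u V" and W: "W \<in> growth_class" "weak_solution u W"
  shows "AE X in lebesgue. X \<in> half_space \<longrightarrow> V X = W X"
proof -
  have loc: "V \<in> L1_loc closed_half_space" "W \<in> L1_loc closed_half_space"
    using V(1) W(1) by (auto simp: growth_class_def)
  obtain C1 n1 where b1: "C1 \<ge> 0" "AE X in lborel. snd X > 0 \<longrightarrow> \<bar>V X\<bar> \<le> C1 * (1 + norm X) ^ n1"
    using growth_class_bound[OF V(1)] by blast
  obtain C2 n2 where b2: "C2 \<ge> 0" "AE X in lborel. snd X > 0 \<longrightarrow> \<bar>W X\<bar> \<le> C2 * (1 + norm X) ^ n2"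
    using growth_class_bound[OF W(1)] by blast
  define C n where "C = C1 + C2" and "n = max n1 n2"
  have "closed closed_half_space"
    unfolding closed_half_space_def by (intro closed_Collect_le continuous_intros)
  then have "(\<lambda>X. indicator closed_half_space X * V X - indicator closed_half_space X * W X) \<in> borel_measurable lebesgue"
    by (intro borel_measurable_diff L1_loc_closed_measurable loc)
  from completion_ex_borel_measurable_real[OF this]
  obtain E where E: "E \<in> borel_measurable lborel"
    "AE X in lborel. indicator closed_half_space X * V X - indicator closed_half_space X * W X = E X" by blast
  have [measurable]: "E \<in> borel_measurable borel" using E(1) by simp
  define D where "D X = (if snd X > 0 \<and> \<bar>E X\<bar> \<le> C * (1 + norm X) ^ n then E X else 0)" for X
  have [measurable]: "D \<in> borel_measurable borel" unfolding D_def by measurable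
  have ae: "AE X in lborel. snd X > 0 \<longrightarrow> D X = V X - W X"
    using E(2) b1(2) b2(2)
  proof eventually_elim
    case (elim X)
    show ?case
    proof
      assume X: "snd X > 0"
      then have EX: "E X = V X - W X" using elim(1) by (simp add: closed_half_space_def)
      have "\<bar>V X - W X\<bar> \<le> C1 * (1 + norm X) ^ n1 + C2 * (1 + norm X) ^ n2"
        using elim(2,3) X by linarith
      also have "\<dots> \<le> C1 * (1 + norm X) ^ n + C2 * (1 + norm X) ^ n"
        using b1(1) b2(1) unfolding n_def by (intro add_mono mult_left_mono power_increasing) auto
      finally have "\<bar>E X\<bar> \<le> C * (1 + norm X) ^ n" unfolding EX by (simp add: C_def algebra_simps)
      then show "D X = V X - W X" using X by (simp add: D_def EX)
    qed
  qed
  interpret null_solution D C n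
  proof
    show "D \<in> borel_measurable borel" by measurable
    show "\<bar>D X\<bar> \<le> C * (1 + norm X) ^ n" for X
      using b1(1) b2(1) by (simp add: D_def C_def)
    show "D X = 0" if "snd X \<le> 0" for X using that by (simp add: D_def)
  next
    fix \<phi> assume \<phi>: "\<phi> \<in> boundary_test_functions"
    then have sm: "smooth \<phi>" and cc: "\<phi> \<in> Cc_infinity UNIV"
      by (auto simp: boundary_test_functions_def Cc_infinity_def)
    obtain R where R: "\<And>X. norm X > R \<Longrightarrow> \<phi> X = 0" using Cc_infinity_support[OF cc] by blast
    define g where "g = laplacian (laplacian \<phi>)"
    have sg: "smooth g" unfolding g_def by (intro smooth_intros sm)
    have [measurable]: "g \<in> borel_measurable borel" by (rule smooth_imp_measurable[OF sg])
    have g0: "g X = 0" if "norm X > R" for X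
      unfolding g_def using that R by (auto intro!: laplacian_outside[of R])
    note int = weak_solution_integrable[OF _ smooth_imp_continuous[OF sg] g0]
    have m: "(\<lambda>X. D X * g X) \<in> borel_measurable lborel" by measurable
    have "(LINT X:half_space|lebesgue. V X * g X) = (LINT X:half_space|lebesgue. W X * g X)"
      using V(2) W(2) \<phi> by (simp add: weak_solution_def g_def)
    then have "0 = (LINT X|lebesgue. indicator half_space X * (V X * g X) - indicator half_space X * (W X * g X))"
      unfolding set_lebesgue_integral_def using int[OF loc(1)] int[OF loc(2)] by simp
    also have "\<dots> = (LINT X|lebesgue. D X * g X)"
    proof (rule integral_cong_AE)
      show "(\<lambda>X. indicator half_space X * (V X * g X) - indicator half_space X * (W X * g X)) \<in> borel_measurable lebesgue"
        using int[OF loc(1)] int[OF loc(2)] by (intro borel_measurable_diff borel_measurable_integrable)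
      show "(\<lambda>X. D X * g X) \<in> borel_measurable lebesgue" by (rule measurable_completion[OF m])
      show "AE X in lebesgue. indicator half_space X * (V X * g X) - indicator half_space X * (W X * g X) = D X * g X"
        unfolding AE_completion_iff using ae
      proof eventually_elim
        case (elim X)
        then show ?case by (cases "snd X > 0") (simp_all add: half_space_def D_def left_diff_distrib)
      qed
    qed
    also have "\<dots> = (LINT X|lborel. D X * g X)" by (rule integral_completion[OF m])
    finally show "(LINT X|lborel. D X * laplacian (laplacian \<phi>) X) = 0" by (simp add: g_def)
  next
    fix t :: real assume t: "t > 0"
    have "AE X in lborel. \<forall>k. snd (X + (0, real k * t)) > 0 \<longrightarrow>
        D (X + (0, real k * t)) = V (X + (0, real k * t)) - W (X + (0, real k * t))"
      by (rule AE_lborel_translates[OF ae])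
    then show "AE X in lborel. snd X > 0 \<longrightarrow> (\<lambda>k. D (X + (0, real k * t)) / (real k)\<^sup>2) \<longlonglongrightarrow> 0"
    proof eventually_elim
      case (elim X)
      show ?case
      proof
        assume X: "snd X > 0"
        define y where "y = snd X"
        define z where "z k = y + real k * t" for k
        have z: "z k > 0" for k using X t by (simp add: z_def y_def add_pos_nonneg)
        have shift: "X + (0, real k * t) = (fst X, z k)" for k by (simp add: z_def y_def prod_eq_iff)
        have D_eq: "D (fst X, z k) = V (fst X, z k) - W (fst X, z k)" for k
          using elim[rule_format, of k] z unfolding shift by simp
        have z_lim: "filterlim z at_top sequentially"
          unfolding z_def[abs_def] using t
          by (intro filterlim_tendsto_add_at_top[OF tendsto_const] filterlim_at_top_mult_tendsto_pos[OF tendsto_const] filterlim_real_sequentially)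
        have "((\<lambda>y. V (fst X, y) / y\<^sup>2) \<longlongrightarrow> 0) at_top" "((\<lambda>y. W (fst X, y) / y\<^sup>2) \<longlongrightarrow> 0) at_top"
          using V(1) W(1) by (auto simp: growth_class_def)
        from tendsto_diff[OF filterlim_compose[OF this(1) z_lim] filterlim_compose[OF this(2) z_lim]]
        have "(\<lambda>k. D (fst X, z k) / (z k)\<^sup>2) \<longlonglongrightarrow> 0" by (simp add: D_eq diff_divide_distrib)
        moreover have "(\<lambda>k. (y / real k + t)\<^sup>2) \<longlonglongrightarrow> (0 + t)\<^sup>2"
          by (intro tendsto_power tendsto_add lim_const_over_n tendsto_const)
        ultimately have "(\<lambda>k. D (fst X, z k) / (z k)\<^sup>2 * (y / real k + t)\<^sup>2) \<longlonglongrightarrow> 0 * (0 + t)\<^sup>2" by (rule tendsto_mult)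
        moreover have "\<forall>\<^sub>F k in sequentially. D (fst X, z k) / (z k)\<^sup>2 * (y / real k + t)\<^sup>2 = D (fst X, z k) / (real k)\<^sup>2"
          using eventually_gt_at_top[of 0]
        proof eventually_elim
          case (elim k)
          then have "y / real k + t = z k / real k" by (simp add: z_def field_simps)
          then show ?case using z[of k] by (simp add: power_divide)
        qed
        ultimately have "(\<lambda>k. D (fst X, z k) / (real k)\<^sup>2) \<longlonglongrightarrow> 0 * (0 + t)\<^sup>2" by (rule Lim_transform_eventually)
        then show "(\<lambda>k. D (X + (0, real k * t)) / (real k)\<^sup>2) \<longlonglongrightarrow> 0" by (simp add: shift)
      qed
    qed
  qed
  show ?thesis
    unfolding AE_completion_iff using ae null_solution_zero
    by eventually_elim (simp add: half_space_def)
qed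

theorem proposition2p1:
  fixes u :: "real^3 \<Rightarrow> real"
  assumes "u \<in> L\<^sub>6"
  shows "(\<forall>x y. y > 0 \<longrightarrow> integrable lebesgue (\<lambda>x'. poisson_kernel (x - x', y) * u x'))
    \<and> poisson_extension u \<in> L1_loc closed_half_space
    \<and> weak_solution u (poisson_extension u)
    \<and> (\<forall>V W. V \<in> growth_class \<and> weak_solution u V \<and> W \<in> growth_class \<and> weak_solution u W \<longrightarrow>
          (AE X in lebesgue. X \<in> half_space \<longrightarrow> V X = W X))
    \<and> (poisson_extension u \<in> growth_class \<longrightarrow>
        (\<forall>V. V \<in> growth_class \<and> weak_solution u V \<longrightarrow>
          (AE X in lebesgue. X \<in> half_space \<longrightarrow> V X = poisson_extension u X)))"
proof (intro conjI allI impI)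
  show "integrable lebesgue (\<lambda>x'. poisson_kernel (x - x', y) * u x')" if "y > 0" for x y
    by (rule poisson_kernel_integrable[OF assms that])
  show "poisson_extension u \<in> L1_loc closed_half_space" "weak_solution u (poisson_extension u)"
    by (rule poisson_extension_L1_loc_weak_solution[OF assms])+
  show "AE X in lebesgue. X \<in> half_space \<longrightarrow> V X = W X"
    if "V \<in> growth_class \<and> weak_solution u V \<and> W \<in> growth_class \<and> weak_solution u W" for V W
    using that growth_class_weak_solution_unique by blast
  show "AE X in lebesgue. X \<in> half_space \<longrightarrow> V X = poisson_extension u X"
    if "poisson_extension u \<in> growth_class" "V \<in> growth_class \<and> weak_solution u V" for V
    using that growth_class_weak_solution_unique poisson_extension_L1_loc_weak_solution(2)[OF assms] by blast
qed

end
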